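(* Let $n\ge 2$ be an integer. (i) For any $d\ge 4$, $\mu(n,d)=2n+1$. (ii) For any $d\ge 4$, $\rho(n,d)=\binom{n+d-1}{n-1}$. (iii) For any $d\ge 4$, $n=3$ and any integer $r$ with $\mu(3,d)=7\le r\le\rho(3,d)=\binom{d+2}{2}$, there exists $I\in\mathcal{T}(3,d)$ with $\mu(I)=r$.
   Context: $k$ is an algebraically closed field of characteristic zero and $R=k[x_0,\dots,x_n]$. Togliatti systems. Let $I\subset R$ be a homogeneous artinian ideal generated by $r$ forms $F_1,\dots,F_r$ of degree $d$, with $r\le\binom{n+d-1}{n-1}$. $I$ is a Togliatti system (of forms of degree $d$) if it satisfies the following (known to be equivalent) conditions: (1) $I$ fails the weak Lefschetz property in degree $d-1$, i.e. for a general linear form $L$ the multiplication map $\times L:(R/I)_{d-1}\to(R/I)_d$ does not have maximal rank (is neither injective nor surjective); (2) $F_1,\dots,F_r$ become $k$-linearly dependent on a general hyperplane of $\mathbb{P}^n$; (3) the variety $X$ associated to $I$ satisfies at least one Laplace equation of order $d-1$, i.e. its $(d-1)$-st osculating space at a general point has dimension less than $\binom{n+d-1}{d-1}-1$ (for monomial $I$, $X$ is the closure of the image of the rational map from $\mathbb{P}^n$ given by all monomials of degree $d$ not in $I$). It is monomial if $I$ is generated by monomials. A monomial Togliatti system is minimal if, $I$ being generated by monomials $m_1,\dots,m_r$ of degree $d$, no proper subset of $\{m_1,\dots,m_r\}$ generates a monomial Togliatti system. $\mu(I)$ is the minimal number of generators of $I$. $\mathcal{T}(n,d)$ is the set of all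 minimal monomial Togliatti systems $I\subset k[x_0,\dots,x_n]$ of forms of degree $d$ (no smoothness is required). $\mu(n,d)$ and $\rho(n,d)$ are respectively the minimum and the maximum of $\{\mu(I)\mid I\in\mathcal{T}(n,d)\}$. *)

theory Defs
  imports
    "HOL-Algebra.QuotRing"
    "HOL-Library.Poly_Mapping"
    "HOL-Library.FuncSet"
    "HOL-Computational_Algebra.Polynomial"
begin

section \<open>The polynomial ring in $n+1$ variables\<close>

text \<open>An exponent vector is a finitely supported map from variable indices to exponents, a
  polynomial a finitely supported map from exponent vectors to coefficients; with the
  convolution product of \<^theory>\<open>HOL-Library.Poly_Mapping\<close> this is a polynomial ring in
  the variables $x_0, x_1, \ldots$, of which \<open>poly_ring n\<close> is the subring in $x_0, \ldots, x_n$.\<close>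

type_synonym 'k mpoly = "(nat \<Rightarrow>\<^sub>0 nat) \<Rightarrow>\<^sub>0 'k"

definition poly_ring :: "nat \<Rightarrow> 'k::comm_ring_1 mpoly ring" where
  "poly_ring n =
     \<lparr>carrier = {p. \<forall>m\<in>Poly_Mapping.keys p. Poly_Mapping.keys m \<subseteq> {..n}},
      monoid.mult = (*), one = 1, zero = 0, add = (+)\<rparr>"

definition mon_degree :: "(nat \<Rightarrow>\<^sub>0 nat) \<Rightarrow> nat" where
  "mon_degree m = (\<Sum>i\<in>Poly_Mapping.keys m. Poly_Mapping.lookup m i)"

text \<open>As usual the zero polynomial counts as a form of every degree.\<close>

definition forms :: "nat \<Rightarrow> nat \<Rightarrow> 'k::comm_ring_1 mpoly set" where
  "forms n d =
     {p \<in> carrier (poly_ring n). \<forall>m\<in>Poly_Mapping.keys p. mon_degree m = d}"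

definition monomials :: "nat \<Rightarrow> nat \<Rightarrow> 'k::comm_ring_1 mpoly set" where
  "monomials n d =
     {Poly_Mapping.single m 1 | m. Poly_Mapping.keys m \<subseteq> {..n} \<and> mon_degree m = d}"

definition linear_form :: "nat \<Rightarrow> (nat \<Rightarrow> 'k) \<Rightarrow> 'k::comm_ring_1 mpoly" where
  "linear_form n a = (\<Sum>i\<le>n. Poly_Mapping.single (Poly_Mapping.single i 1) (a i))"

definition poly_eval :: "(nat \<Rightarrow> 'k) \<Rightarrow> 'k::comm_ring_1 mpoly \<Rightarrow> 'k" where
  "poly_eval a p =
     (\<Sum>m\<in>Poly_Mapping.keys p. Poly_Mapping.lookup p m *
        (\<Prod>i\<in>Poly_Mapping.keys m. a i ^ Poly_Mapping.lookup m i))"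


section \<open>General linear forms\<close>

definition affine_space :: "nat \<Rightarrow> (nat \<Rightarrow> 'k) set" where
  "affine_space n = {..n} \<rightarrow>\<^sub>E UNIV"

definition zariski_open :: "nat \<Rightarrow> (nat \<Rightarrow> 'k::comm_ring_1) set \<Rightarrow> bool" where
  "zariski_open n U \<longleftrightarrow>
     (\<exists>S \<subseteq> carrier (poly_ring n). U = {a \<in> affine_space n. \<exists>f\<in>S. poly_eval a f \<noteq> 0})"

text \<open>A property holds for a general linear form if it holds for all linear forms in some
  nonempty Zariski open subset of the coefficient space $k^{n+1}$.\<close>

definition for_general_linear_form :: "nat \<Rightarrow> ('k::comm_ring_1 mpoly \<Rightarrow> bool) \<Rightarrow> bool" where
  "for_general_linear_form n P \<longleftrightarrow>
     (\<exists>U. zariski_open n U \<and> U \<noteq> {} \<and> (\<forall>a\<in>U. P (linear_form n a)))"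


section \<open>Artinian ideals and the weak Lefschetz property\<close>

definition artinian_ring :: "('a, 'b) ring_scheme \<Rightarrow> bool" where
  "artinian_ring Q \<longleftrightarrow>
     ring Q \<and>
     (\<forall>J :: nat \<Rightarrow> 'a set. (\<forall>i. ideal (J i) Q \<and> J (Suc i) \<subseteq> J i) \<longrightarrow> (\<exists>N. \<forall>i\<ge>N. J i = J N))"

definition artinian_ideal :: "nat \<Rightarrow> 'k::comm_ring_1 mpoly set \<Rightarrow> bool" where
  "artinian_ideal n I \<longleftrightarrow> ideal I (poly_ring n) \<and> artinian_ring (poly_ring n Quot I)"

text \<open>The graded piece $(R/I)_j$, for a homogeneous ideal $I$.\<close>

definition quot_component :: "nat \<Rightarrow> 'k::comm_ring_1 mpoly set \<Rightarrow> nat \<Rightarrow> 'k mpoly set set" where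
  "quot_component n I j = (\<lambda>f. I +>\<^bsub>poly_ring n\<^esub> f) ` forms n j"

definition mult_by ::
    "nat \<Rightarrow> 'k::comm_ring_1 mpoly set \<Rightarrow> 'k mpoly \<Rightarrow> 'k mpoly set \<Rightarrow> 'k mpoly set" where
  "mult_by n I L c = (I +>\<^bsub>poly_ring n\<^esub> L) \<otimes>\<^bsub>poly_ring n Quot I\<^esub> c"

definition mult_max_rank :: "nat \<Rightarrow> 'k::comm_ring_1 mpoly set \<Rightarrow> nat \<Rightarrow> 'k mpoly \<Rightarrow> bool" where
  "mult_max_rank n I j L \<longleftrightarrow>
     inj_on (mult_by n I L) (quot_component n I j) \<or>
     mult_by n I L ` quot_component n I j = quot_component n I (Suc j)"

definition fails_WLP_in_degree :: "nat \<Rightarrow> 'k::comm_ring_1 mpoly set \<Rightarrow> nat \<Rightarrow> bool" where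
  "fails_WLP_in_degree n I j \<longleftrightarrow> for_general_linear_form n (\<lambda>L. \<not> mult_max_rank n I j L)"


section \<open>Togliatti systems\<close>

definition togliatti_system :: "nat \<Rightarrow> nat \<Rightarrow> 'k::comm_ring_1 mpoly set \<Rightarrow> bool" where
  "togliatti_system n d I \<longleftrightarrow>
     artinian_ideal n I \<and>
     (\<exists>F \<subseteq> forms n d. finite F \<and> card F \<le> (n + d - 1) choose (n - 1) \<and>
        I = Idl\<^bsub>poly_ring n\<^esub> F) \<and>
     fails_WLP_in_degree n I (d - 1)"

text \<open>The generating set \<open>M\<close> below is determined by $I$: it consists of all the monomials of
  degree $d$ in $I$.\<close>

definition minimal_monomial_togliatti :: "nat \<Rightarrow> nat \<Rightarrow> 'k::comm_ring_1 mpoly set \<Rightarrow> bool" where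
  "minimal_monomial_togliatti n d I \<longleftrightarrow>
     togliatti_system n d I \<and>
     (\<exists>M \<subseteq> monomials n d. I = Idl\<^bsub>poly_ring n\<^esub> M \<and>
        (\<forall>M'. M' \<subset> M \<longrightarrow> \<not> togliatti_system n d (Idl\<^bsub>poly_ring n\<^esub> M')))"

definition min_monomial_togliatti_systems :: "nat \<Rightarrow> nat \<Rightarrow> 'k::comm_ring_1 mpoly set set" where
  "min_monomial_togliatti_systems n d = {I. minimal_monomial_togliatti n d I}"

definition num_generators :: "nat \<Rightarrow> 'k::comm_ring_1 mpoly set \<Rightarrow> nat" where
  "num_generators n I =
     (LEAST r. \<exists>G \<subseteq> carrier (poly_ring n). finite G \<and> card G = r \<and> Idl\<^bsub>poly_ring n\<^esub> G = I)"

text \<open>The type argument carries the ground field.\<close>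

definition togliatti_mu :: "'k::comm_ring_1 itself \<Rightarrow> nat \<Rightarrow> nat \<Rightarrow> nat" where
  "togliatti_mu k n d =
     Min (num_generators n ` (min_monomial_togliatti_systems n d :: 'k mpoly set set))"

definition togliatti_rho :: "'k::comm_ring_1 itself \<Rightarrow> nat \<Rightarrow> nat \<Rightarrow> nat" where
  "togliatti_rho k n d =
     Max (num_generators n ` (min_monomial_togliatti_systems n d :: 'k mpoly set set))"

end

theory Submission
  imports Defs
begin

text \<open>For a set of degree-$d$ monomials $A$ containing all pure powers, with at most
  $\binom{n+d-1}{n-1}$ elements, rescaling the variables turns a general linear form into
  $L = x_0 + \dots + x_n$, and a dimension count turns the failure of maximal rank into the existence
  of a form $G \neq 0$ of degree $d-1$ such that all monomials of $L G$ lie in $A$.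

  For such $G$ at least $n$ monomials of $L G$ are not pure powers.  This goes by induction on the
  number of variables: if a variable divides $G$, count the monomials of $L G$; otherwise set
  variables to $0$, down to three variables, where $L = 0$ turns the claim into a relation between
  $t^d$, $1$, $(1+t)^d$ and $t^a (1+t)^c$.

  If $L G$ spans the space of all such products supported in $A$ and together with the pure powers
  exhausts $A$, then $A$ is minimal.  The required examples are
  $L G = \nu\,(L'^e - (-x_n)^e - L E)$ with $L' = x_0 + \dots + x_{n-1}$ and a monomial $\nu$, where
  $E$ is a truncated and perturbed binomial expansion in $x_0$ and $x_1 + x_2$: the monomials of
  $L'^e$ cancelled by $L' E$ outnumber those added by $x_n E$ by any prescribed small amount.
  Since $x_n = -L'$ modulo $L$, a product supported in $A$ is determined by the coefficient of
  $\nu x_n^e$.\<close>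

section \<open>Polynomials, monomials and substitution\<close>

text \<open>The bound \<open>(n + d - 1) choose (n - 1)\<close> is the difference between the
  dimensions of the forms of degree d and of degree d - 1; under it, failing to be injective is all
  that failing to have maximal rank means. The lower bound 2n + 1 consists of n + 1 pure powers and
  n further monomials. In degree 3 it breaks down: x^3 + y^3 + z^3 - 3xyz is divisible by x + y + z,
  and d >= 4 excludes exactly this.

  Minimality is never tested on single subsets. A smaller system would still contain the pure
  powers, which the artinian condition forces, and all monomials of some product L G; so it suffices
  that every product supported in A involves all of A apart from pure powers.

  With E = 0 the sizes obtained jump with e. A layer of fixed degree j in x_1, x_2 has j + 1
  monomials in (x_0 + x_1 + x_2)^e, while cancelling it costs only j monomials of x_n E, so each
  cancelled layer lowers the size by exactly one. The factor x_0^b then supplies the one size per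
  jump that the layers cannot reach.\<close>

lemma lookup_single_times_add:
  fixes p :: "'k::comm_ring_1 mpoly"
  shows "Poly_Mapping.lookup (Poly_Mapping.single u c * p) (u + m) = c * Poly_Mapping.lookup p m"
  by (simp add: lookup_mult lookup_single when_mult mult_when)

lemma poly_mapping_sum_single:
  fixes p :: "'a \<Rightarrow>\<^sub>0 'b::comm_monoid_add"
  assumes "finite K" "Poly_Mapping.keys p \<subseteq> K"
  shows "p = (\<Sum>m\<in>K. Poly_Mapping.single m (Poly_Mapping.lookup p m))"
proof (rule poly_mapping_eqI)
  fix k
  show "Poly_Mapping.lookup p k =
    Poly_Mapping.lookup (\<Sum>m\<in>K. Poly_Mapping.single m (Poly_Mapping.lookup p m)) k"
    using assms by (auto simp: lookup_sum lookup_single when_def sum.delta in_keys_iff)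
qed

lemma lookup_single_times_eq_0:
  fixes p :: "'k::comm_ring_1 mpoly"
  assumes "\<And>v. m \<noteq> u + v"
  shows "Poly_Mapping.lookup (Poly_Mapping.single u c * p) m = 0"
proof -
  have "m \<notin> Poly_Mapping.keys (Poly_Mapping.single u c * p)"
    using keys_mult[of "Poly_Mapping.single u c" p] assms by (auto split: if_splits)
  then show ?thesis by (simp add: in_keys_iff)
qed

lemma keys_add_nat:
  fixes u v :: "'a \<Rightarrow>\<^sub>0 nat"
  shows "Poly_Mapping.keys (u + v) = Poly_Mapping.keys u \<union> Poly_Mapping.keys v"
  by (auto simp: in_keys_iff lookup_add)

definition var :: "nat \<Rightarrow> 'k::comm_ring_1 mpoly" where
  "var i = Poly_Mapping.single (Poly_Mapping.single i 1) 1"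

lemma single_minus_single:
  fixes m :: "nat \<Rightarrow>\<^sub>0 nat"
  assumes "i \<in> Poly_Mapping.keys m"
  shows "Poly_Mapping.single i 1 + (m - Poly_Mapping.single i 1) = m"
  using assms by (intro poly_mapping_eqI)
    (auto simp: lookup_add lookup_minus lookup_single when_def in_keys_iff)

lemma lookup_var_times:
  "Poly_Mapping.lookup (var i * p) m =
    (if i \<in> Poly_Mapping.keys m then Poly_Mapping.lookup p (m - Poly_Mapping.single i 1) else 0)"
proof (cases "i \<in> Poly_Mapping.keys m")
  case True
  then show ?thesis
    using lookup_single_times_add[of "Poly_Mapping.single i 1" 1 p "m - Poly_Mapping.single i 1"]
    by (simp only: single_minus_single var_def if_True mult_1)
next
  case False
  then have "m \<noteq> Poly_Mapping.single i 1 + v" for v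
    by (auto simp: keys_add_nat)
  then show ?thesis
    using False by (simp add: var_def lookup_single_times_eq_0)
qed

definition var_sum :: "nat set \<Rightarrow> 'k::comm_ring_1 mpoly" where
  "var_sum V = (\<Sum>i\<in>V. var i)"

lemma lookup_var_sum_times:
  assumes "finite V"
  shows "Poly_Mapping.lookup (var_sum V * p) m =
    (\<Sum>i\<in>V \<inter> Poly_Mapping.keys m. Poly_Mapping.lookup p (m - Poly_Mapping.single i 1))"
  using assms
  by (simp add: var_sum_def sum_distrib_right lookup_sum lookup_var_times sum.inter_restrict
      del: One_nat_def)

definition mons :: "nat set \<Rightarrow> nat \<Rightarrow> (nat \<Rightarrow>\<^sub>0 nat) set" where
  "mons V d = {m. Poly_Mapping.keys m \<subseteq> V \<and> mon_degree m = d}"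

lemma mon_degree_eq_sum:
  assumes "finite V" "Poly_Mapping.keys m \<subseteq> V"
  shows "mon_degree m = (\<Sum>i\<in>V. Poly_Mapping.lookup m i)"
  unfolding mon_degree_def using assms
  by (intro sum.mono_neutral_left) (auto simp: in_keys_iff)

lemma mon_degree_add [simp]: "mon_degree (u + v) = mon_degree u + mon_degree v"
  using mon_degree_eq_sum[of "Poly_Mapping.keys u \<union> Poly_Mapping.keys v"]
  by (simp add: keys_add_nat lookup_add sum.distrib)

lemma mon_degree_single [simp]: "mon_degree (Poly_Mapping.single i c) = c"
  by (cases "c = 0") (simp_all add: mon_degree_def)

lemma mon_degree_zero [simp]: "mon_degree 0 = 0"
  by (simp add: mon_degree_def)

lemma lookup_le_mon_degree: "Poly_Mapping.lookup m i \<le> mon_degree m"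
  by (cases "i \<in> Poly_Mapping.keys m")
    (auto simp: mon_degree_def in_keys_iff intro!: member_le_sum)

lemma mon_degree_minus_single:
  assumes "i \<in> Poly_Mapping.keys m"
  shows "mon_degree (m - Poly_Mapping.single i 1) = mon_degree m - 1"
  using mon_degree_add[of "Poly_Mapping.single i 1" "m - Poly_Mapping.single i 1"]
  by (simp only: single_minus_single[OF assms] mon_degree_single diff_add_inverse)

lemma single_of_mon_degree_le:
  assumes "mon_degree m = d" "d \<le> Poly_Mapping.lookup m i"
  shows "m = Poly_Mapping.single i d"
proof (rule poly_mapping_eqI)
  fix j
  have fin: "finite (insert j (insert i (Poly_Mapping.keys m)))" by simp
  have "mon_degree m = (\<Sum>l\<in>insert j (insert i (Poly_Mapping.keys m)). Poly_Mapping.lookup m l)"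
    using fin by (intro mon_degree_eq_sum) auto
  also have "\<dots> \<ge> (\<Sum>l\<in>{i, j}. Poly_Mapping.lookup m l)"
    by (intro sum_mono2) auto
  finally have "(\<Sum>l\<in>{i, j}. Poly_Mapping.lookup m l) \<le> d" using assms by simp
  with assms lookup_le_mon_degree[of m i] show "Poly_Mapping.lookup m j = Poly_Mapping.lookup (Poly_Mapping.single i d) j"
    by (cases "i = j") (auto simp: lookup_single)
qed

text \<open>Sorting by the exponent \<open>d - j\<close> of the new variable turns the count of
  monomials into a sum over \<open>j\<close>, which the hockey-stick identity
  \<open>sum_choose_lower\<close> evaluates.\<close>

lemma mons_insert:
  assumes "finite V" "i \<notin> V"
  shows "mons (insert i V) d =
    (\<Union>j\<in>{..d}. (\<lambda>m. m + Poly_Mapping.single i (d - j)) ` mons V j)" (is "_ = ?R")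
proof
  show "mons (insert i V) d \<subseteq> ?R"
  proof
    fix m assume m: "m \<in> mons (insert i V) d"
    define m' where "m' = m - Poly_Mapping.single i (Poly_Mapping.lookup m i)"
    have eq: "m = m' + Poly_Mapping.single i (Poly_Mapping.lookup m i)"
      by (intro poly_mapping_eqI) (auto simp: m'_def lookup_add lookup_minus lookup_single when_def)
    have "mon_degree m = mon_degree m' + Poly_Mapping.lookup m i"
      using arg_cong[OF eq, of mon_degree] by simp
    moreover have "Poly_Mapping.keys m' \<subseteq> V"
      using m unfolding mons_def subset_iff
      by (auto simp: m'_def in_keys_iff lookup_minus lookup_single when_def split: if_splits)
    ultimately have m': "m' \<in> mons V (d - Poly_Mapping.lookup m i)" and le: "Poly_Mapping.lookup m i \<le> d"
      using m by (auto simp: mons_def)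
    have "m = m' + Poly_Mapping.single i (d - (d - Poly_Mapping.lookup m i))"
      using eq le by simp
    with m' show "m \<in> ?R"
      by (intro UN_I[of "d - Poly_Mapping.lookup m i"]) (simp, blast)
  qed
  show "?R \<subseteq> mons (insert i V) d"
  proof
    fix m assume "m \<in> ?R"
    then obtain j m' where "j \<le> d" "m' \<in> mons V j" "m = m' + Poly_Mapping.single i (d - j)"
      by blast
    then show "m \<in> mons (insert i V) d"
      unfolding mons_def by (auto simp: keys_add_nat split: if_splits)
  qed
qed

lemma mons_singleton: "mons {i} d = {Poly_Mapping.single i d}"
proof -
  have "m = Poly_Mapping.single i d" if "m \<in> mons {i} d" for m
    using that mon_degree_eq_sum[of "{i}" m]
    by (intro single_of_mon_degree_le) (auto simp: mons_def)
  then show ?thesis by (auto simp: mons_def split: if_splits)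
qed

lemma finite_card_mons:
  assumes "finite V" "V \<noteq> {}"
  shows "finite (mons V d) \<and> card (mons V d) = (card V - 1 + d) choose d"
  using assms
proof (induction V arbitrary: d rule: finite_ne_induct)
  case (singleton i)
  then show ?case by (simp add: mons_singleton)
next
  case (insert i V)
  have inj: "inj_on (\<lambda>m. m + Poly_Mapping.single i (d - j)) (mons V j)" for j
    by (auto intro: inj_onI)
  have disj: "((\<lambda>m. m + Poly_Mapping.single i (d - j)) ` mons V j) \<inter>
      ((\<lambda>m. m + Poly_Mapping.single i (d - j')) ` mons V j') = {}" if "j \<noteq> j'" "j \<le> d" "j' \<le> d" for j j'
  proof -
    have "Poly_Mapping.lookup m i = 0" if "m \<in> mons V k" for m k
      using that insert.hyps by (auto simp: mons_def simp flip: not_in_keys_iff_lookup_eq_zero)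
    then have "Poly_Mapping.lookup (m + Poly_Mapping.single i (d - j)) i = d - j"
        "Poly_Mapping.lookup (m + Poly_Mapping.single i (d - j')) i = d - j'"
      if "m \<in> mons V k" for m k
      using that by (simp_all add: lookup_add)
    moreover have "d - j \<noteq> d - j'"
      using \<open>j \<noteq> j'\<close> \<open>j \<le> d\<close> \<open>j' \<le> d\<close> by linarith
    ultimately have "m + Poly_Mapping.single i (d - j) \<noteq> m' + Poly_Mapping.single i (d - j')"
      if "m \<in> mons V j" "m' \<in> mons V j'" for m m'
      using that by metis
    then show ?thesis by blast
  qed
  have "card (mons (insert i V) d) =
      (\<Sum>j\<le>d. card ((\<lambda>m. m + Poly_Mapping.single i (d - j)) ` mons V j))"
    unfolding mons_insert[OF insert.hyps(1,3)]
    by (rule card_UN_disjoint) (use insert.IH disj in auto)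
  also have "\<dots> = (\<Sum>j\<le>d. card (mons V j))"
    by (simp add: card_image inj)
  also have "\<dots> = (\<Sum>j\<le>d. (card V - 1 + j) choose j)"
    using insert.IH by simp
  also have "\<dots> = (card V + d) choose d"
  proof -
    have "0 < card V" using insert.hyps by (simp add: card_gt_0_iff)
    then have "Suc (card V - 1 + d) = card V + d" by linarith
    then show ?thesis using sum_choose_lower[of "card V - 1" d] by (simp only:)
  qed
  finally show ?case
    using insert by (auto simp: mons_insert)
qed

lemmas finite_mons = finite_card_mons[THEN conjunct1]
lemmas card_mons = finite_card_mons[THEN conjunct2]

section \<open>Evaluation and substitution homomorphisms\<close>

definition mon_val :: "(nat \<Rightarrow> 'r) \<Rightarrow> (nat \<Rightarrow>\<^sub>0 nat) \<Rightarrow> 'r::comm_ring_1" where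
  "mon_val \<sigma> m = (\<Prod>i\<in>Poly_Mapping.keys m. \<sigma> i ^ Poly_Mapping.lookup m i)"

lemma mon_val_eq_prod:
  assumes "finite V" "Poly_Mapping.keys m \<subseteq> V"
  shows "mon_val \<sigma> m = (\<Prod>i\<in>V. \<sigma> i ^ Poly_Mapping.lookup m i)"
  unfolding mon_val_def using assms
  by (intro prod.mono_neutral_left) (auto simp: in_keys_iff)

lemma mon_val_add: "mon_val \<sigma> (u + v) = mon_val \<sigma> u * mon_val \<sigma> v"
  by (simp add: keys_add_nat lookup_add power_add prod.distrib
      mon_val_eq_prod[of "Poly_Mapping.keys u \<union> Poly_Mapping.keys v"])

lemma mon_val_single [simp]: "mon_val \<sigma> (Poly_Mapping.single i c) = \<sigma> i ^ c"
  by (cases "c = 0") (simp_all add: mon_val_def)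

lemma mon_val_zero [simp]: "mon_val \<sigma> 0 = 1"
  by (simp add: mon_val_def)

lemma mon_val_cong:
  assumes "\<And>i. i \<in> Poly_Mapping.keys m \<Longrightarrow> \<sigma> i = \<tau> i"
  shows "mon_val \<sigma> m = mon_val \<tau> m"
  unfolding mon_val_def using assms by (intro prod.cong) auto

text \<open>One definition covers all specialisations that occur: evaluation at a point
  (\<open>h = id\<close>), restriction to a curve (coefficients embedded in \<open>'k poly\<close>)
  and replacement of variables by polynomials (coefficients as constants
  \<open>Poly_Mapping.single 0 c\<close>).\<close>

definition subst ::
    "('k \<Rightarrow> 'r) \<Rightarrow> (nat \<Rightarrow> 'r) \<Rightarrow> 'k::comm_ring_1 mpoly \<Rightarrow> 'r::comm_ring_1" where
  "subst h \<sigma> p = (\<Sum>m\<in>Poly_Mapping.keys p. h (Poly_Mapping.lookup p m) * mon_val \<sigma> m)"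

lemma poly_eval_eq_subst: "poly_eval a p = subst id a p"
  by (simp add: poly_eval_def subst_def mon_val_def)

locale coeff_hom =
  fixes h :: "'k::comm_ring_1 \<Rightarrow> 'r::comm_ring_1"
  assumes h_one [simp]: "h 1 = 1"
    and h_add [simp]: "h (a + b) = h a + h b"
    and h_mult [simp]: "h (a * b) = h a * h b"
begin

lemma h_zero [simp]: "h 0 = 0"
  using h_add[of 0 0] by simp

lemma subst_eq_sum:
  assumes "finite K" "Poly_Mapping.keys p \<subseteq> K"
  shows "subst h \<sigma> p = (\<Sum>m\<in>K. h (Poly_Mapping.lookup p m) * mon_val \<sigma> m)"
  unfolding subst_def using assms
  by (intro sum.mono_neutral_left) (auto simp: in_keys_iff)

lemma subst_zero [simp]: "subst h \<sigma> 0 = 0"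
  by (simp add: subst_def)

lemma subst_add [simp]: "subst h \<sigma> (p + q) = subst h \<sigma> p + subst h \<sigma> q"
proof -
  let ?K = "Poly_Mapping.keys p \<union> Poly_Mapping.keys q"
  have "Poly_Mapping.keys (p + q) \<subseteq> ?K"
    by (rule keys_add)
  then show ?thesis
    using subst_eq_sum[of ?K p] subst_eq_sum[of ?K q] subst_eq_sum[of ?K "p + q"]
    by (simp add: lookup_add distrib_right sum.distrib)
qed

lemma subst_uminus [simp]: "subst h \<sigma> (- p) = - subst h \<sigma> p"
  using subst_add[of \<sigma> p "- p"] by (simp add: eq_neg_iff_add_eq_0 add.commute)

lemma subst_sum [simp]: "subst h \<sigma> (sum f S) = (\<Sum>i\<in>S. subst h \<sigma> (f i))"
  by (induction S rule: infinite_finite_induct) auto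

lemma subst_single [simp]: "subst h \<sigma> (Poly_Mapping.single m c) = h c * mon_val \<sigma> m"
  by (cases "c = 0") (simp_all add: subst_def)

lemma subst_mult [simp]: "subst h \<sigma> (p * q) = subst h \<sigma> p * subst h \<sigma> q"
proof -
  let ?s = "\<lambda>p m. Poly_Mapping.single m (Poly_Mapping.lookup p m) :: 'k mpoly"
  have "p * q = (\<Sum>u\<in>Poly_Mapping.keys p. ?s p u) * (\<Sum>v\<in>Poly_Mapping.keys q. ?s q v)"
    using poly_mapping_sum_single[of "Poly_Mapping.keys p" p]
      poly_mapping_sum_single[of "Poly_Mapping.keys q" q] by simp
  also have "\<dots> = (\<Sum>u\<in>Poly_Mapping.keys p. \<Sum>v\<in>Poly_Mapping.keys q.
      Poly_Mapping.single (u + v) (Poly_Mapping.lookup p u * Poly_Mapping.lookup q v))"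
    by (simp add: sum_product mult_single)
  finally have "subst h \<sigma> (p * q) = (\<Sum>u\<in>Poly_Mapping.keys p. \<Sum>v\<in>Poly_Mapping.keys q.
      h (Poly_Mapping.lookup p u) * h (Poly_Mapping.lookup q v) * (mon_val \<sigma> u * mon_val \<sigma> v))"
    by (simp only: subst_sum subst_single mon_val_add h_mult)
  then show ?thesis
    by (simp add: subst_def sum_product mult_ac)
qed

lemma subst_var [simp]: "subst h \<sigma> (var i) = \<sigma> i"
  by (simp add: var_def)

lemma subst_var_sum [simp]: "subst h \<sigma> (var_sum V) = sum \<sigma> V"
  by (simp add: var_sum_def)

lemma subst_one [simp]: "subst h \<sigma> 1 = 1"
  using subst_single[of \<sigma> 0 1] by (simp del: subst_single)

lemma subst_power [simp]: "subst h \<sigma> (p ^ e) = subst h \<sigma> p ^ e"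
  by (induction e) auto

end

interpretation id_hom: coeff_hom "id :: 'k::comm_ring_1 \<Rightarrow> 'k"
  by unfold_locales auto

interpretation const_hom: coeff_hom "Poly_Mapping.single 0 :: 'k::comm_ring_1 \<Rightarrow> 'k mpoly"
  by unfold_locales (auto simp: single_add mult_single)

interpretation poly_hom: coeff_hom "(\<lambda>c. [:c:]) :: 'k::comm_ring_1 \<Rightarrow> 'k poly"
  by unfold_locales auto

lemma lookup_const_times:
  fixes p :: "'k::comm_ring_1 mpoly"
  shows "Poly_Mapping.lookup (Poly_Mapping.single 0 c * p) m = c * Poly_Mapping.lookup p m"
  using lookup_single_times_add[of 0 c p m] by (simp only: add_0)

text \<open>Scalars act as constant polynomials, which makes span, independence and dimension
  available for the counting arguments.\<close>

lemma mpoly_vector_space: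
  "vector_space (\<lambda>(c::'k::field) (p::'k mpoly). Poly_Mapping.single 0 c * p)"
proof
  fix a b :: 'k and p q :: "'k mpoly"
  show "Poly_Mapping.single 0 a * (p + q) = Poly_Mapping.single 0 a * p + Poly_Mapping.single 0 a * q"
    by (rule distrib_left)
  show "Poly_Mapping.single 0 (a + b) * p = Poly_Mapping.single 0 a * p + Poly_Mapping.single 0 b * p"
    by (simp only: single_add distrib_right)
  show "Poly_Mapping.single 0 a * (Poly_Mapping.single 0 b * p) = Poly_Mapping.single 0 (a * b) * p"
    by (simp only: mult.assoc[symmetric] mult_single add_0)
  show "Poly_Mapping.single 0 1 * p = p"
    by (simp only: single_one mult_1)
qed

interpretation mp: vector_space "\<lambda>(c::'k::field) (p::'k mpoly). Poly_Mapping.single 0 c * p"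
  by (rule mpoly_vector_space)

section \<open>Monomial ideals and minimal numbers of generators\<close>

lemma carrier_poly_ring:
  "carrier (poly_ring n) = {p. \<forall>m\<in>Poly_Mapping.keys p. Poly_Mapping.keys m \<subseteq> {..n}}"
  by (simp add: poly_ring_def)

lemma poly_ring_simps [simp]:
  "monoid.mult (poly_ring n) = (*)" "one (poly_ring n) = 1"
  "zero (poly_ring n) = 0" "add (poly_ring n) = (+)"
  by (simp_all add: poly_ring_def)

lemma carrier_add:
  "p \<in> carrier (poly_ring n) \<Longrightarrow> q \<in> carrier (poly_ring n) \<Longrightarrow> p + q \<in> carrier (poly_ring n)"
  using keys_add[of p q] by (auto simp: carrier_poly_ring)

lemma carrier_uminus: "p \<in> carrier (poly_ring n) \<Longrightarrow> - p \<in> carrier (poly_ring n)"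
  by (simp add: carrier_poly_ring in_keys_iff)

lemma carrier_mult:
  assumes "p \<in> carrier (poly_ring n)" "q \<in> carrier (poly_ring n)"
  shows "p * q \<in> carrier (poly_ring n)"
  unfolding carrier_poly_ring
proof safe
  fix m i assume "m \<in> Poly_Mapping.keys (p * q)" "i \<in> Poly_Mapping.keys m"
  then show "i \<le> n"
    using keys_mult[of p q] assms by (fastforce simp: carrier_poly_ring keys_add_nat)
qed

lemma carrier_single:
  "Poly_Mapping.keys m \<subseteq> {..n} \<Longrightarrow> Poly_Mapping.single m c \<in> carrier (poly_ring n)"
  by (simp add: carrier_poly_ring)

lemma carrier_zero: "0 \<in> carrier (poly_ring n)"
  by (simp add: carrier_poly_ring)

lemma carrier_one: "1 \<in> carrier (poly_ring n)"
  by (simp add: carrier_poly_ring)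

lemma cring_poly_ring: "cring (poly_ring n :: 'k::comm_ring_1 mpoly ring)"
proof (rule cringI)
  show "abelian_group (poly_ring n :: 'k mpoly ring)"
  proof (rule abelian_groupI)
    fix p :: "'k mpoly" assume "p \<in> carrier (poly_ring n)"
    then show "\<exists>q\<in>carrier (poly_ring n). q \<oplus>\<^bsub>poly_ring n\<^esub> p = \<zero>\<^bsub>poly_ring n\<^esub>"
      by (intro bexI[of _ "- p"]) (simp_all add: carrier_uminus)
  qed (simp_all add: carrier_add carrier_zero add_ac)
  show "Group.comm_monoid (poly_ring n :: 'k mpoly ring)"
    by unfold_locales (simp_all add: carrier_mult carrier_one mult_ac)
qed (auto simp: distrib_right)

lemma a_inv_poly_ring:
  assumes "p \<in> carrier (poly_ring n)"
  shows "a_inv (poly_ring n) p = - p"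
proof -
  interpret cring "poly_ring n :: 'a mpoly ring" by (rule cring_poly_ring)
  show ?thesis
    using minus_equality[of "- p" p] assms carrier_uminus[OF assms] by simp
qed

lemma a_minus_poly_ring:
  assumes "p \<in> carrier (poly_ring n)" "q \<in> carrier (poly_ring n)"
  shows "a_minus (poly_ring n) p q = p - q"
  using assms by (simp add: a_minus_def a_inv_poly_ring)

lemma ideal_poly_ringI:
  assumes sub: "I \<subseteq> carrier (poly_ring n)" and zero: "0 \<in> I"
    and add: "\<And>p q. p \<in> I \<Longrightarrow> q \<in> I \<Longrightarrow> p + q \<in> I"
    and mult: "\<And>p q. p \<in> I \<Longrightarrow> q \<in> carrier (poly_ring n) \<Longrightarrow> q * p \<in> I"
  shows "ideal I (poly_ring n :: 'k::comm_ring_1 mpoly ring)"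
proof -
  interpret cring "poly_ring n :: 'k mpoly ring" by (rule cring_poly_ring)
  have inv: "- p \<in> I" if "p \<in> I" for p
  proof -
    have "(- 1 :: 'k mpoly) \<in> carrier (poly_ring n)"
      by (rule carrier_uminus) (simp add: carrier_poly_ring)
    then show ?thesis using mult[OF that, of "- 1"] by simp
  qed
  show ?thesis
  proof (rule idealI)
    show "subgroup I (add_monoid (poly_ring n))"
    proof (rule subgroup.intro)
      fix p assume p: "p \<in> I"
      then have "inv\<^bsub>add_monoid (poly_ring n)\<^esub> p = - p"
        using a_inv_poly_ring[of p n] sub unfolding a_inv_def by blast
      then show "inv\<^bsub>add_monoid (poly_ring n)\<^esub> p \<in> I"
        using inv[OF p] by simp
    qed (use sub zero add in auto)
  qed (use mult ring_axioms in \<open>auto simp: mult.commute\<close>)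
qed

context
  fixes I :: "'k::comm_ring_1 mpoly set" and n :: nat
  assumes I: "ideal I (poly_ring n)"
begin

interpretation ideal I "poly_ring n" by (rule I)

lemma ideal_zero: "0 \<in> I"
  using additive_subgroup.zero_closed[OF additive_subgroup_axioms] by simp

lemma ideal_add: "p \<in> I \<Longrightarrow> q \<in> I \<Longrightarrow> p + q \<in> I"
  using additive_subgroup.a_closed[OF additive_subgroup_axioms, of p q] by simp

lemma ideal_mult: "p \<in> I \<Longrightarrow> q \<in> carrier (poly_ring n) \<Longrightarrow> q * p \<in> I"
  using I_l_closed[of p q] by simp

lemma ideal_sum: "(\<And>s. s \<in> S \<Longrightarrow> f s \<in> I) \<Longrightarrow> sum f S \<in> I"
  by (induction S rule: infinite_finite_induct) (auto simp: ideal_zero ideal_add)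

lemma coset_eq_iff:
  assumes "p \<in> carrier (poly_ring n)" "q \<in> carrier (poly_ring n)"
  shows "I +>\<^bsub>poly_ring n\<^esub> p = I +>\<^bsub>poly_ring n\<^esub> q \<longleftrightarrow> p - q \<in> I"
  using quotient_eq_iff_same_a_r_cos[OF I assms] a_minus_poly_ring[OF assms] by simp

lemma mult_by_coset:
  assumes "L \<in> carrier (poly_ring n)" "p \<in> carrier (poly_ring n)"
  shows "mult_by n I L (I +>\<^bsub>poly_ring n\<^esub> p) = I +>\<^bsub>poly_ring n\<^esub> (L * p)"
  using rcoset_mult_add[OF assms] by (simp add: mult_by_def FactRing_def)

end

section \<open>Monomial ideals and supports\<close>

abbreviation mono :: "(nat \<Rightarrow>\<^sub>0 nat) \<Rightarrow> 'k::comm_ring_1 mpoly" where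
  "mono m \<equiv> Poly_Mapping.single m 1"

lemma inj_mono: "inj_on (mono :: _ \<Rightarrow> 'k::comm_ring_1 mpoly) A"
  by (auto intro!: inj_onI dest: arg_cong[where f = Poly_Mapping.keys])

lemma monomials_eq: "monomials n d = mono ` mons {..n} d"
  by (auto simp: monomials_def mons_def)

text \<open>The closure of \<open>A\<close> under multiples: the exponents of all monomials in the
  ideal generated by \<open>A\<close>.\<close>

definition above :: "(nat \<Rightarrow>\<^sub>0 nat) set \<Rightarrow> (nat \<Rightarrow>\<^sub>0 nat) set" where
  "above A = {a + u | a u. a \<in> A}"

lemma above_add: "m \<in> above A \<Longrightarrow> m + u \<in> above A"
  unfolding above_def by (auto simp: add.assoc) blast

lemma above_self: "a \<in> A \<Longrightarrow> a \<in> above A"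
  unfolding above_def by (metis (mono_tags, lifting) add_0_right mem_Collect_eq)

lemma ideal_monomial:
  assumes "\<And>m u. m \<in> Q \<Longrightarrow> m + u \<in> Q"
  shows "ideal {p \<in> carrier (poly_ring n). Poly_Mapping.keys p \<subseteq> Q}
    (poly_ring n :: 'k::comm_ring_1 mpoly ring)"
proof (rule ideal_poly_ringI)
  fix p q :: "'k mpoly"
  assume p: "p \<in> {p \<in> carrier (poly_ring n). Poly_Mapping.keys p \<subseteq> Q}"
    and q: "q \<in> carrier (poly_ring n)"
  have "Poly_Mapping.keys (q * p) \<subseteq> Q"
    using keys_mult[of q p] p assms by (fastforce simp: add.commute)
  then show "q * p \<in> {p \<in> carrier (poly_ring n). Poly_Mapping.keys p \<subseteq> Q}"
    using p q by (simp add: carrier_mult)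
next
  fix p q :: "'k mpoly"
  assume "p \<in> {p \<in> carrier (poly_ring n). Poly_Mapping.keys p \<subseteq> Q}"
    and "q \<in> {p \<in> carrier (poly_ring n). Poly_Mapping.keys p \<subseteq> Q}"
  then show "p + q \<in> {p \<in> carrier (poly_ring n). Poly_Mapping.keys p \<subseteq> Q}"
    using keys_add[of p q] by (auto simp: carrier_add)
qed (auto simp: carrier_poly_ring)

lemma Idl_mono_eq:
  assumes A: "A \<subseteq> {m. Poly_Mapping.keys m \<subseteq> {..n}}"
  shows "Idl\<^bsub>poly_ring n\<^esub> (mono ` A) =
    {p \<in> carrier (poly_ring n :: 'k::comm_ring_1 mpoly ring). Poly_Mapping.keys p \<subseteq> above A}"
    (is "?I = ?J")
proof
  interpret cring "poly_ring n :: 'k mpoly ring" by (rule cring_poly_ring)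
  have "(mono a :: 'k mpoly) \<in> ?J" if "a \<in> A" for a
    using A that by (auto simp: carrier_single above_self)
  then have "(mono :: _ \<Rightarrow> 'k mpoly) ` A \<subseteq> ?J"
    by blast
  then show "?I \<subseteq> ?J"
    by (intro genideal_minimal ideal_monomial above_add)
  show "?J \<subseteq> ?I"
  proof
    fix p :: "'k mpoly" assume p: "p \<in> ?J"
    have sub: "(mono :: _ \<Rightarrow> 'k mpoly) ` A \<subseteq> carrier (poly_ring n)"
      using A by (auto simp: carrier_single)
    have I: "ideal ?I (poly_ring n :: 'k mpoly ring)"
      by (rule genideal_ideal[OF sub])
    have "Poly_Mapping.single m (Poly_Mapping.lookup p m) \<in> ?I" if m: "m \<in> Poly_Mapping.keys p" for m
    proof -
      obtain a u where au: "a \<in> A" "m = a + u"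
        using p m by (auto simp: above_def)
      have "Poly_Mapping.keys u \<subseteq> {..n}"
      proof -
        have "Poly_Mapping.keys m \<subseteq> {..n}"
          using p m by (simp add: carrier_poly_ring)
        then show ?thesis by (simp add: au keys_add_nat)
      qed
      moreover have "(mono a :: 'k mpoly) \<in> ?I"
        using genideal_self[OF sub] au by auto
      ultimately have "Poly_Mapping.single u (Poly_Mapping.lookup p m) * mono a \<in> ?I"
        by (intro ideal_mult[OF I] carrier_single)
      then show ?thesis
        by (simp add: au mult_single add.commute)
    qed
    then have "(\<Sum>m\<in>Poly_Mapping.keys p. Poly_Mapping.single m (Poly_Mapping.lookup p m)) \<in> ?I"
      by (intro ideal_sum[OF I])
    then show "p \<in> ?I"
      using poly_mapping_sum_single[of "Poly_Mapping.keys p" p] by simp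
  qed
qed

lemma above_mons_iff:
  assumes "A \<subseteq> mons V d" "mon_degree m = d"
  shows "m \<in> above A \<longleftrightarrow> m \<in> A"
proof
  assume "m \<in> above A"
  then obtain a u where au: "a \<in> A" "m = a + u" by (auto simp: above_def)
  then have "mon_degree u = 0" using assms by (auto simp: mons_def)
  then have "u = 0" by (auto simp: mon_degree_def in_keys_iff intro!: poly_mapping_eqI)
  then show "m \<in> A" using au by simp
next
  assume "m \<in> A"
  then show "m \<in> above A" by (rule above_self)
qed

lemma above_mon_degree:
  assumes "A \<subseteq> mons V d" "m \<in> above A"
  shows "d \<le> mon_degree m"
  using assms by (auto simp: above_def mons_def)

lemma forms_eq: "forms n d = {p. Poly_Mapping.keys p \<subseteq> mons {..n} d}"
  by (auto simp: forms_def carrier_poly_ring mons_def)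

definition part :: "'a set \<Rightarrow> ('a \<Rightarrow>\<^sub>0 'b::zero) \<Rightarrow> 'a \<Rightarrow>\<^sub>0 'b" where
  "part S p = Poly_Mapping.mapp (\<lambda>m c. if m \<in> S then c else 0) p"

lemma lookup_part: "Poly_Mapping.lookup (part S p) m = (if m \<in> S then Poly_Mapping.lookup p m else 0)"
  by (simp add: part_def lookup_mapp when_def in_keys_iff)

lemma keys_part: "Poly_Mapping.keys (part S p) = Poly_Mapping.keys p \<inter> S"
  by (auto simp: in_keys_iff lookup_part split: if_splits)

lemma part_add: "part S (p + q) = part S p + part S q"
  by (rule poly_mapping_eqI) (simp add: lookup_part lookup_add)

lemma part_const_times: "part S (Poly_Mapping.single 0 c * p) = Poly_Mapping.single 0 c * part S p"
  for p :: "'k::comm_ring_1 mpoly"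
  by (rule poly_mapping_eqI) (simp add: lookup_part lookup_const_times)

lemma part_eq_self: "Poly_Mapping.keys p \<subseteq> S \<Longrightarrow> part S p = p"
  by (rule poly_mapping_eqI) (auto simp: lookup_part in_keys_iff)

lemma part_eq_0: "Poly_Mapping.keys p \<inter> S = {} \<Longrightarrow> part S p = 0"
  by (rule poly_mapping_eqI) (auto simp: lookup_part in_keys_iff)

lemma independent_mono:
  assumes "finite A"
  shows "mp.independent ((mono :: _ \<Rightarrow> 'k::field mpoly) ` A)"
proof -
  have "u (mono a) = 0"
    if sum: "(\<Sum>v\<in>mono ` A. Poly_Mapping.single 0 (u v) * v) = (0 :: 'k mpoly)" and a: "a \<in> A" for u a
  proof -
    have "(\<Sum>b\<in>A. Poly_Mapping.single 0 (u (mono b)) * (mono b :: 'k mpoly)) = 0"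
      using sum by (subst (asm) sum.reindex[OF inj_mono]) (simp only: o_def)
    then have "Poly_Mapping.lookup (\<Sum>b\<in>A. Poly_Mapping.single 0 (u (mono b)) * (mono b :: 'k mpoly)) a = 0"
      by (simp only: lookup_zero)
    moreover have "Poly_Mapping.lookup (Poly_Mapping.single 0 (u (mono b)) * (mono b :: 'k mpoly)) a =
        (if b = a then u (mono b) else 0)" for b
      by (simp only: lookup_const_times) (simp add: lookup_single)
    ultimately show ?thesis
      using assms a by (simp add: lookup_sum sum.delta)
  qed
  then show ?thesis
    using assms by (subst mp.dependent_finite) blast+
qed

lemma span_mono:
  assumes "Poly_Mapping.keys p \<subseteq> A"
  shows "p \<in> mp.span ((mono :: _ \<Rightarrow> 'k::field mpoly) ` A)"
proof -
  have "Poly_Mapping.single m (Poly_Mapping.lookup p m) \<in> mp.span (mono ` A)"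
    if "m \<in> Poly_Mapping.keys p" for m
  proof -
    have "Poly_Mapping.single 0 (Poly_Mapping.lookup p m) * mono m \<in> mp.span (mono ` A)"
      using that assms by (intro mp.span_scale mp.span_base) auto
    then show ?thesis by (simp only: mult_single add_0 mult_1_right)
  qed
  then have "(\<Sum>m\<in>Poly_Mapping.keys p. Poly_Mapping.single m (Poly_Mapping.lookup p m)) \<in> mp.span (mono ` A)"
    by (rule mp.span_sum)
  then show ?thesis
    using poly_mapping_sum_single[of "Poly_Mapping.keys p" p] by simp
qed

text \<open>Every element of the ideal has initial degree at least \<open>d\<close>, so passing to degree-\<open>d\<close> parts
  turns ideal generators into linear generators of the degree-\<open>d\<close> part.\<close>

lemma card_le_generators:
  assumes A: "A \<subseteq> mons {..n} d" and G: "finite G" "G \<subseteq> carrier (poly_ring n)"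
    and eq: "Idl\<^bsub>poly_ring n\<^esub> G = Idl\<^bsub>poly_ring n\<^esub> ((mono :: _ \<Rightarrow> 'k::field mpoly) ` A)"
  shows "card A \<le> card G"
proof -
  interpret R: cring "poly_ring n :: 'k mpoly ring" by (rule cring_poly_ring)
  define hc :: "'k mpoly \<Rightarrow> 'k mpoly" where "hc = part {m. mon_degree m = d}"
  \<comment> \<open>An ideal that contains \<open>G\<close>, hence every \<open>mono a\<close> with
    \<open>a \<in> A\<close>. The degree-\<open>d\<close> part of \<open>mono a\<close> is
    \<open>mono a\<close> itself, so these monomials lie in the span of the degree-\<open>d\<close>
    parts of \<open>G\<close>.\<close>
  define J where "J = {p \<in> carrier (poly_ring n).
    (\<forall>m\<in>Poly_Mapping.keys p. d \<le> mon_degree m) \<and> hc p \<in> mp.span (hc ` G)}"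
  have finA: "finite A"
    using finite_subset[OF A] finite_mons by blast
  have A': "A \<subseteq> {m. Poly_Mapping.keys m \<subseteq> {..n}}"
    using A by (auto simp: mons_def)
  have "ideal J (poly_ring n)"
  proof (rule ideal_poly_ringI)
    fix p q :: "'k mpoly"
    assume p: "p \<in> J" and q: "q \<in> carrier (poly_ring n)"
    \<comment> \<open>Only the constant term of \<open>q\<close> contributes to the
      degree-\<open>d\<close> part of \<open>q * p\<close>: \<open>q'\<close> has no constant term,
      so \<open>q' * p\<close> starts above degree \<open>d\<close>.\<close>
    define c where "c = Poly_Mapping.lookup q 0"
    define q' where "q' = q - Poly_Mapping.single 0 c"
    have deg: "d < mon_degree m" if m: "m \<in> Poly_Mapping.keys (q' * p)" for m
    proof -
      obtain u v where uv: "u \<in> Poly_Mapping.keys q'" "v \<in> Poly_Mapping.keys p" "m = u + v"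
        using keys_mult[of q' p] m by auto
      have "u \<noteq> 0"
        using uv by (auto simp: q'_def c_def in_keys_iff lookup_minus)
      then have "mon_degree u \<noteq> 0"
        by (auto simp: mon_degree_def in_keys_iff intro!: poly_mapping_eqI)
      moreover have "d \<le> mon_degree v"
        using p uv by (auto simp: J_def)
      ultimately show ?thesis
        using uv by simp
    qed
    have qp: "q * p = Poly_Mapping.single 0 c * p + q' * p"
      by (simp add: q'_def algebra_simps)
    have "hc (q' * p) = 0"
      unfolding hc_def by (rule part_eq_0) (use deg in force)
    then have "hc (q * p) = Poly_Mapping.single 0 c * hc p"
      unfolding qp hc_def part_add part_const_times by (simp only: add_0_right)
    moreover have "Poly_Mapping.single 0 c * hc p \<in> mp.span (hc ` G)"
      using p by (intro mp.span_scale) (auto simp: J_def)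
    moreover have "d \<le> mon_degree m" if "m \<in> Poly_Mapping.keys (q * p)" for m
      using keys_mult[of q p] that p unfolding J_def by fastforce
    ultimately show "q * p \<in> J"
      using p q by (auto simp: J_def carrier_mult)
  next
    fix p q assume "p \<in> J" "q \<in> J"
    then show "p + q \<in> J"
      using keys_add[of p q] unfolding J_def hc_def
      by (auto simp: carrier_add part_add intro: mp.span_add)
  next
    have "hc 0 = 0"
      unfolding hc_def by (rule part_eq_0) simp
    then show "0 \<in> J"
      unfolding J_def using mp.span_zero[of "hc ` G"] by (simp add: carrier_zero)
  qed (auto simp: J_def)
  moreover have "G \<subseteq> J"
  proof
    fix g assume g: "g \<in> G"
    then have "g \<in> Idl\<^bsub>poly_ring n\<^esub> (mono ` A)"
      using R.genideal_self[OF G(2)] eq by blast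
    then show "g \<in> J"
      using g G above_mon_degree[OF A] mp.span_base[of "hc g" "hc ` G"]
      by (auto simp: J_def Idl_mono_eq[OF A'])
  qed
  ultimately have "Idl\<^bsub>poly_ring n\<^esub> (mono ` A) \<subseteq> J"
    using R.genideal_minimal[of J G] eq by simp
  then have J: "(mono a :: 'k mpoly) \<in> J" if "a \<in> A" for a
    using that A' above_self[OF that] carrier_single[of a n "1 :: 'k"]
    unfolding Idl_mono_eq[OF A'] by (auto simp: subset_iff)
  have "(mono :: _ \<Rightarrow> 'k mpoly) ` A \<subseteq> mp.span (hc ` G)"
  proof safe
    fix a assume a: "a \<in> A"
    have "hc (mono a) = mono a"
      unfolding hc_def by (rule part_eq_self) (use a A in \<open>auto simp: mons_def\<close>)
    then show "mono a \<in> mp.span (hc ` G)"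
      using J[OF a] by (simp add: J_def)
  qed
  then have "card ((mono :: _ \<Rightarrow> 'k mpoly) ` A) \<le> card (hc ` G)"
    using mp.independent_span_bound[OF _ independent_mono[OF finA]] G(1) by blast
  also have "\<dots> \<le> card G"
    by (rule card_image_le[OF G(1)])
  finally show ?thesis
    by (simp add: card_image inj_mono)
qed

lemma num_generators_Idl_mono:
  assumes A: "A \<subseteq> mons {..n} d"
  shows "num_generators n (Idl\<^bsub>poly_ring n\<^esub> ((mono :: _ \<Rightarrow> 'k::field mpoly) ` A)) = card A"
  unfolding num_generators_def
proof (rule Least_equality)
  have "finite A"
    using finite_subset[OF A] finite_mons by blast
  then show "\<exists>G\<subseteq>carrier (poly_ring n). finite G \<and> card G = card A \<and>
      Idl\<^bsub>poly_ring n\<^esub> G = Idl\<^bsub>poly_ring n\<^esub> ((mono :: _ \<Rightarrow> 'k mpoly) ` A)"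
    using A by (intro exI[of _ "mono ` A"]) (auto simp: card_image inj_mono carrier_single mons_def)
qed (use card_le_generators[OF A] in blast)

section \<open>Artinian monomial ideals\<close>

lemma (in vector_space) subspace_dim_eq:
  assumes U: "subspace U" "U \<subseteq> W" and W: "W \<subseteq> span T" "finite T"
  shows "dim U \<le> dim W \<and> (dim U = dim W \<longrightarrow> U = W)"
proof -
  obtain B where B: "B \<subseteq> U" "independent B" "U \<subseteq> span B" "card B = dim U"
    by (rule basis_exists)
  obtain C where C: "C \<subseteq> W" "independent C" "W \<subseteq> span C" "card C = dim W"
    by (rule basis_exists)
  have finC: "finite C"
    using independent_span_bound[OF W(2) C(2)] C(1) W(1) by blast
  then have finB: "finite B" "card B \<le> card C"
    using independent_span_bound[OF finC B(2)] B(1) U(2) C(3) by blast+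
  moreover have "x \<in> U" if "card B = card C" "x \<in> W" for x
  proof (rule ccontr)
    assume "x \<notin> U"
    then have x: "x \<notin> span B"
      using span_minimal[OF B(1) U(1)] by blast
    then have "card (insert x B) \<le> card C"
      using independent_span_bound[OF finC independent_insertI[OF x B(2)]] B(1) U(2) C(3) that
      by blast
    moreover have "x \<notin> B"
      using x span_base by blast
    ultimately show False
      using that finB by simp
  qed
  ultimately show ?thesis
    using B(4) C(4) U(2) by auto
qed

text \<open>Modulo I, the ideals I + (x_i^j) form a descending chain. Once it is stationary at N,
  the power x_i^N lies in I, so a generator divides it; having degree \<open>d\<close>, this
  generator is x_i^d.\<close>

lemma artinian_ideal_imp_powers:
  assumes A: "A \<subseteq> mons {..n} d" and i: "i \<le> n"
    and art: "artinian_ideal n (Idl\<^bsub>poly_ring n\<^esub> ((mono :: _ \<Rightarrow> 'k::field mpoly) ` A))"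
  shows "Poly_Mapping.single i d \<in> A"
proof -
  interpret R: cring "poly_ring n :: 'k mpoly ring" by (rule cring_poly_ring)
  let ?I = "Idl\<^bsub>poly_ring n\<^esub> ((mono :: _ \<Rightarrow> 'k mpoly) ` A)"
  let ?Q = "poly_ring n Quot ?I"
  have A': "A \<subseteq> {m. Poly_Mapping.keys m \<subseteq> {..n}}"
    using A by (auto simp: mons_def)
  have I: "ideal ?I (poly_ring n)"
    using art by (simp add: artinian_ideal_def)
  define S where "S j = above A \<union> {m. j \<le> Poly_Mapping.lookup m i}" for j
  define K where "K j = {p \<in> carrier (poly_ring n :: 'k mpoly ring). Poly_Mapping.keys p \<subseteq> S j}" for j
  define J where "J j = (+>\<^bsub>poly_ring n\<^esub>) ?I ` K j" for j
  have "ideal (K j) (poly_ring n)" for j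
    unfolding K_def by (rule ideal_monomial) (auto simp: S_def above_add lookup_add)
  then have "ideal (J j) ?Q" for j
    unfolding J_def by (rule R.ring_ideal_imp_quot_ideal[OF I])
  moreover have "J (Suc j) \<subseteq> J j" for j
    unfolding J_def K_def S_def by (rule image_mono) auto
  ultimately obtain N where N: "\<forall>j\<ge>N. J j = J N"
    using art unfolding artinian_ideal_def artinian_ring_def by blast
  let ?x = "mono (Poly_Mapping.single i N) :: 'k mpoly"
  have x: "?x \<in> carrier (poly_ring n)"
    using i by (intro carrier_single) auto
  have "?x \<in> K N"
    using x by (simp add: K_def S_def)
  then have "?I +>\<^bsub>poly_ring n\<^esub> ?x \<in> J N"
    unfolding J_def by (rule imageI)
  also have "J N = J (Suc N)"
    using N[rule_format, of "Suc N"] by simp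
  finally obtain p where p: "p \<in> K (Suc N)" "?I +>\<^bsub>poly_ring n\<^esub> ?x = ?I +>\<^bsub>poly_ring n\<^esub> p"
    unfolding J_def by blast
  then have "?x - p \<in> ?I"
    using coset_eq_iff[OF I x] by (auto simp: K_def)
  then have "Poly_Mapping.keys (?x - p) \<subseteq> above A"
    unfolding Idl_mono_eq[OF A'] by simp
  \<comment> \<open>In either alternative the exponent lies in \<open>above A\<close>: a monomial of
    \<open>p\<close> outside \<open>above A\<close> has exponent at least N + 1 in x_i.\<close>
  moreover have "Poly_Mapping.single i N \<in> Poly_Mapping.keys (?x - p) \<union> Poly_Mapping.keys p"
    by (auto simp: in_keys_iff lookup_minus)
  ultimately have "Poly_Mapping.single i N \<in> above A"
    using p(1) unfolding K_def S_def by auto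
  then obtain a u where au: "a \<in> A" "Poly_Mapping.single i N = a + u"
    by (auto simp: above_def)
  then have "Poly_Mapping.keys a \<subseteq> {i}"
    by (metis Un_upper1 keys_add_nat keys_single keys_zero empty_subsetI order_trans)
  then have "a \<in> mons {i} d"
    using au A by (auto simp: mons_def)
  then show ?thesis
    using au by (simp add: mons_singleton)
qed

text \<open>Only the finitely many monomials in \<open>F\<close> lie outside I. An ideal of the
  quotient is determined by the polynomials supported in \<open>F\<close> whose cosets it contains,
  so a descending chain of ideals becomes a descending chain of subspaces of a finite-dimensional
  space.\<close>

lemma powers_imp_artinian_ideal:
  assumes A: "A \<subseteq> mons {..n} d" and powers: "\<And>i. i \<le> n \<Longrightarrow> Poly_Mapping.single i d \<in> A"
  shows "artinian_ideal n (Idl\<^bsub>poly_ring n\<^esub> ((mono :: _ \<Rightarrow> 'k::field mpoly) ` A))"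
proof -
  interpret R: cring "poly_ring n :: 'k mpoly ring" by (rule cring_poly_ring)
  let ?I = "Idl\<^bsub>poly_ring n\<^esub> ((mono :: _ \<Rightarrow> 'k mpoly) ` A)"
  let ?Q = "poly_ring n Quot ?I"
  have A': "A \<subseteq> {m. Poly_Mapping.keys m \<subseteq> {..n}}"
    using A by (auto simp: mons_def)
  then have I: "ideal ?I (poly_ring n)"
    by (intro R.genideal_ideal) (auto simp: carrier_single)
  interpret h: ring_hom_ring "poly_ring n" ?Q "(+>\<^bsub>poly_ring n\<^esub>) ?I"
    by (rule ideal.rcos_ring_hom_ring[OF I])
  define F where "F = {m. Poly_Mapping.keys m \<subseteq> {..n} \<and> m \<notin> above A}"
  have "F \<subseteq> (\<Union>e\<le>Suc n * d. mons {..n} e)"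
  proof
    fix m assume m: "m \<in> F"
    have "Poly_Mapping.lookup m i \<le> d" if "i \<le> n" for i
    proof (rule ccontr)
      assume gt: "\<not> ?thesis"
      have "m = Poly_Mapping.single i d + (m - Poly_Mapping.single i d)"
        using gt by (intro poly_mapping_eqI)
          (auto simp: lookup_add lookup_minus lookup_single when_def)
      then have "m \<in> above A"
        using powers[OF that] unfolding above_def by blast
      then show False
        using m by (simp add: F_def)
    qed
    then have "(\<Sum>i\<in>{..n}. Poly_Mapping.lookup m i) \<le> (\<Sum>i\<in>{..n}. d)"
      by (intro sum_mono) simp
    then have "mon_degree m \<le> Suc n * d"
      using m mon_degree_eq_sum[of "{..n}" m] by (simp add: F_def)
    then show "m \<in> (\<Union>e\<le>Suc n * d. mons {..n} e)"
      using m by (auto simp: F_def mons_def)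
  qed
  then have finF: "finite F"
    by (rule finite_subset) (auto intro: finite_mons)
  have "\<exists>N. \<forall>i\<ge>N. J i = J N" if J: "\<forall>i. ideal (J i) ?Q \<and> J (Suc i) \<subseteq> J i" for J
  proof -
    define K where "K i = {p \<in> carrier (poly_ring n). ?I +>\<^bsub>poly_ring n\<^esub> p \<in> J i}" for i
    have K: "ideal (K i) (poly_ring n)" for i
      unfolding K_def using h.ideal_vimage J by blast
    define W where "W i = {p \<in> K i. Poly_Mapping.keys p \<subseteq> F}" for i
    have W: "mp.subspace (W i)" for i
    proof (rule mp.subspaceI)
      show "0 \<in> W i"
        using ideal_zero[OF K] by (simp add: W_def)
      show "p + q \<in> W i" if "p \<in> W i" "q \<in> W i" for p q
        using that keys_add[of p q] ideal_add[OF K, of p i q] by (auto simp: W_def)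
      show "Poly_Mapping.single 0 c * p \<in> W i" if "p \<in> W i" for c p
        using that ideal_mult[OF K, of p i "Poly_Mapping.single 0 c"] carrier_single[of 0 n c]
        by (auto simp: W_def in_keys_iff lookup_const_times)
    qed
    have anti: "J j \<subseteq> J i" if "i \<le> j" for i j
      using that by (rule lift_Suc_antimono_le[of J, rotated]) (use J in blast)
    then have W_anti: "W j \<subseteq> W i" if "i \<le> j" for i j
      using that by (fastforce simp: W_def K_def)
    have W_span: "W i \<subseteq> mp.span (mono ` F)" for i
      by (auto simp: W_def intro: span_mono)
    \<comment> \<open>A member of least dimension in the chain: later ones lie inside it and have no
      smaller dimension, so they coincide with it.\<close>
    obtain N where N: "\<And>i. mp.dim (W N) \<le> mp.dim (W i)"
      using ex_has_least_nat[of "\<lambda>_. True" 0 "\<lambda>i. mp.dim (W i)"] by auto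
    have "W i = W N" if "N \<le> i" for i
      using mp.subspace_dim_eq[OF W W_anti[OF that] W_span] finF N[of i] by force
    then have WN: "W N \<subseteq> W i" if "N \<le> i" for i
      using that by blast
    have "J N \<subseteq> J i" if le: "N \<le> i" for i
    proof
      fix j assume j: "j \<in> J N"
      have "j \<in> carrier ?Q"
        using j J additive_subgroup.a_subset[OF ideal.axioms(1)] by blast
      then obtain p where p: "p \<in> carrier (poly_ring n)" "j = ?I +>\<^bsub>poly_ring n\<^esub> p"
        by (auto simp: FactRing_def A_RCOSETS_def')
      \<comment> \<open>Reduction modulo I: the remainder \<open>r\<close> is supported in
        \<open>above A\<close>, so \<open>part F p\<close> represents the same coset as
        \<open>p\<close>.\<close>
      define r where "r = part (- F) p"
      have split: "p - part F p = r"
        by (rule poly_mapping_eqI) (simp add: r_def lookup_minus lookup_part)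
      have part: "part F p \<in> carrier (poly_ring n)" "r \<in> carrier (poly_ring n)"
        using p(1) by (auto simp: carrier_poly_ring keys_part r_def)
      have "Poly_Mapping.keys r \<subseteq> above A"
        using p(1) unfolding r_def keys_part carrier_poly_ring F_def by blast
      then have "r \<in> ?I"
        using part(2) unfolding Idl_mono_eq[OF A'] by blast
      then have "?I +>\<^bsub>poly_ring n\<^esub> p = ?I +>\<^bsub>poly_ring n\<^esub> part F p"
        using coset_eq_iff[OF I p(1) part(1)] split by simp
      moreover from this have "part F p \<in> W N"
        using j p part by (simp add: W_def K_def keys_part)
      then have "part F p \<in> W i"
        using WN[OF le] by blast
      ultimately show "j \<in> J i"
        using p by (simp add: W_def K_def)
    qed
    then show ?thesis
      using anti by blast
  qed
  then show ?thesis
    unfolding artinian_ideal_def artinian_ring_def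
    using I ideal.quotient_is_ring[OF I] by blast
qed

section \<open>Failure of maximal rank as a kernel condition\<close>

lemma mons_mult:
  assumes "Poly_Mapping.keys p \<subseteq> mons V a" "Poly_Mapping.keys q \<subseteq> mons V b"
  shows "Poly_Mapping.keys (p * q) \<subseteq> mons V (a + b)"
proof
  fix m assume "m \<in> Poly_Mapping.keys (p * q)"
  then obtain u v where "u \<in> Poly_Mapping.keys p" "v \<in> Poly_Mapping.keys q" "m = u + v"
    using keys_mult[of p q] by auto
  moreover from this have "u \<in> mons V a" "v \<in> mons V b"
    using assms by auto
  ultimately show "m \<in> mons V (a + b)"
    by (simp add: mons_def keys_add_nat)
qed

lemma keys_var: "Poly_Mapping.keys (var i :: 'k::comm_ring_1 mpoly) = {Poly_Mapping.single i 1}"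
  by (simp add: var_def)

lemma keys_var_sum: "Poly_Mapping.keys (var_sum V :: 'k::comm_ring_1 mpoly) \<subseteq> mons V 1"
  unfolding var_sum_def using keys_sum[of "var :: nat \<Rightarrow> 'k mpoly" V]
  by (auto simp: keys_var mons_def)

lemma lookup_linear_form_times:
  "Poly_Mapping.lookup (linear_form n a * p) m =
    (\<Sum>i\<in>{..n} \<inter> Poly_Mapping.keys m. a i * Poly_Mapping.lookup p (m - Poly_Mapping.single i 1))"
proof -
  have "Poly_Mapping.single (Poly_Mapping.single i 1) (a i) = Poly_Mapping.single 0 (a i) * var i" for i
    by (simp only: var_def mult_single add_0 mult_1_right)
  then have "linear_form n a * p = (\<Sum>i\<le>n. Poly_Mapping.single 0 (a i) * (var i * p))"
    by (simp only: linear_form_def sum_distrib_right mult.assoc)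
  then have "Poly_Mapping.lookup (linear_form n a * p) m = (\<Sum>i\<le>n. a i *
      (if i \<in> Poly_Mapping.keys m then Poly_Mapping.lookup p (m - Poly_Mapping.single i 1) else 0))"
    by (simp only: lookup_sum lookup_const_times lookup_var_times)
  then show ?thesis
    by (simp add: sum.inter_restrict if_distrib[of "\<lambda>x. _ * x"] cong: if_cong del: One_nat_def)
qed

lemma linear_form_one: "linear_form n (\<lambda>_. 1) = var_sum {..n}"
  by (simp add: linear_form_def var_sum_def var_def)

lemma keys_linear_form: "Poly_Mapping.keys (linear_form n a :: 'k::comm_ring_1 mpoly) \<subseteq> mons {..n} 1"
  unfolding linear_form_def
  using keys_sum[of "\<lambda>i. Poly_Mapping.single (Poly_Mapping.single i 1) (a i)" "{..n}"]
  by (fastforce simp: mons_def split: if_splits)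

lemma forms_carrier: "p \<in> forms n d \<Longrightarrow> p \<in> carrier (poly_ring n)"
  by (simp add: forms_def)

lemma forms_diff: "p \<in> forms n d \<Longrightarrow> q \<in> forms n d \<Longrightarrow> p - q \<in> forms n d"
  using keys_diff[of p q] by (auto simp: forms_eq)

text \<open>The substitution x_i -> b_i x_i, written coefficientwise so that it visibly preserves
  supports when no b_i is zero.\<close>

definition scale_vars :: "(nat \<Rightarrow> 'k) \<Rightarrow> 'k::comm_ring_1 mpoly \<Rightarrow> 'k mpoly" where
  "scale_vars b p = Poly_Mapping.mapp (\<lambda>m c. mon_val b m * c) p"

lemma lookup_scale_vars: "Poly_Mapping.lookup (scale_vars b p) m = mon_val b m * Poly_Mapping.lookup p m"
  by (simp add: scale_vars_def lookup_mapp when_def in_keys_iff)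

text \<open>\<open>linear_form n c\<close> is the rescaled \<open>linear_form n c'\<close>, and
  rescaling the variables is multiplicative.\<close>

lemma lookup_linear_form_times_scale_vars:
  assumes "\<And>i. i \<le> n \<Longrightarrow> c i = b i * c' i"
  shows "Poly_Mapping.lookup (linear_form n c * scale_vars b p) m =
    mon_val b m * Poly_Mapping.lookup (linear_form n c' * p) m"
proof -
  have "c i * (mon_val b (m - Poly_Mapping.single i 1) * x) = mon_val b m * (c' i * x)"
    if "i \<in> {..n} \<inter> Poly_Mapping.keys m" for i x
  proof -
    have "mon_val b m = b i * mon_val b (m - Poly_Mapping.single i 1)"
      using mon_val_add[of b "Poly_Mapping.single i 1" "m - Poly_Mapping.single i 1"] that
      by (simp only: single_minus_single Int_iff mon_val_single power_one_right)
    then show ?thesis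
      using that assms by (simp add: mult_ac)
  qed
  then show ?thesis
    unfolding lookup_linear_form_times lookup_scale_vars sum_distrib_left
    by (rule sum.cong[OF refl])
qed

lemma scale_vars_kernel:
  fixes b :: "nat \<Rightarrow> 'k::field"
  assumes "\<And>i. i \<le> n \<Longrightarrow> c i = b i * c' i" "\<And>i. i \<le> n \<Longrightarrow> b i \<noteq> 0"
    and G: "G \<in> forms n e" "G \<noteq> 0" "Poly_Mapping.keys (linear_form n c' * G) \<subseteq> A"
  shows "\<exists>G\<in>forms n e. G \<noteq> 0 \<and> Poly_Mapping.keys (linear_form n c * G) \<subseteq> A"
proof (intro bexI conjI)
  have keys: "Poly_Mapping.keys (scale_vars b G) = Poly_Mapping.keys G"
  proof -
    have "mon_val b m \<noteq> 0" if "m \<in> Poly_Mapping.keys G" for m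
    proof -
      have "Poly_Mapping.keys m \<subseteq> {..n}"
        using that G(1) by (auto simp: forms_eq mons_def)
      then show ?thesis
        using assms(2) by (auto simp: mon_val_def)
    qed
    then show ?thesis
      by (auto simp: in_keys_iff lookup_scale_vars)
  qed
  show "scale_vars b G \<in> forms n e"
    using G(1) by (simp add: forms_eq keys)
  show "scale_vars b G \<noteq> 0"
    using keys G(2) by (metis keys_eq_empty)
  show "Poly_Mapping.keys (linear_form n c * scale_vars b G) \<subseteq> A"
    using G(3) lookup_linear_form_times_scale_vars[OF assms(1), where p = G]
    by (auto simp: in_keys_iff subset_iff)
qed

context
  fixes n d :: nat and A :: "(nat \<Rightarrow>\<^sub>0 nat) set" and I L :: "'k::field mpoly" and J :: "'k mpoly set"
  assumes A: "A \<subseteq> mons {..n} d" and d: "0 < d" and L: "Poly_Mapping.keys L \<subseteq> mons {..n} 1"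
    and J: "J = Idl\<^bsub>poly_ring n\<^esub> (mono ` A)"
begin

lemma monomial_ideal_ideal: "ideal J (poly_ring n)"
proof -
  interpret R: cring "poly_ring n :: 'k mpoly ring" by (rule cring_poly_ring)
  show ?thesis
    unfolding J using A by (intro R.genideal_ideal) (auto simp: carrier_single mons_def)
qed

lemma mem_monomial_ideal_iff:
  assumes "p \<in> forms n d"
  shows "p \<in> J \<longleftrightarrow> Poly_Mapping.keys p \<subseteq> A"
proof -
  have A': "A \<subseteq> {m. Poly_Mapping.keys m \<subseteq> {..n}}"
    using A by (auto simp: mons_def)
  have "m \<in> above A \<longleftrightarrow> m \<in> A" if "m \<in> Poly_Mapping.keys p" for m
    using that assms by (intro above_mons_iff[OF A]) (auto simp: forms_def)
  then show ?thesis
    unfolding J Idl_mono_eq[OF A'] using forms_carrier[OF assms] by auto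
qed

lemma L_carrier: "L \<in> carrier (poly_ring n)"
  using L by (auto simp: carrier_poly_ring mons_def)

lemma times_L_forms: "p \<in> forms n (d - 1) \<Longrightarrow> L * p \<in> forms n d"
  using mons_mult[OF L, of p "d - 1"] d by (simp add: forms_eq)

text \<open>The ideal has no nonzero elements in degree \<open>d - 1\<close>, so there the quotient
  can be identified with the forms themselves, and in degree \<open>d\<close> membership in the
  ideal is an inclusion of supports.\<close>

lemma not_inj_mult_by_iff:
  "\<not> inj_on (mult_by n J L) (quot_component n J (d - 1)) \<longleftrightarrow>
    (\<exists>G\<in>forms n (d - 1). G \<noteq> 0 \<and> Poly_Mapping.keys (L * G) \<subseteq> A)"
proof
  assume "\<not> inj_on (mult_by n J L) (quot_component n J (d - 1))"
  then obtain f g where fg: "f \<in> forms n (d - 1)" "g \<in> forms n (d - 1)"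
      "J +>\<^bsub>poly_ring n\<^esub> f \<noteq> J +>\<^bsub>poly_ring n\<^esub> g"
      "mult_by n J L (J +>\<^bsub>poly_ring n\<^esub> f) = mult_by n J L (J +>\<^bsub>poly_ring n\<^esub> g)"
    by (auto simp: inj_on_def quot_component_def)
  have "L * f - L * g \<in> J"
    using fg(4) coset_eq_iff[OF monomial_ideal_ideal forms_carrier[OF times_L_forms[OF fg(1)]]
      forms_carrier[OF times_L_forms[OF fg(2)]]]
    by (simp add: mult_by_coset[OF monomial_ideal_ideal L_carrier] forms_carrier[OF fg(1)]
      forms_carrier[OF fg(2)])
  then have "L * (f - g) \<in> J"
    by (simp add: right_diff_distrib)
  then have "Poly_Mapping.keys (L * (f - g)) \<subseteq> A"
    using mem_monomial_ideal_iff times_L_forms forms_diff fg(1,2) by blast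
  moreover have "f - g \<noteq> 0"
    using fg(3) by auto
  ultimately show "\<exists>G\<in>forms n (d - 1). G \<noteq> 0 \<and> Poly_Mapping.keys (L * G) \<subseteq> A"
    using forms_diff[OF fg(1,2)] by blast
next
  assume "\<exists>G\<in>forms n (d - 1). G \<noteq> 0 \<and> Poly_Mapping.keys (L * G) \<subseteq> A"
  then obtain G where G: "G \<in> forms n (d - 1)" "G \<noteq> 0" "Poly_Mapping.keys (L * G) \<subseteq> A"
    by blast
  have A': "A \<subseteq> {m. Poly_Mapping.keys m \<subseteq> {..n}}"
    using A by (auto simp: mons_def)
  obtain m where m: "m \<in> Poly_Mapping.keys G"
    using G(2) by (metis all_not_in_conv keys_eq_empty)
  have "m \<notin> above A"
    using above_mon_degree[OF A] m G(1) d by (fastforce simp: forms_def)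
  then have "G \<notin> J"
    unfolding J Idl_mono_eq[OF A'] using m by blast
  then have neq: "J +>\<^bsub>poly_ring n\<^esub> G \<noteq> J +>\<^bsub>poly_ring n\<^esub> 0"
    using coset_eq_iff[OF monomial_ideal_ideal forms_carrier[OF G(1)] carrier_zero] by simp
  have zero: "0 \<in> forms n (d - 1)"
    by (simp add: forms_eq)
  have "L * G \<in> J"
    using G mem_monomial_ideal_iff times_L_forms by blast
  then have "mult_by n J L (J +>\<^bsub>poly_ring n\<^esub> G) = mult_by n J L (J +>\<^bsub>poly_ring n\<^esub> 0)"
    using coset_eq_iff[OF monomial_ideal_ideal forms_carrier[OF times_L_forms[OF G(1)]] carrier_zero]
    by (simp add: mult_by_coset[OF monomial_ideal_ideal L_carrier] forms_carrier[OF G(1)] carrier_zero)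
  then show "\<not> inj_on (mult_by n J L) (quot_component n J (d - 1))"
    using neq G(1) zero unfolding inj_on_def quot_component_def by blast
qed

text \<open>Surjectivity yields, for each monomial outside \<open>A\<close>, a form
  \<open>f m\<close> whose product with \<open>L\<close> has that monomial as its only one outside
  \<open>A\<close>. These forms are independent, and a nonzero \<open>G\<close> in the kernel lies
  outside their span, so the source has dimension at least one more than the target.\<close>

lemma surj_imp_card_less:
  assumes surj: "mult_by n J L ` quot_component n J (d - 1) = quot_component n J d"
    and G: "G \<in> forms n (d - 1)" "G \<noteq> 0" "Poly_Mapping.keys (L * G) \<subseteq> A"
  shows "card (mons {..n} d - A) < card (mons {..n} (d - 1))"
proof -
  let ?D = "mons {..n} d - A"
  have finD: "finite ?D"
    by (simp add: finite_mons)
  have "\<forall>m\<in>?D. \<exists>f. f \<in> forms n (d - 1) \<and> Poly_Mapping.keys (L * f - mono m) \<subseteq> A"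
  proof
    fix m assume m: "m \<in> ?D"
    have mono: "(mono m :: 'k mpoly) \<in> forms n d"
      using m by (simp add: forms_eq)
    then have "J +>\<^bsub>poly_ring n\<^esub> mono m \<in> mult_by n J L ` quot_component n J (d - 1)"
      using surj by (simp add: quot_component_def)
    then obtain f where f: "f \<in> forms n (d - 1)"
        "mult_by n J L (J +>\<^bsub>poly_ring n\<^esub> f) = J +>\<^bsub>poly_ring n\<^esub> mono m"
      by (auto simp: quot_component_def)
    then have "L * f - mono m \<in> J"
      using coset_eq_iff[OF monomial_ideal_ideal forms_carrier[OF times_L_forms[OF f(1)]]
        forms_carrier[OF mono]]
      by (simp add: mult_by_coset[OF monomial_ideal_ideal L_carrier] forms_carrier[OF f(1)])
    then show "\<exists>f. f \<in> forms n (d - 1) \<and> Poly_Mapping.keys (L * f - mono m) \<subseteq> A"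
      using mem_monomial_ideal_iff forms_diff[OF times_L_forms[OF f(1)] mono] f(1) by blast
  qed
  from bchoice[OF this] obtain f where f: "\<And>m. m \<in> ?D \<Longrightarrow> f m \<in> forms n (d - 1)"
      "\<And>m. m \<in> ?D \<Longrightarrow> Poly_Mapping.keys (L * f m - mono m) \<subseteq> A"
    by blast
  have lookup_f: "Poly_Mapping.lookup (L * f m) m' = (if m = m' then 1 else 0)"
    if "m \<in> ?D" "m' \<in> ?D" for m m'
  proof -
    have "m' \<notin> Poly_Mapping.keys (L * f m - mono m)"
      using f(2) that by blast
    then show ?thesis
      by (simp add: in_keys_iff lookup_minus lookup_single when_def split: if_splits)
  qed
  have coeff: "c m = Poly_Mapping.lookup (L * (\<Sum>v\<in>?D. Poly_Mapping.single 0 (c v) * f v)) m"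
    if "m \<in> ?D" for c m
  proof -
    have "L * (\<Sum>v\<in>?D. Poly_Mapping.single 0 (c v) * f v) =
        (\<Sum>v\<in>?D. Poly_Mapping.single 0 (c v) * (L * f v))"
      by (simp only: sum_distrib_left mult.left_commute)
    then have "Poly_Mapping.lookup (L * (\<Sum>v\<in>?D. Poly_Mapping.single 0 (c v) * f v)) m =
        (\<Sum>v\<in>?D. c v * Poly_Mapping.lookup (L * f v) m)"
      by (simp only: lookup_sum lookup_const_times)
    also have "\<dots> = (\<Sum>v\<in>?D. if v = m then c v else 0)"
      using that lookup_f by (intro sum.cong) auto
    finally show ?thesis
      using that finD by (simp add: sum.delta)
  qed
  have inj: "inj_on f ?D"
  proof (rule inj_onI)
    fix x y assume x: "x \<in> ?D" and y: "y \<in> ?D" and "f x = f y"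
    then have "Poly_Mapping.lookup (L * f y) x = 1"
      using lookup_f[OF x x] by simp
    then show "x = y"
      unfolding lookup_f[OF y x] by (metis zero_neq_one)
  qed
  have indep: "mp.independent (f ` ?D)"
  proof -
    have "u (f m) = 0"
      if sum: "(\<Sum>v\<in>f ` ?D. Poly_Mapping.single 0 (u v) * v) = 0" and m: "m \<in> ?D" for u m
    proof -
      have "(\<Sum>v\<in>?D. Poly_Mapping.single 0 (u (f v)) * f v) = 0"
        using sum by (subst (asm) sum.reindex[OF inj]) (simp only: o_def)
      then show ?thesis
        using coeff[OF m, of "u \<circ> f"] by simp
    qed
    then show ?thesis
      using finD by (subst mp.dependent_finite) blast+
  qed
  have notin: "G \<notin> mp.span (f ` ?D)"
  proof
    assume "G \<in> mp.span (f ` ?D)"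
    then obtain u where "G = (\<Sum>v\<in>f ` ?D. Poly_Mapping.single 0 (u v) * v)"
      using finD by (subst (asm) mp.span_finite) auto
    then have Gu: "G = (\<Sum>v\<in>?D. Poly_Mapping.single 0 (u (f v)) * f v)"
      by (subst (asm) sum.reindex[OF inj]) (simp only: o_def)
    have "u (f m) = 0" if "m \<in> ?D" for m
    proof -
      have "u (f m) = Poly_Mapping.lookup (L * G) m"
        unfolding Gu using coeff[OF that, of "u \<circ> f"] by simp
      also have "\<dots> = 0"
        using G(3) that by (auto simp: in_keys_iff)
      finally show ?thesis .
    qed
    then have "G = 0"
      unfolding Gu by (intro sum.neutral ballI) (simp only: single_zero mult_zero_left)
    then show False
      using G(2) by blast
  qed
  have fin: "finite ((mono :: _ \<Rightarrow> 'k mpoly) ` mons {..n} (d - 1))"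
    by (simp add: finite_mons)
  have sub: "insert G (f ` ?D) \<subseteq> mp.span (mono ` mons {..n} (d - 1))"
    using G(1) f(1) by (auto simp: forms_eq intro!: span_mono)
  have "card (insert G (f ` ?D)) \<le> card ((mono :: _ \<Rightarrow> 'k mpoly) ` mons {..n} (d - 1))"
    by (rule mp.independent_span_bound[OF fin mp.independent_insertI[OF notin indep] sub, THEN conjunct2])
  also have "\<dots> = card (mons {..n} (d - 1))"
    by (rule card_image[OF inj_mono])
  finally have le: "card (insert G (f ` ?D)) \<le> card (mons {..n} (d - 1))" .
  have "G \<notin> f ` ?D"
    by (rule contra_subsetD[OF mp.span_superset notin])
  then have "card (insert G (f ` ?D)) = Suc (card (f ` ?D))"
    by (rule card_insert_disjoint[OF finite_imageI[OF finD]])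
  also have "card (f ` ?D) = card ?D"
    by (rule card_image[OF inj])
  finally show ?thesis
    using le by linarith
qed

end

lemma card_mons_atMost: "card (mons {..n} e) = (n + e) choose n"
  using card_mons[of "{..n}" e] by (simp add: binomial_symmetric[of n "n + e"])

text \<open>By Pascal's rule the bound on \<open>card A\<close> is the dimension of the forms of
  degree \<open>d\<close> minus that of the forms of degree \<open>d - 1\<close>. So the target of
  the multiplication is at least as large as the source, and a map with nonzero kernel cannot be
  surjective.\<close>

lemma not_mult_max_rank_iff:
  fixes L :: "'k::field mpoly"
  assumes A: "A \<subseteq> mons {..n} d" and d: "0 < d" and n: "0 < n"
    and L: "Poly_Mapping.keys L \<subseteq> mons {..n} 1"
    and card: "card A \<le> (n + d - 1) choose (n - 1)"
  shows "\<not> mult_max_rank n (Idl\<^bsub>poly_ring n\<^esub> (mono ` A)) (d - 1) L \<longleftrightarrow>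
    (\<exists>G\<in>forms n (d - 1). G \<noteq> 0 \<and> Poly_Mapping.keys (L * G) \<subseteq> A)"
proof -
  obtain n' d' where nd: "n = Suc n'" "d = Suc d'"
    using n d gr0_implies_Suc by metis
  have "card (mons {..n} d - A) = card (mons {..n} d) - card A"
    using A finite_subset[OF A] by (intro card_Diff_subset) (simp_all add: finite_mons)
  then have "card (mons {..n} (d - 1)) \<le> card (mons {..n} d - A)"
    using card by (simp add: card_mons_atMost nd)
  then show ?thesis
    using not_inj_mult_by_iff[OF A d L refl] surj_imp_card_less[OF A d L refl] d
    unfolding mult_max_rank_def by (metis Suc_diff_1 leD)
qed

lemma poly_subst_const: "poly (subst (\<lambda>c. [:c:]) \<sigma> p) t = poly_eval (\<lambda>i. poly (\<sigma> i) t) p"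
  by (simp add: subst_def mon_val_def poly_eval_def poly_sum poly_prod)

text \<open>A nonempty open set meets the torus: along a suitable line, a defining polynomial and
  all coordinates are nonzero polynomials in one parameter, and over an infinite field their product
  has a non-root.\<close>

lemma zariski_open_nonzero_coords:
  assumes "zariski_open n U" "U \<noteq> ({} :: (nat \<Rightarrow> 'k::field_char_0) set)"
  obtains a where "a \<in> U" "\<And>i. i \<le> n \<Longrightarrow> a i \<noteq> 0"
proof -
  obtain S where S: "S \<subseteq> carrier (poly_ring n)"
      "U = {a \<in> affine_space n. \<exists>f\<in>S. poly_eval a f \<noteq> (0 :: 'k)}"
    using assms(1) by (auto simp: zariski_open_def)
  then obtain a0 f where f: "f \<in> S" "poly_eval a0 f \<noteq> 0"
    using assms(2) by blast
  \<comment> \<open>The line from \<open>a0\<close> at t = 0 to (1, ..., 1) at t = 1. The first end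
    makes \<open>f\<close> nonzero along it, the second every coordinate.\<close>
  define \<sigma> where "\<sigma> i = [:a0 i, 1 - a0 i:]" for i
  define P where "P = subst (\<lambda>c. [:c:]) \<sigma> f * (\<Prod>i\<le>n. \<sigma> i)"
  have "poly (subst (\<lambda>c. [:c:]) \<sigma> f) 0 \<noteq> 0"
    using f(2) by (simp add: poly_subst_const \<sigma>_def)
  then have "subst (\<lambda>c. [:c:]) \<sigma> f \<noteq> 0"
    by auto
  moreover have "\<sigma> i \<noteq> 0" for i
    by (auto simp: \<sigma>_def)
  ultimately have "P \<noteq> 0"
    by (simp add: P_def)
  then obtain t where t: "poly P t \<noteq> 0"
    using poly_roots_finite[of P] infinite_UNIV_char_0[where 'a = 'k]
    by (metis (mono_tags, lifting) Collect_cong UNIV_def mem_Collect_eq)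
  \<comment> \<open>Points of \<open>affine_space n\<close> are extensional functions;
    \<open>f\<close> involves only the variables up to \<open>n\<close>, so the restriction does not
    change its value.\<close>
  define a where "a = restrict (\<lambda>i. poly (\<sigma> i) t) {..n}"
  have "poly_eval a f = poly_eval (\<lambda>i. poly (\<sigma> i) t) f"
    unfolding poly_eval_eq_subst subst_def
  proof (rule sum.cong)
    fix m assume "m \<in> Poly_Mapping.keys f"
    then have "Poly_Mapping.keys m \<subseteq> {..n}"
      using f(1) S(1) by (auto simp: carrier_poly_ring)
    then have "mon_val a m = mon_val (\<lambda>i. poly (\<sigma> i) t) m"
      by (intro mon_val_cong) (auto simp: a_def)
    then show "id (Poly_Mapping.lookup f m) * mon_val a m =
        id (Poly_Mapping.lookup f m) * mon_val (\<lambda>i. poly (\<sigma> i) t) m"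
      by simp
  qed simp
  then have "poly_eval a f \<noteq> 0" "\<And>i. i \<le> n \<Longrightarrow> a i \<noteq> 0"
    using t by (auto simp: P_def poly_subst_const poly_prod a_def)
  moreover have "a \<in> affine_space n"
    by (simp add: a_def affine_space_def)
  ultimately show ?thesis
    using S(2) f(1) by (intro that[of a]) auto
qed

lemma zariski_open_torus:
  "zariski_open n {a \<in> affine_space n. \<forall>i\<le>n. a i \<noteq> (0 :: 'k::field)}"
  unfolding zariski_open_def
proof (intro exI conjI)
  define e :: "nat \<Rightarrow>\<^sub>0 nat" where "e = (\<Sum>i\<le>n. Poly_Mapping.single i 1)"
  have lookup: "Poly_Mapping.lookup e i = (if i \<le> n then 1 else 0)" for i
    by (simp add: e_def lookup_sum lookup_single when_def)
  then have keys: "Poly_Mapping.keys e = {..n}"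
    by (auto simp: in_keys_iff split: if_splits)
  show "{mono e} \<subseteq> carrier (poly_ring n :: 'k mpoly ring)"
    by (simp add: carrier_single keys)
  have "poly_eval a (mono e :: 'k mpoly) = (\<Prod>i\<le>n. a i)" for a
    by (simp add: poly_eval_eq_subst mon_val_def keys lookup)
  then show "{a \<in> affine_space n. \<forall>i\<le>n. a i \<noteq> (0 :: 'k)} =
      {a \<in> affine_space n. \<exists>f\<in>{mono e}. poly_eval a f \<noteq> 0}"
    by auto
qed

text \<open>The combinatorial criterion behind both the bounds and the examples; its three clauses
  correspond to those of the definition. A single linear form replaces the general one since every
  nonempty open set meets the torus, the torus is itself open, and rescaling variables moves any of
  its points to (1, ..., 1) without changing supports.\<close>

theorem togliatti_system_monomial_iff:
  assumes A: "A \<subseteq> mons {..n} d" and d: "0 < d" and n: "0 < n"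
  shows "togliatti_system n d (Idl\<^bsub>poly_ring n\<^esub> ((mono :: _ \<Rightarrow> 'k::field_char_0 mpoly) ` A)) \<longleftrightarrow>
    (\<forall>i\<le>n. Poly_Mapping.single i d \<in> A) \<and> card A \<le> (n + d - 1) choose (n - 1) \<and>
    (\<exists>G\<in>forms n (d - 1). G \<noteq> (0 :: 'k mpoly) \<and> Poly_Mapping.keys (var_sum {..n} * G) \<subseteq> A)"
    (is "togliatti_system n d ?I \<longleftrightarrow> ?powers \<and> ?card \<and> ?kernel")
proof -
  have art: "artinian_ideal n ?I \<longleftrightarrow> ?powers"
    using artinian_ideal_imp_powers[OF A] powers_imp_artinian_ideal[OF A] by blast
  have gen: "(\<exists>F\<subseteq>forms n d. finite F \<and> card F \<le> (n + d - 1) choose (n - 1) \<and>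
      ?I = Idl\<^bsub>poly_ring n\<^esub> F) \<longleftrightarrow> ?card"
  proof
    assume "\<exists>F\<subseteq>forms n d. finite F \<and> card F \<le> (n + d - 1) choose (n - 1) \<and> ?I = Idl\<^bsub>poly_ring n\<^esub> F"
    then obtain F where F: "F \<subseteq> forms n d" "finite F" "card F \<le> (n + d - 1) choose (n - 1)"
        "?I = Idl\<^bsub>poly_ring n\<^esub> F"
      by blast
    moreover from F(1) have "F \<subseteq> carrier (poly_ring n)"
      using forms_carrier by blast
    ultimately show ?card
      using card_le_generators[OF A F(2)] by force
  next
    assume ?card
    moreover have "mono ` A \<subseteq> (forms n d :: 'k mpoly set)"
      using A by (auto simp: forms_eq)
    moreover have "finite A"
      using finite_subset[OF A] finite_mons by blast
    ultimately show "\<exists>F\<subseteq>forms n d. finite F \<and> card F \<le> (n + d - 1) choose (n - 1) \<and>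
        ?I = Idl\<^bsub>poly_ring n\<^esub> F"
      by (intro exI[of _ "mono ` A"]) (simp add: card_image inj_mono)
  qed
  have "fails_WLP_in_degree n ?I (d - 1) \<longleftrightarrow> ?kernel" if card: ?card
  proof -
    have rank: "\<not> mult_max_rank n ?I (d - 1) (linear_form n a) \<longleftrightarrow>
        (\<exists>G\<in>forms n (d - 1). G \<noteq> 0 \<and> Poly_Mapping.keys (linear_form n a * G) \<subseteq> A)" for a
      by (rule not_mult_max_rank_iff[OF A d n keys_linear_form card])
    show ?thesis
    proof
      assume "fails_WLP_in_degree n ?I (d - 1)"
      then obtain U where U: "zariski_open n U" "U \<noteq> {}"
          "\<forall>a\<in>U. \<not> mult_max_rank n ?I (d - 1) (linear_form n a)"
        by (auto simp: fails_WLP_in_degree_def for_general_linear_form_def)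
      obtain a where a: "a \<in> U" "\<And>i. i \<le> n \<Longrightarrow> a i \<noteq> 0"
        using zariski_open_nonzero_coords[OF U(1,2)] by blast
      then obtain G where "G \<in> forms n (d - 1)" "G \<noteq> 0" "Poly_Mapping.keys (linear_form n a * G) \<subseteq> A"
        using U(3) rank by blast
      \<comment> \<open>Rescaling by the inverses of the coefficients turns
        \<open>linear_form n a\<close> into the sum of the variables.\<close>
      then show ?kernel
        using scale_vars_kernel[of n "\<lambda>_. 1" "\<lambda>i. inverse (a i)" a G "d - 1" A] a(2)
        by (simp add: linear_form_one)
    next
      assume ?kernel
      then obtain G where G: "G \<in> forms n (d - 1)" "G \<noteq> (0 :: 'k mpoly)"
          "Poly_Mapping.keys (linear_form n (\<lambda>_. 1) * G) \<subseteq> A"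
        by (auto simp: linear_form_one)
      let ?U = "{a \<in> affine_space n. \<forall>i\<le>n. a i \<noteq> (0 :: 'k)}"
      have "restrict (\<lambda>_. 1) {..n} \<in> ?U"
        by (auto simp: affine_space_def)
      moreover have "\<not> mult_max_rank n ?I (d - 1) (linear_form n a)" if "a \<in> ?U" for a
        unfolding rank using that by (intro scale_vars_kernel[OF _ _ G, of a a]) auto
      ultimately show "fails_WLP_in_degree n ?I (d - 1)"
        unfolding fails_WLP_in_degree_def for_general_linear_form_def
        using zariski_open_torus by blast
    qed
  qed
  then show ?thesis
    unfolding togliatti_system_def art gen by blast
qed

section \<open>The lower bound\<close>

definition pures :: "nat set \<Rightarrow> nat \<Rightarrow> (nat \<Rightarrow>\<^sub>0 nat) set" where
  "pures V d = (\<lambda>i. Poly_Mapping.single i d) ` V"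

lemma pures_subset_mons: "pures V d \<subseteq> mons V d"
  by (auto simp: pures_def mons_def split: if_splits)

lemma keys_var_sum_times:
  "Poly_Mapping.keys G \<subseteq> mons V e \<Longrightarrow> Poly_Mapping.keys (var_sum V * G) \<subseteq> mons V (Suc e)"
  using mons_mult[OF keys_var_sum, of G V e] by simp

text \<open>For each variable, a monomial of \<open>G\<close> that is maximal in that variable survives
  multiplication by it.\<close>

lemma card_le_keys_var_sum_times:
  fixes G :: "'k::comm_ring_1 mpoly"
  assumes V: "finite V" and G: "G \<noteq> 0"
  shows "card V \<le> card (Poly_Mapping.keys (var_sum V * G))"
proof -
  have "\<exists>m\<in>Poly_Mapping.keys G. \<forall>m'\<in>Poly_Mapping.keys G. Poly_Mapping.lookup m' i \<le> Poly_Mapping.lookup m i" for i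
  proof -
    let ?S = "(\<lambda>m. Poly_Mapping.lookup m i) ` Poly_Mapping.keys G"
    have "?S \<noteq> {}"
      using G by (simp add: keys_eq_empty)
    then have "Max ?S \<in> ?S"
      by (intro Max_in) auto
    then obtain m where "m \<in> Poly_Mapping.keys G" "Poly_Mapping.lookup m i = Max ?S"
      by (metis imageE)
    then show ?thesis
      by (intro bexI[of _ m]) auto
  qed
  then obtain f where f: "\<And>i. f i \<in> Poly_Mapping.keys G"
      "\<And>i m. m \<in> Poly_Mapping.keys G \<Longrightarrow> Poly_Mapping.lookup m i \<le> Poly_Mapping.lookup (f i) i"
    by metis
  let ?g = "\<lambda>i. Poly_Mapping.single i 1 + f i"
  have "?g i \<in> Poly_Mapping.keys (var_sum V * G)" if i: "i \<in> V" for i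
  proof -
    have other: "Poly_Mapping.lookup G (?g i - Poly_Mapping.single j 1) = 0" if "j \<noteq> i" for j
    proof -
      have "Poly_Mapping.lookup (?g i - Poly_Mapping.single j 1) i = Suc (Poly_Mapping.lookup (f i) i)"
        using that by (simp add: lookup_add lookup_minus lookup_single when_def)
      then have "?g i - Poly_Mapping.single j 1 \<notin> Poly_Mapping.keys G"
        using f(2)[of "?g i - Poly_Mapping.single j 1" i] by auto
      then show ?thesis
        by (simp add: in_keys_iff)
    qed
    have "Poly_Mapping.lookup (var_sum V * G) (?g i) =
        (\<Sum>j\<in>V \<inter> Poly_Mapping.keys (?g i). if j = i then Poly_Mapping.lookup G (f i) else 0)"
      unfolding lookup_var_sum_times[OF V]
      by (rule sum.cong[OF refl]) (auto simp: other simp del: One_nat_def)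
    also have "\<dots> = Poly_Mapping.lookup G (f i)"
      using i V by (simp add: sum.delta keys_add_nat)
    finally show ?thesis
      using f(1)[of i] by (simp add: in_keys_iff)
  qed
  moreover have "inj_on ?g V"
  proof (rule inj_onI, rule ccontr)
    fix i j assume eq: "?g i = ?g j" and "i \<noteq> j"
    have "Poly_Mapping.lookup (?g i) i = Poly_Mapping.lookup (?g j) i"
      by (rule arg_cong[OF eq])
    then have "Suc (Poly_Mapping.lookup (f i) i) = Poly_Mapping.lookup (f j) i"
      using \<open>i \<noteq> j\<close> unfolding lookup_add by (simp add: lookup_single)
    then show False
      using f(2)[OF f(1)[of j], of i] by simp
  qed
  ultimately show ?thesis
    by (intro card_inj_on_le[of ?g]) auto
qed

text \<open>The four polynomials are, up to sign, the values of x^d, y^d, z^d and x^a y^b z^c on the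
  line x = t, y = 1, z = -(1 + t) inside x + y + z = 0. Comparing a few coefficients shows that they
  are independent.\<close>

lemma binomial_relation_trivial:
  fixes \<alpha> \<beta> \<gamma> \<delta> :: "'k::field_char_0"
  assumes eq: "monom \<alpha> d + [:\<beta>:] + smult \<gamma> ([:1, 1:] ^ d) + smult \<delta> (monom 1 a * [:1, 1:] ^ c) = 0"
    and d: "4 \<le> d" and abc: "a + b + c = d" "a < d" "b < d" "c < d"
  shows "\<alpha> = 0" "\<beta> = 0" "\<gamma> = 0" "\<delta> = 0"
proof -
  define l :: "'k poly" where "l = [:1, 1:]"
  have l: "coeff (l ^ m) j = of_nat (m choose j)" for m j
  proof (cases "j \<le> m")
    case True
    then show ?thesis
      using coeff_linear_poly_power[OF True, of "1 :: 'k" 1] by (simp only: l_def power_one mult_1_right)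
  next
    case False
    have "degree (l ^ m) \<le> m"
      using degree_power_le[of l m] by (simp add: l_def)
    then show ?thesis
      using False by (simp add: coeff_eq_0 binomial_eq_0)
  qed
  have coeff: "(if i = d then \<alpha> else 0) + (if i = 0 then \<beta> else 0) + \<gamma> * of_nat (d choose i) +
      \<delta> * (if a \<le> i then of_nat (c choose (i - a)) else 0) = 0" for i
    using arg_cong[OF eq[folded l_def], of "\<lambda>p. coeff p i"]
    by (auto simp: l coeff_monom_mult coeff_pCons not_less split: nat.splits if_splits)
  have mid: "\<gamma> * of_nat (d choose i) + \<delta> * (if a \<le> i then of_nat (c choose (i - a)) else 0) = 0"
    if "0 < i" "i < d" for i
    using coeff[of i] that by simp
  \<comment> \<open>If \<gamma> is nonzero, the coefficient of t forces a <= 1 and that of t^(d-1)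
    forces b <= 1. In each of the three remaining cases the coefficients of t and t^2 are
    incompatible.\<close>
  show \<gamma>: "\<gamma> = 0"
  proof (rule ccontr)
    assume nz: "\<gamma> \<noteq> 0"
    have eq1: "\<gamma> * of_nat d + \<delta> * (if a \<le> 1 then of_nat (c choose (1 - a)) else 0) = 0"
      using mid[of 1] d by simp
    have "a \<le> 1"
      using eq1 nz d by (auto split: if_splits)
    moreover have "b \<le> 1"
    proof (rule ccontr)
      assume "\<not> b \<le> 1"
      then have "c choose (d - 1 - a) = 0"
        using abc by (intro binomial_eq_0) simp
      then have "\<gamma> * of_nat (d choose (d - 1)) = 0"
        using mid[of "d - 1"] d by (simp only: of_nat_0 if_cancel mult_zero_right add_0_right)
      then show False
        using nz d by (simp add: binomial_eq_0_iff)
    qed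
    ultimately have cases: "a = 0 \<and> b = 1 \<and> c = d - 1 \<or> a = 1 \<and> b = 0 \<and> c = d - 1 \<or>
        a = 1 \<and> b = 1 \<and> c = d - 2"
      using abc by auto
    define x where "x = (of_nat d :: 'k)"
    define P where "P m = (of_nat (m choose 2) :: 'k)" for m
    have P2: "2 * P m = of_nat m * (of_nat m - 1)" if "1 \<le> m" for m
    proof -
      have "even (m * (m - 1))"
        by (cases m) auto
      then have "2 * (m choose 2) = m * (m - 1)"
        unfolding choose_two by (rule dvd_mult_div_cancel)
      then have "of_nat (2 * (m choose 2)) = (of_nat (m * (m - 1)) :: 'k)"
        by (rule arg_cong)
      then show ?thesis
        using that by (simp add: P_def of_nat_diff)
    qed
    have P: "2 * P d = x * (x - 1)" "2 * P (d - 1) = (x - 1) * (x - 2)"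
      using P2[of d] P2[of "d - 1"] d by (simp_all add: x_def of_nat_diff)
    have "x \<noteq> of_nat i" if "i < 4" for i
      unfolding x_def of_nat_eq_iff using that d by simp
    from this[of 0] this[of 1] this[of 3] have x: "x \<noteq> 0" "x \<noteq> 1" "x \<noteq> 3"
      by simp_all
    have eq2: "\<gamma> * P d + \<delta> * (if a \<le> 2 then of_nat (c choose (2 - a)) else 0) = 0"
      using mid[of 2] d by (simp add: P_def)
    from cases show False
    proof (elim disjE)
      assume "a = 0 \<and> b = 1 \<and> c = d - 1"
      then have "\<gamma> * x + \<delta> * (x - 1) = 0" "\<gamma> * P d + \<delta> * P (d - 1) = 0"
        using eq1 eq2 d by (simp_all add: x_def P_def of_nat_diff)
      moreover have "\<delta> * (x - 1) = (x - 1) * (\<gamma> * x + \<delta> * (x - 1)) -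
          (\<gamma> * (2 * P d) + \<delta> * (2 * P (d - 1)))"
        unfolding P by (simp add: algebra_simps)
      ultimately have "\<delta> * (x - 1) = (x - 1) * 0 - 2 * 0"
        by (metis distrib_left mult.left_commute)
      then have "\<delta> * (x - 1) = 0"
        by simp
      then show False
        using \<open>\<gamma> * x + \<delta> * (x - 1) = 0\<close> nz x by simp
    next
      assume "a = 1 \<and> b = 0 \<and> c = d - 1"
      then have "\<gamma> * x + \<delta> = 0" "\<gamma> * P d + \<delta> * (x - 1) = 0"
        using eq1 eq2 d by (simp_all add: x_def P_def of_nat_diff)
      moreover have "\<delta> * (x - 1) = (\<gamma> * (2 * P d) + \<delta> * (2 * (x - 1))) - (x - 1) * (\<gamma> * x + \<delta>)"
        unfolding P by (simp add: algebra_simps)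
      ultimately have "\<delta> * (x - 1) = 2 * 0 - (x - 1) * 0"
        by (metis distrib_left mult.left_commute)
      then have "\<delta> * (x - 1) = 0"
        by simp
      then show False
        using \<open>\<gamma> * x + \<delta> = 0\<close> nz x by simp
    next
      \<comment> \<open>The case in which d = 3 would survive, through 1 + t^3 - (1 + t)^3 + 3t(1 +
        t) = 0; the factor \<open>x - 3\<close> below records it.\<close>
      assume "a = 1 \<and> b = 1 \<and> c = d - 2"
      then have "\<gamma> * x + \<delta> = 0" "\<gamma> * P d + \<delta> * (x - 2) = 0"
        using eq1 eq2 d by (simp_all add: x_def P_def of_nat_diff)
      moreover have "\<gamma> * x * (x - 3) = 2 * (x - 2) * (\<gamma> * x + \<delta>) - (\<gamma> * (2 * P d) + \<delta> * (2 * (x - 2)))"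
        unfolding P by (simp add: algebra_simps)
      ultimately have "\<gamma> * x * (x - 3) = 2 * (x - 2) * 0 - 2 * 0"
        by (metis distrib_left mult.left_commute)
      then have "\<gamma> * x * (x - 3) = 0"
        by simp
      then show False
        using nz x by simp
    qed
  qed
  \<comment> \<open>The lowest term t^a would do, but for a = 0 its coefficient is mixed with
    \<beta>; then the coefficient of t is used, where c > 0 because b < d.\<close>
  have "\<delta> * of_nat (c choose (max a 1 - a)) = 0"
    using mid[of "max a 1"] \<gamma> abc d by (simp split: if_splits)
  moreover have "max a 1 - a \<le> c"
    using abc by (cases a) auto
  ultimately show \<delta>: "\<delta> = 0"
    by (simp add: binomial_eq_0_iff)
  show "\<alpha> = 0" "\<beta> = 0"
    using coeff[of d] coeff[of 0] \<gamma> \<delta> d by auto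
qed

lemma var_sum_neq_0:
  assumes "finite V" "x \<in> V"
  shows "var_sum V \<noteq> (0 :: 'k::comm_ring_1 mpoly)"
proof
  assume "var_sum V = (0 :: 'k mpoly)"
  then have "(\<Sum>i\<in>V. if i = x then 1 else 0) = (0 :: 'k)"
    by (simp only: id_hom.subst_zero flip: id_hom.subst_var_sum)
  then show False
    using assms by (simp add: sum.delta)
qed

text \<open>Substituting x = t, y = 1, z = -(1 + t) makes the product vanish. The surviving
  monomials become the independent polynomials of \<open>binomial_relation_trivial\<close>, so all
  coefficients of the product are zero.\<close>

lemma keys_relation_three_variables:
  fixes G :: "'k::field_char_0 mpoly"
  assumes V: "V = {x, y, z}" "x \<noteq> y" "x \<noteq> z" "y \<noteq> z" and d: "4 \<le> d"
    and G: "Poly_Mapping.keys (var_sum V * G) \<subseteq> insert m (pures V d)"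
    and m: "m \<in> mons V d" "m \<notin> pures V d"
  shows "G = 0"
proof -
  let ?H = "var_sum V * G"
  let ?a = "Poly_Mapping.lookup m x" and ?b = "Poly_Mapping.lookup m y" and ?c = "Poly_Mapping.lookup m z"
  let ?h = "Poly_Mapping.lookup ?H"
  define X where "X i = Poly_Mapping.single i d" for i :: nat
  have pures: "pures V d = {X x, X y, X z}"
    by (simp add: pures_def V(1) X_def)
  have X_neq: "X i \<noteq> X j" if "i \<noteq> j" for i j
    using that d by (auto simp: X_def dest!: arg_cong[where f = Poly_Mapping.keys])
  have abc: "?a + ?b + ?c = d"
    using mon_degree_eq_sum[of V m] m(1) V by (auto simp: mons_def)
  have less: "Poly_Mapping.lookup m i < d" if "i \<in> V" for i
    using single_of_mon_degree_le[of m d i] m that by (force simp: pures_def mons_def not_less)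
  define l :: "'k poly" where "l = [:1, 1:]"
  define \<sigma> :: "nat \<Rightarrow> 'k poly" where
    "\<sigma> i = (if i = x then [:0, 1:] else if i = y then 1 else - l)" for i
  have \<sigma>: "\<sigma> x = [:0, 1:]" "\<sigma> y = 1" "\<sigma> z = - l"
    using V by (auto simp: \<sigma>_def)
  have "subst (\<lambda>c. [:c:]) \<sigma> (var_sum V) = 0"
  proof -
    have "[:0, 1:] + (1 + - l) = 0"
      unfolding l_def poly_eq_poly_eq_iff[symmetric] by (rule ext) simp
    moreover have "x \<notin> {y, z}" "y \<notin> {z}"
      using V by auto
    then have "sum \<sigma> V = \<sigma> x + (\<sigma> y + \<sigma> z)"
      by (simp add: V(1))
    ultimately show ?thesis
      by (simp only: poly_hom.subst_var_sum \<sigma>)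
  qed
  then have "subst (\<lambda>c. [:c:]) \<sigma> ?H = 0"
    by (simp only: poly_hom.subst_mult mult_zero_left)
  moreover have "subst (\<lambda>c. [:c:]) \<sigma> ?H =
      (\<Sum>u\<in>{X x, X y, X z, m}. [:?h u:] * mon_val \<sigma> u)"
    by (rule poly_hom.subst_eq_sum) (use G in \<open>auto simp: pures\<close>)
  moreover have "X x \<notin> {X y, X z, m}" "X y \<notin> {X z, m}" "X z \<notin> {m}"
    using X_neq V m(2) unfolding pures by auto
  ultimately have "[:?h (X x):] * mon_val \<sigma> (X x) + ([:?h (X y):] * mon_val \<sigma> (X y) +
      ([:?h (X z):] * mon_val \<sigma> (X z) + [:?h m:] * mon_val \<sigma> m)) = 0"
    by (simp only: sum.insert finite.emptyI finite_insert sum.empty add_0_right not_False_eq_True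
      empty_iff)
  moreover have "mon_val \<sigma> m = \<sigma> x ^ ?a * (\<sigma> y ^ ?b * \<sigma> z ^ ?c)"
    using mon_val_eq_prod[of V m \<sigma>] m(1) V(2-4) by (simp add: V(1) mons_def)
  moreover have "(- l) ^ e = smult ((- 1) ^ e) (l ^ e)" for e :: nat
    using smult_power[of "- 1" l e] by simp
  moreover have "[:0, 1:] ^ e = monom (1 :: 'k) e" for e
    by (simp add: monom_altdef)
  ultimately have "monom (?h (X x)) d + [:?h (X y):] + smult ((- 1) ^ d * ?h (X z)) (l ^ d) +
      smult ((- 1) ^ ?c * ?h m) (monom 1 ?a * l ^ ?c) = 0"
    by (simp add: X_def \<sigma> smult_monom add.assoc)
  note rel = this[unfolded l_def]
  have "?h (X x) = 0 \<and> ?h (X y) = 0 \<and> ?h (X z) = 0 \<and> ?h m = 0"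
    using binomial_relation_trivial[OF rel d abc] less V(1) by simp
  then have "?H = 0"
    using G by (intro poly_mapping_eqI) (auto simp: pures in_keys_iff)
  moreover have "var_sum V \<noteq> (0 :: 'k mpoly)"
    using V(1) by (intro var_sum_neq_0[of V x]) simp_all
  ultimately show ?thesis
    by simp
qed

theorem card_nonpure_ge:
  fixes G :: "'k::field_char_0 mpoly"
  assumes "finite V" "3 \<le> card V" "4 \<le> d" "G \<noteq> 0" "Poly_Mapping.keys G \<subseteq> mons V (d - 1)"
  shows "card V - 1 \<le> card (Poly_Mapping.keys (var_sum V * G) - pures V d)"
  using assms
proof (induction "card V" arbitrary: V G rule: less_induct)
  case less
  let ?N = "Poly_Mapping.keys (var_sum V * G) - pures V d"
  have finN: "finite ?N"
    by simp
  have H: "Poly_Mapping.keys (var_sum V * G) \<subseteq> mons V d"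
    using keys_var_sum_times[OF less.prems(5)] less.prems(3) by simp
  show ?case
  proof (cases "\<exists>i\<in>V. \<forall>m\<in>Poly_Mapping.keys G. i \<in> Poly_Mapping.keys m")
    case True
    then obtain i where i: "i \<in> V" "\<And>m. m \<in> Poly_Mapping.keys G \<Longrightarrow> i \<in> Poly_Mapping.keys m"
      by blast
    have "i \<in> Poly_Mapping.keys m" if "m \<in> Poly_Mapping.keys (var_sum V * G)" for m
      using keys_mult[of "var_sum V" G] that i(2) by (auto simp: keys_add_nat)
    \<comment> \<open>As x_i divides the whole product, x_i^d is the only pure power that can occur;
      at most one of the at least \<open>card V\<close> monomials is lost.\<close>
    then have "m = Poly_Mapping.single i d" if "m \<in> Poly_Mapping.keys (var_sum V * G)" "m \<in> pures V d" for m
      using that less.prems(3) by (fastforce simp: pures_def)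
    then have "Poly_Mapping.keys (var_sum V * G) \<subseteq> insert (Poly_Mapping.single i d) ?N"
      by blast
    then have "card (Poly_Mapping.keys (var_sum V * G)) \<le> card (insert (Poly_Mapping.single i d) ?N)"
      by (intro card_mono) simp_all
    also have "\<dots> \<le> Suc (card ?N)"
      by (rule card_insert_le_m1[THEN order_trans]) (use finN in auto)
    finally show ?thesis
      using card_le_keys_var_sum_times[OF less.prems(1,4)] by linarith
  next
    case False
    show ?thesis
    proof (cases "card V = 3")
      case True
      then obtain x y z where V: "V = {x, y, z}" "x \<noteq> y" "x \<noteq> z" "y \<noteq> z"
        by (metis card_3_iff)
      show ?thesis
      proof (rule ccontr)
        assume "\<not> ?thesis"
        then have "card ?N \<le> 1"
          using True by simp
        then obtain m where m: "m \<in> mons V d" "m \<notin> pures V d" "?N \<subseteq> {m}"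
        proof (cases "?N = {}")
          case True
          \<comment> \<open>If there is no non-pure monomial at all, any non-pure \<open>m\<close>
            may be added with coefficient 0; x^(d-1) y is one.\<close>
          have "Poly_Mapping.single x (d - 1) + Poly_Mapping.single y 1 \<in> mons V d"
            using less.prems(3) V by (simp add: mons_def keys_add_nat)
          moreover have "Poly_Mapping.single x (d - 1) + Poly_Mapping.single y 1 \<notin> pures V d"
          proof
            assume "Poly_Mapping.single x (d - 1) + Poly_Mapping.single y 1 \<in> pures V d"
            then obtain i where "Poly_Mapping.single x (d - 1) + Poly_Mapping.single y 1 = Poly_Mapping.single i d"
              by (auto simp: pures_def)
            then have "Poly_Mapping.keys (Poly_Mapping.single x (d - 1) + Poly_Mapping.single y 1) =
                Poly_Mapping.keys (Poly_Mapping.single i d)"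
              by (rule arg_cong)
            then have "{x, y} = {i}"
              using less.prems(3) by (simp add: keys_add_nat insert_commute)
            then show False
              using V by auto
          qed
          ultimately show ?thesis
            using that True by blast
        next
          case False
          then have "card ?N = 1"
            using \<open>card ?N \<le> 1\<close> finN card_gt_0_iff[of ?N] by linarith
          then obtain m where "?N = {m}"
            by (rule card_1_singletonE)
          then show ?thesis
            using that[of m] H by blast
        qed
        then have "G = 0"
          using keys_relation_three_variables[OF V less.prems(3), of G m] by blast
        then show False
          using less.prems(4) by blast
      qed
    next
      case False': False
      \<comment> \<open>No variable divides \<open>G\<close>, so setting x_i = 0 leaves a nonzero
        form in one variable fewer. Induction then finds \<open>card V - 2\<close> non-pure
        monomials free of x_i.\<close>
      define N' where "N' i = {m \<in> ?N. i \<notin> Poly_Mapping.keys m}" for i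
      have N': "card V - 2 \<le> card (N' i)" if i: "i \<in> V" for i
      proof -
        define G' where "G' = part {m. i \<notin> Poly_Mapping.keys m} G"
        let ?V = "V - {i}"
        have keysG': "Poly_Mapping.keys G' = {m \<in> Poly_Mapping.keys G. i \<notin> Poly_Mapping.keys m}"
          by (auto simp: G'_def keys_part)
        then have G': "Poly_Mapping.keys G' \<subseteq> mons ?V (d - 1)" "Poly_Mapping.keys G' \<noteq> {}"
          using less.prems(5) False i by (auto simp: mons_def)
        have card: "card ?V = card V - 1"
          using i less.prems(1) by simp
        have le: "card ?V - 1 \<le> card (Poly_Mapping.keys (var_sum ?V * G') - pures ?V d)"
          using less.prems False' G' card by (intro less.hyps) auto
        have "Poly_Mapping.keys (var_sum ?V * G') - pures ?V d \<subseteq> N' i"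
        proof
          fix m assume m: "m \<in> Poly_Mapping.keys (var_sum ?V * G') - pures ?V d"
          then have "m \<in> mons ?V d"
            using keys_var_sum_times[OF G'(1)] less.prems(3) by auto
          then have im: "i \<notin> Poly_Mapping.keys m"
            by (auto simp: mons_def)
          have im': "i \<notin> Poly_Mapping.keys (m - Poly_Mapping.single j 1)" for j
            using im by (simp add: in_keys_iff lookup_minus)
          have "Poly_Mapping.lookup (var_sum ?V * G') m =
              (\<Sum>j\<in>?V \<inter> Poly_Mapping.keys m. Poly_Mapping.lookup G (m - Poly_Mapping.single j 1))"
            using less.prems(1) im' by (simp add: lookup_var_sum_times G'_def lookup_part del: One_nat_def)
          also have "?V \<inter> Poly_Mapping.keys m = V \<inter> Poly_Mapping.keys m"
            using im by auto
          finally have "m \<in> Poly_Mapping.keys (var_sum V * G)"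
            using m less.prems(1) by (simp add: lookup_var_sum_times in_keys_iff)
          moreover have "m \<notin> pures V d"
            using m im less.prems(3) by (auto simp: pures_def)
          ultimately show "m \<in> N' i"
            using im by (simp add: N'_def)
        qed
        moreover have "finite (N' i)"
          by (simp add: N'_def)
        ultimately have "card (Poly_Mapping.keys (var_sum ?V * G') - pures ?V d) \<le> card (N' i)"
          by (intro card_mono)
        then show ?thesis
          using le card by linarith
      qed
      \<comment> \<open>The one monomial still missing: take \<open>m\<close> in \<open>N' i\<close>
        and a variable x_j occurring in it. Then \<open>m\<close> is not in \<open>N' j\<close> and
        enlarges it by one.\<close>
      obtain i where "i \<in> V"
        using less.prems(2) by fastforce
      then have "0 < card (N' i)"
        using N'[of i] less.prems(2) False' by linarith
      then obtain m where m: "m \<in> N' i"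
        by (metis card.empty equals0I less_irrefl)
      then have "m \<in> mons V d"
        using H by (auto simp: N'_def)
      moreover have "m \<noteq> 0"
        using \<open>m \<in> mons V d\<close> less.prems(3) by (auto simp: mons_def)
      ultimately obtain j where j: "j \<in> V" "j \<in> Poly_Mapping.keys m"
        by (metis (no_types, lifting) all_not_in_conv keys_eq_empty mem_Collect_eq mons_def subset_iff)
      have "insert m (N' j) \<subseteq> ?N"
        using m j by (auto simp: N'_def)
      then have "card (insert m (N' j)) \<le> card ?N"
        by (intro card_mono finN)
      moreover have "m \<notin> N' j" "finite (N' j)"
        using j by (simp_all add: N'_def)
      ultimately show ?thesis
        using N'[OF j(1)] by simp
    qed
  qed
qed

section \<open>Minimality from a one-dimensional kernel\<close>

text \<open>Divisibility by the sum of the variables gives vanishing on a hyperplane, divisibility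
  by its square also vanishing to second order. In two variables the first alone is too weak: x^d +
  y^d is divisible by x + y for odd d, hence the two alternatives.\<close>

lemma pure_sum_divisible_by_power:
  fixes \<alpha> :: "nat \<Rightarrow> 'k::field_char_0"
  assumes V: "finite V" and d: "2 \<le> d" and i: "i \<in> V"
    and a: "2 \<le> a \<and> 2 \<le> card V \<or> 1 \<le> a \<and> 3 \<le> card V"
    and eq: "(\<Sum>i\<in>V. Poly_Mapping.single (Poly_Mapping.single i d) (\<alpha> i)) = var_sum V ^ a * Q"
  shows "\<alpha> i = 0"
proof -
  have other: "\<exists>j\<in>V. j \<notin> S" if "card S < card V" "finite S" for S
    using that V card_mono[of S V] by (meson not_less subset_iff)
  have eval: "(\<Sum>i\<in>V. \<alpha> i * \<sigma> i ^ d) = 0" if "sum \<sigma> V = 0" "a \<noteq> 0" for \<sigma> :: "nat \<Rightarrow> 'k"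
    using arg_cong[OF eq, of "subst id \<sigma>"] that by (simp add: zero_power)
  from a consider "2 \<le> a" "2 \<le> card V" | "1 \<le> a" "3 \<le> card V"
    by blast
  then show ?thesis
  proof cases
    case 1
    obtain j where j: "j \<in> V" "j \<noteq> i"
      using other[of "{i}"] 1 by auto
    define l :: "'k poly" where "l = [:1, 1:]"
    \<comment> \<open>The curve with coordinates 1 + t at i, -1 at j and 0 elsewhere. The sum of the
      variables becomes t, so t^2 divides the image, whose linear coefficient is d times
      \<open>\<alpha> i\<close>.\<close>
    define \<sigma> :: "nat \<Rightarrow> 'k poly" where
      "\<sigma> k = (if k = i then l else 0) + (if k = j then - 1 else 0)" for k
    have "l + - 1 = [:0, 1:]"
      unfolding poly_eq_poly_eq_iff[symmetric] l_def by (rule ext) simp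
    then have "sum \<sigma> V = [:0, 1:]"
      using V i j by (simp add: \<sigma>_def sum.distrib sum.delta)
    then have "subst (\<lambda>c. [:c:]) \<sigma> (var_sum V ^ a * Q) = [:0, 1:] ^ a * subst (\<lambda>c. [:c:]) \<sigma> Q"
      by simp
    also have "[:0, 1:] ^ a = monom (1 :: 'k) a"
      by (simp add: monom_altdef)
    also have "coeff (monom 1 a * subst (\<lambda>c. [:c:]) \<sigma> Q) 1 = 0"
      using 1 by (simp add: coeff_monom_mult)
    finally have "coeff (\<Sum>k\<in>V. [:\<alpha> k:] * \<sigma> k ^ d) 1 = 0"
      by (simp flip: eq)
    moreover have "[:\<alpha> k:] * \<sigma> k ^ d =
        (if k = i then [:\<alpha> i:] * l ^ d else 0) + (if k = j then [:\<alpha> j:] * (- 1) ^ d else 0)" for k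
    proof -
      consider "k = i" "k \<noteq> j" | "k \<noteq> i" "k = j" | "k \<noteq> i" "k \<noteq> j"
        using j by blast
      then show ?thesis
        using d by cases (simp_all add: \<sigma>_def zero_power)
    qed
    ultimately have "coeff ([:\<alpha> i:] * l ^ d + [:\<alpha> j:] * (- 1) ^ d) 1 = 0"
      using V i j by (simp add: sum.distrib sum.delta)
    moreover have "coeff (l ^ d) 1 = of_nat d"
      using coeff_linear_poly_power[of 1 d "1 :: 'k" 1] d by (simp add: l_def)
    moreover have "coeff ((- 1 :: 'k poly) ^ d) 1 = 0"
      by (cases "even d") simp_all
    ultimately have "\<alpha> i * of_nat d = 0"
      by simp
    then show ?thesis
      using d by simp
  next
    case 2
    obtain j where j: "j \<in> V" "j \<noteq> i"
      using other[of "{i}"] 2 by auto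
    obtain k where k: "k \<in> V" "k \<noteq> i" "k \<noteq> j"
      using other[of "{i, j}"] 2 j by auto
    \<comment> \<open>Test points of the hyperplane: here (1, -1), below (1, 1, -2), with zeros
      elsewhere. For even d the pair relations suffice; for odd d they make the three coefficients
      equal, and the triple leaves the nonzero factor 2 - 2^d.\<close>
    have pair: "\<alpha> x + \<alpha> y * (- 1) ^ d = 0" if "x \<in> V" "y \<in> V" "x \<noteq> y" for x y
    proof -
      let ?\<sigma> = "\<lambda>k. (if k = x then 1 else 0) + (if k = y then - 1 else (0 :: 'k))"
      have "(\<Sum>i\<in>V. \<alpha> i * ?\<sigma> i ^ d) = 0"
        using V that 2 by (intro eval) (simp_all add: sum.distrib sum.delta)
      also have "(\<lambda>i. \<alpha> i * ?\<sigma> i ^ d) =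
          (\<lambda>i. (if i = x then \<alpha> x else 0) + (if i = y then \<alpha> y * (- 1) ^ d else 0))"
        using that d by (auto simp: zero_power)
      finally show ?thesis
        using V that by (simp add: sum.distrib sum.delta)
    qed
    have triple: "\<alpha> i + \<alpha> j + \<alpha> k * (- 2) ^ d = 0"
    proof -
      let ?\<sigma> = "\<lambda>l. (if l = i then 1 else 0) + (if l = j then 1 else 0) + (if l = k then - 2 else (0 :: 'k))"
      have "(\<Sum>i\<in>V. \<alpha> i * ?\<sigma> i ^ d) = 0"
        using V i j k 2 by (intro eval) (simp_all add: sum.distrib sum.delta)
      also have "(\<lambda>i. \<alpha> i * ?\<sigma> i ^ d) = (\<lambda>l. (if l = i then \<alpha> i else 0) +
          (if l = j then \<alpha> j else 0) + (if l = k then \<alpha> k * (- 2) ^ d else 0))"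
        using j k d by (auto simp: zero_power)
      finally show ?thesis
        using V i j k by (simp add: sum.distrib sum.delta)
    qed
    define s where "s = ((- 1) ^ d :: 'k)"
    have p: "\<alpha> i = - \<alpha> j * s" "\<alpha> i = - \<alpha> k * s" "\<alpha> j = - \<alpha> k * s"
      using pair[of i j] pair[of i k] pair[of j k] i j k by (simp_all add: s_def eq_neg_iff_add_eq_0)
    show ?thesis
    proof (cases "even d")
      case True
      then have "s = 1"
        by (simp add: s_def)
      then have "2 * \<alpha> i = 0"
        using p by simp
      then show ?thesis
        by simp
    next
      case False
      then have "s = - 1"
        by (simp add: s_def)
      then have "\<alpha> j = \<alpha> i" "\<alpha> k = \<alpha> i"
        using p by simp_all
      then have "\<alpha> i * (2 - 2 ^ d) = 0"
        using triple False by (simp add: algebra_simps)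
      moreover have "(2 :: 'k) ^ d \<noteq> 2"
      proof
        assume "(2 :: 'k) ^ d = 2"
        then have "of_nat (2 ^ d) = (of_nat (2 ^ 1) :: 'k)"
          by simp
        then have "(2 :: nat) ^ d = 2 ^ 1"
          by (simp only: of_nat_eq_iff)
        then show False
          using d by (simp only: power_inject_exp)
      qed
      ultimately show ?thesis
        by simp
    qed
  qed
qed

lemma var_power: "var i ^ e = mono (Poly_Mapping.single i e)"
proof (induction e)
  case (Suc e)
  have "Poly_Mapping.single i (Suc e) = Poly_Mapping.single i 1 + Poly_Mapping.single i e"
    by (simp flip: single_add)
  then have "mono (Poly_Mapping.single i (Suc e)) = mono (Poly_Mapping.single i 1) * mono (Poly_Mapping.single i e)"
    by (simp only: mult_single mult_1_right)
  then show ?case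
    unfolding power_Suc Suc.IH unfolding var_def by (rule sym)
qed simp

lemma mon_val_var: "mon_val var m = mono m"
proof -
  have "(\<Prod>i\<in>S. var i ^ f i) = mono (\<Sum>i\<in>S. Poly_Mapping.single i (f i))" if "finite S" for S f
    using that by (induction S) (simp_all add: var_power mult_single)
  from this[OF finite_keys, of "Poly_Mapping.lookup m" m] show ?thesis
    unfolding mon_val_def poly_mapping_sum_single[OF finite_keys order_refl, of m, symmetric] .
qed

lemma subst_fixed:
  fixes p :: "'k::comm_ring_1 mpoly"
  assumes "\<And>m. m \<in> Poly_Mapping.keys p \<Longrightarrow> Poly_Mapping.keys m \<subseteq> V"
    and "\<And>i. i \<in> V \<Longrightarrow> \<sigma> i = var i"
  shows "subst (Poly_Mapping.single 0) \<sigma> p = p"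
proof -
  have "Poly_Mapping.single 0 c * mon_val \<sigma> m = Poly_Mapping.single m c"
    if "m \<in> Poly_Mapping.keys p" for c m
  proof -
    have "mon_val \<sigma> m = mono m"
      using mon_val_cong[of m \<sigma> var] assms that by (metis mon_val_var subset_iff)
    then show ?thesis
      by (simp add: mult_single)
  qed
  then have "subst (Poly_Mapping.single 0) \<sigma> p =
      (\<Sum>m\<in>Poly_Mapping.keys p. Poly_Mapping.single m (Poly_Mapping.lookup p m))"
    unfolding subst_def by (intro sum.cong) auto
  then show ?thesis
    using poly_mapping_sum_single[of "Poly_Mapping.keys p" p] by simp
qed

lemma mons_power: "Poly_Mapping.keys p \<subseteq> mons V a \<Longrightarrow> Poly_Mapping.keys (p ^ k) \<subseteq> mons V (a * k)"
proof (induction k)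
  case 0
  then show ?case by (auto simp: mons_def)
next
  case (Suc k)
  then show ?case
    using mons_mult[of p V a "p ^ k" "a * k"] by simp
qed

lemma mons_diff:
  fixes p q :: "'k::comm_ring_1 mpoly"
  assumes "Poly_Mapping.keys p \<subseteq> S" "Poly_Mapping.keys q \<subseteq> S"
  shows "Poly_Mapping.keys (p - q) \<subseteq> S"
  using assms keys_diff[of p q] by blast

text \<open>The polynomial
  $x_n^a x_0^b\,(L'^e - (-x_n)^e - (L' + x_n) E)$ with $L' = x_0 + \dots + x_{n-1}$ is divisible by
  $L' + x_n$.  Apart from pure powers, \<open>T\<close> is its set of monomials: \<open>C\<close> are the monomials of $L'^e$
  that are cancelled by $L' E$.\<close>

locale monomial_family =
  fixes n d a b e :: nat and B C :: "(nat \<Rightarrow>\<^sub>0 nat) set" and E :: "'k::field_char_0 mpoly"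
  assumes n: "2 \<le> n" and d: "2 \<le> d" and e: "1 \<le> e" and deg: "a + b + e = d" and b: "b \<le> 1"
    and pure: "a = 0 \<and> b = 0 \<and> pures {..<n} d \<inter> C = {} \<or> 1 \<le> a \<and> 3 \<le> n \<or> 2 \<le> a"
    and C: "C \<subseteq> mons {..<n} e"
    and B: "B \<subseteq> mons {..<n} (e - 1)" "0 \<notin> B"
    and E: "Poly_Mapping.keys E = B"
    and cancel: "\<And>m. m \<in> mons {..<n} e \<Longrightarrow>
      Poly_Mapping.lookup (var_sum {..<n} ^ e - var_sum {..<n} * E) m = 0 \<longleftrightarrow> m \<in> C"
    and unique: "\<And>F :: 'k mpoly. Poly_Mapping.keys F \<subseteq> B \<Longrightarrow>
      (\<And>m. m \<in> C \<Longrightarrow> Poly_Mapping.lookup (var_sum {..<n} * F) m = 0) \<Longrightarrow> F = 0"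
begin

definition \<mu> :: "nat \<Rightarrow>\<^sub>0 nat" where
  "\<mu> = Poly_Mapping.single n a + Poly_Mapping.single 0 b"

definition T :: "(nat \<Rightarrow>\<^sub>0 nat) set" where
  "T = (\<lambda>m. \<mu> + m) ` (mons {..<n} e - C) \<union>
    ((\<lambda>m. \<mu> + (Poly_Mapping.single n 1 + m)) ` B \<union> {\<mu> + Poly_Mapping.single n e})"

definition A :: "(nat \<Rightarrow>\<^sub>0 nat) set" where
  "A = pures {..n} d \<union> T"

abbreviation L' :: "'k mpoly" where "L' \<equiv> var_sum {..<n}"

lemma lookup_n: "m \<in> mons {..<n} k \<Longrightarrow> Poly_Mapping.lookup m n = 0"
  by (auto simp: mons_def simp flip: not_in_keys_iff_lookup_eq_zero)

lemma \<mu>: "\<mu> \<in> mons {..n} (a + b)"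
  by (auto simp: \<mu>_def mons_def keys_add_nat split: if_splits)

lemma T_subset: "T \<subseteq> mons {..n} d"
proof -
  have "mons {..<n} e \<subseteq> mons {..n} e" "mons {..<n} (e - 1) \<subseteq> mons {..n} (e - 1)"
    by (auto simp: mons_def)
  then show ?thesis
    using \<mu> B(1) deg e unfolding T_def by (fastforce simp: mons_def keys_add_nat split: if_splits)
qed

lemma A_subset: "A \<subseteq> mons {..n} d"
  using T_subset pures_subset_mons by (simp add: A_def)

lemma finite_A: "finite A"
  using finite_subset[OF A_subset] finite_mons by blast

lemma finite_B: "finite B"
  using finite_subset[OF B(1)] n by (simp add: finite_mons lessThan_empty_iff)

text \<open>After division by \<open>\<mu>\<close> the three pieces have exponent 0, 1 and e in x_n.
  For e = 1 the last two could meet only in x_n itself, which \<open>0 \<notin> B\<close>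
  prevents.\<close>

lemma T_disjoint:
  "(\<lambda>m. \<mu> + m) ` (mons {..<n} e - C) \<inter>
    ((\<lambda>m. \<mu> + (Poly_Mapping.single n 1 + m)) ` B \<union> {\<mu> + Poly_Mapping.single n e}) = {}"
  "(\<lambda>m. \<mu> + (Poly_Mapping.single n 1 + m)) ` B \<inter> {\<mu> + Poly_Mapping.single n e} = {}"
proof -
  have "m \<noteq> Poly_Mapping.single n 1 + m'" if "m \<in> mons {..<n} e" for m m'
    using lookup_n[OF that] by (auto simp: lookup_add)
  moreover have "Poly_Mapping.single n e \<notin> mons {..<n} e"
    using lookup_n[of "Poly_Mapping.single n e" e] e by auto
  ultimately show "(\<lambda>m. \<mu> + m) ` (mons {..<n} e - C) \<inter>
      ((\<lambda>m. \<mu> + (Poly_Mapping.single n 1 + m)) ` B \<union> {\<mu> + Poly_Mapping.single n e}) = {}"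
    by auto
  have neq: "Poly_Mapping.single n 1 + m \<noteq> Poly_Mapping.single n e" if "m \<in> B" for m
  proof
    assume eq: "Poly_Mapping.single n 1 + m = Poly_Mapping.single n e"
    have m: "m \<in> mons {..<n} (e - 1)"
      using that B(1) by blast
    have "Poly_Mapping.lookup (Poly_Mapping.single n 1 + m) n = e"
      unfolding eq by simp
    then have "e = 1"
      using lookup_n[OF m] by (simp add: lookup_add)
    then have "mon_degree m = 0"
      using m by (simp add: mons_def)
    then have "m = 0"
      by (auto simp: mon_degree_def in_keys_iff intro!: poly_mapping_eqI)
    then show False
      using that B(2) by simp
  qed
  show "(\<lambda>m. \<mu> + (Poly_Mapping.single n 1 + m)) ` B \<inter> {\<mu> + Poly_Mapping.single n e} = {}"
  proof (rule equals0I)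
    fix x assume "x \<in> (\<lambda>m. \<mu> + (Poly_Mapping.single n 1 + m)) ` B \<inter> {\<mu> + Poly_Mapping.single n e}"
    then obtain m where "m \<in> B" "\<mu> + (Poly_Mapping.single n 1 + m) = \<mu> + Poly_Mapping.single n e"
      by blast
    then show False
      using neq[of m] unfolding add_left_cancel by blast
  qed
qed

lemma finite_mons_n: "finite (mons {..<n} k)"
  using n by (simp add: finite_mons lessThan_empty_iff)

lemma card_T: "card T + card C = card (mons {..<n} e) + card B + 1"
proof -
  have fin: "finite ((\<lambda>m. \<mu> + m) ` (mons {..<n} e - C))"
    "finite ((\<lambda>m. \<mu> + (Poly_Mapping.single n 1 + m)) ` B)"
    using finite_B finite_mons_n by simp_all
  have "card T = card (mons {..<n} e - C) + (card B + 1)"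
    unfolding T_def using fin T_disjoint
    by (simp add: card_Un_disjoint card_image inj_on_def)
  moreover have "card (mons {..<n} e - C) + card C = card (mons {..<n} e)"
    using C finite_mons_n card_Diff_subset[OF finite_subset[OF C]] card_mono[OF _ C] by simp
  ultimately show ?thesis
    by simp
qed

lemma var_sum_atMost: "var_sum {..n} = L' + var n"
  by (simp add: var_sum_def lessThan_Suc flip: lessThan_Suc_atMost)

lemma kernel_exists:
  "\<exists>G\<in>forms n (d - 1). G \<noteq> (0 :: 'k mpoly) \<and> Poly_Mapping.keys (var_sum {..n} * G) \<subseteq> A"
proof -
  let ?w = "var n :: 'k mpoly"
  \<comment> \<open>The quotient of L'^e - (-x_n)^e by L' + x_n, as a geometric sum; so K is the sum
    of all variables times S - E.\<close>
  define S where "S = (\<Sum>i<e. (- ?w) ^ (e - Suc i) * L' ^ i)"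
  define K where "K = (L' ^ e - L' * E) - (?w * E + (- ?w) ^ e)"
  define G where "G = mono \<mu> * (S - E)"
  have "L' ^ e - (- ?w) ^ e = (L' - (- ?w)) * S"
    unfolding S_def by (rule power_diff_sumr2)
  then have K_eq: "K = var_sum {..n} * (S - E)"
    by (simp add: K_def var_sum_atMost algebra_simps)
  then have LG: "var_sum {..n} * G = mono \<mu> * K"
    by (simp add: G_def mult_ac)
  have w: "(- ?w) ^ e = Poly_Mapping.single (Poly_Mapping.single n e) ((- 1) ^ e)"
  proof -
    have "(- ?w) ^ e = (- 1) ^ e * ?w ^ e"
      by (rule power_minus)
    also have "(- 1 :: 'k mpoly) ^ e = Poly_Mapping.single 0 ((- 1) ^ e)"
      by (induction e) (simp_all add: single_uminus)
    finally show ?thesis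
      by (simp add: var_power mult_single)
  qed
  have keysL: "Poly_Mapping.keys L' \<subseteq> mons {..<n} 1"
    by (rule keys_var_sum)
  have keys1: "Poly_Mapping.keys (L' ^ e - L' * E) \<subseteq> mons {..<n} e - C"
  proof -
    have "Poly_Mapping.keys (L' ^ e - L' * E) \<subseteq> mons {..<n} e"
      using mons_power[OF keysL, of e] mons_mult[OF keysL, of E "e - 1"] B(1) E e
      by (intro mons_diff) simp_all
    then show ?thesis
      using cancel by (auto simp: in_keys_iff)
  qed
  have keys2: "Poly_Mapping.keys (?w * E + (- ?w) ^ e) \<subseteq>
      (\<lambda>m. Poly_Mapping.single n 1 + m) ` B \<union> {Poly_Mapping.single n e}"
    using keys_add[of "?w * E" "(- ?w) ^ e"] keys_mult[of ?w E] E
    by (force simp: w keys_var)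
  have keysK: "Poly_Mapping.keys K \<subseteq> (mons {..<n} e - C) \<union>
      ((\<lambda>m. Poly_Mapping.single n 1 + m) ` B \<union> {Poly_Mapping.single n e})"
    unfolding K_def by (rule mons_diff) (use keys1 keys2 in blast)+
  have "Poly_Mapping.keys (mono \<mu> * K) \<subseteq> T"
  proof
    fix m assume "m \<in> Poly_Mapping.keys (mono \<mu> * K)"
    then obtain v where "v \<in> Poly_Mapping.keys K" "m = \<mu> + v"
      using keys_mult[of "mono \<mu>" K] by auto
    then show "m \<in> T"
      using keysK unfolding T_def by blast
  qed
  then have "Poly_Mapping.keys (var_sum {..n} * G) \<subseteq> A"
    by (simp add: LG A_def le_supI2)
  moreover have "G \<noteq> 0"
  proof
    assume "G = 0"
    then have "S - E = 0"
      by (simp add: G_def) (metis keys_eq_empty keys_single insert_not_empty zero_neq_one)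
    then have "K = 0"
      by (simp add: K_eq)
    \<comment> \<open>The monomial x_n^e witnesses K \<noteq> 0: neither L'^e - L' E nor x_n E
      contains it.\<close>
    have "Poly_Mapping.single n e \<notin> mons {..<n} e"
      using lookup_n[of "Poly_Mapping.single n e" e] e by auto
    then have "Poly_Mapping.single n e \<notin> Poly_Mapping.keys (L' ^ e - L' * E)"
      using keys1 by blast
    moreover have "Poly_Mapping.single n e \<notin> Poly_Mapping.keys (?w * E)"
    proof
      assume "Poly_Mapping.single n e \<in> Poly_Mapping.keys (?w * E)"
      then obtain v where "v \<in> B" "Poly_Mapping.single n e = Poly_Mapping.single n 1 + v"
        using keys_mult[of ?w E] E by (auto simp: keys_var)
      then show False
        using T_disjoint(2) by force
    qed
    ultimately have "Poly_Mapping.lookup K (Poly_Mapping.single n e) = - ((- 1) ^ e)"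
      by (simp add: K_def w lookup_minus lookup_add in_keys_iff)
    then show False
      using \<open>K = 0\<close> by simp
  qed
  moreover have "G \<in> forms n (d - 1)"
  proof -
    have sub: "mons {..<n} k \<subseteq> mons {..n} k" for k
      by (auto simp: mons_def)
    have kw: "Poly_Mapping.keys (- ?w) \<subseteq> mons {..n} 1"
      by (auto simp: keys_var mons_def)
    have "Poly_Mapping.keys ((- ?w) ^ (e - Suc i) * L' ^ i) \<subseteq> mons {..n} (e - 1)" if "i < e" for i
      using mons_mult[OF mons_power[OF kw, of "e - Suc i"] order_trans[OF mons_power[OF keysL, of i] sub]]
        that by simp
    then have "Poly_Mapping.keys S \<subseteq> mons {..n} (e - 1)"
      unfolding S_def using keys_sum[of "\<lambda>i. (- ?w) ^ (e - Suc i) * L' ^ i" "{..<e}"] by fastforce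
    then have "Poly_Mapping.keys (S - E) \<subseteq> mons {..n} (e - 1)"
      using E B(1) sub by (intro mons_diff) blast+
    then have "Poly_Mapping.keys G \<subseteq> mons {..n} (a + b + (e - 1))"
      unfolding G_def using \<mu> by (intro mons_mult) auto
    then show ?thesis
      using deg e by (simp add: forms_eq)
  qed
  ultimately show ?thesis
    by blast
qed

lemma pures_subset_T: "a = 0 \<Longrightarrow> b = 0 \<Longrightarrow> pures {..<n} d \<inter> C = {} \<Longrightarrow> pures {..n} d \<subseteq> T"
proof
  fix m assume ab: "a = 0" "b = 0" "pures {..<n} d \<inter> C = {}" and "m \<in> pures {..n} d"
  then consider "m \<in> pures {..<n} d" | "m = Poly_Mapping.single n d"
    by (fastforce simp: pures_def le_less)
  then show "m \<in> T"
  proof cases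
    case 1
    then have "m \<in> mons {..<n} e - C"
      using ab deg pures_subset_mons[of "{..<n}" d] by auto
    then show ?thesis
      unfolding T_def \<mu>_def using ab by simp
  next
    case 2
    then show ?thesis
      unfolding T_def \<mu>_def using ab deg by simp
  qed
qed

lemma pure_n_in_T: "b = 0 \<Longrightarrow> Poly_Mapping.single n d \<in> T"
  unfolding T_def \<mu>_def using deg by (simp flip: single_add)

text \<open>Putting x_n = -L' kills the product and leaves a relation in x_0, ..., x_(n-1). Pure
  powers outside \<open>T\<close> drop out of it, and \<open>unique\<close> then shows that the rest
  is a scalar multiple of \<mu> K, with K as in \<open>kernel_exists\<close>. The scalar is nonzero,
  so every element of \<open>T\<close> occurs.\<close>

lemma kernel_support:
  assumes G: "G \<noteq> (0 :: 'k mpoly)" and keys: "Poly_Mapping.keys (var_sum {..n} * G) \<subseteq> A"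
  shows "T \<subseteq> Poly_Mapping.keys (var_sum {..n} * G)"
proof -
  define H where "H = var_sum {..n} * G"
  let ?h = "Poly_Mapping.lookup H" and ?x = "Poly_Mapping.single :: _ \<Rightarrow> 'k \<Rightarrow> 'k mpoly"
  let ?X = "Poly_Mapping.single n :: nat \<Rightarrow> nat \<Rightarrow>\<^sub>0 nat"
  \<comment> \<open>Pure powers that belong to \<open>T\<close> are already counted in
    \<open>AP\<close>, \<open>BP\<close> or \<open>c\<close>, so they get coefficient 0
    here.\<close>
  define \<alpha> where "\<alpha> i = (if Poly_Mapping.single i d \<in> T then 0 else ?h (Poly_Mapping.single i d))" for i
  define AP where "AP = (\<Sum>m\<in>mons {..<n} e - C. ?x m (?h (\<mu> + m)))"
  define BP where "BP = (\<Sum>m\<in>B. ?x m (?h (\<mu> + (?X 1 + m))))"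
  define c where "c = ?h (\<mu> + ?X e)"
  define Z where "Z = AP - L' * BP + ?x 0 c * (- L') ^ e"
  have finT: "finite T"
    using finite_A by (simp add: A_def)
  have keysAP: "Poly_Mapping.keys AP \<subseteq> mons {..<n} e - C"
    unfolding AP_def using keys_sum[of "\<lambda>m. ?x m (?h (\<mu> + m))"] by (fastforce split: if_splits)
  have keysBP: "Poly_Mapping.keys BP \<subseteq> B"
    unfolding BP_def using keys_sum[of "\<lambda>m. ?x m (?h (\<mu> + (?X 1 + m)))"] by (fastforce split: if_splits)
  have lookupAP: "Poly_Mapping.lookup AP m = ?h (\<mu> + m)" if "m \<in> mons {..<n} e - C" for m
    unfolding AP_def using that finite_mons_n by (simp add: lookup_sum lookup_single when_def sum.delta)
  have lookupBP: "Poly_Mapping.lookup BP m = ?h (\<mu> + (?X 1 + m))" if "m \<in> B" for m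
    unfolding BP_def using that finite_B
    by (simp add: lookup_sum lookup_single when_def sum.delta del: One_nat_def)
  have T_sum: "(\<Sum>m\<in>T. ?x m (?h m)) = mono \<mu> * (AP + (var n * BP + ?x (?X e) c))"
  proof -
    have fin: "finite ((\<lambda>m. \<mu> + m) ` (mons {..<n} e - C))" "finite ((\<lambda>m. \<mu> + (?X 1 + m)) ` B)"
      using finite_B finite_mons_n by simp_all
    have "(\<Sum>m\<in>T. ?x m (?h m)) = (\<Sum>m\<in>(\<lambda>m. \<mu> + m) ` (mons {..<n} e - C). ?x m (?h m)) +
        ((\<Sum>m\<in>(\<lambda>m. \<mu> + (?X 1 + m)) ` B. ?x m (?h m)) + (\<Sum>m\<in>{\<mu> + ?X e}. ?x m (?h m)))"
      unfolding T_def using fin T_disjoint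
      by (subst sum.union_disjoint, simp, simp, blast, subst sum.union_disjoint) simp_all
    also have "(\<Sum>m\<in>(\<lambda>m. \<mu> + m) ` (mons {..<n} e - C). ?x m (?h m)) =
        (\<Sum>m\<in>mons {..<n} e - C. mono \<mu> * ?x m (?h (\<mu> + m)))"
      by (subst sum.reindex) (simp_all add: inj_on_def mult_single)
    also have "(\<Sum>m\<in>(\<lambda>m. \<mu> + (?X 1 + m)) ` B. ?x m (?h m)) =
        (\<Sum>m\<in>B. mono \<mu> * (var n * ?x m (?h (\<mu> + (?X 1 + m)))))"
      by (subst sum.reindex) (simp_all add: inj_on_def mult_single var_def)
    also have "(\<Sum>m\<in>{\<mu> + ?X e}. ?x m (?h m)) = mono \<mu> * ?x (?X e) c"
      by (simp add: mult_single c_def)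
    finally show ?thesis
      by (simp only: AP_def BP_def sum_distrib_left distrib_left)
  qed
  have "H = (\<Sum>m\<in>T \<union> (pures {..n} d - T). ?x m (?h m))"
    using keys finT by (intro poly_mapping_sum_single) (auto simp: H_def A_def pures_def)
  also have "\<dots> = (\<Sum>m\<in>T. ?x m (?h m)) + (\<Sum>m\<in>pures {..n} d - T. ?x m (?h m))"
    using finT by (intro sum.union_disjoint) (auto simp: pures_def)
  also have "(\<Sum>m\<in>pures {..n} d - T. ?x m (?h m)) =
      (\<Sum>m\<in>pures {..n} d. ?x m (if m \<in> T then 0 else ?h m))"
    by (rule sum.mono_neutral_cong_left) (auto simp: pures_def)
  also have "\<dots> = (\<Sum>i\<le>n. ?x (Poly_Mapping.single i d) (\<alpha> i))"
  proof -
    have "inj_on (\<lambda>i. Poly_Mapping.single i d) {..n}"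
      using d by (auto intro!: inj_onI dest!: arg_cong[where f = Poly_Mapping.keys])
    then show ?thesis
      unfolding pures_def by (simp add: sum.reindex \<alpha>_def)
  qed
  finally have H_eq: "H = mono \<mu> * (AP + (var n * BP + ?x (?X e) c)) +
      (\<Sum>i\<le>n. ?x (Poly_Mapping.single i d) (\<alpha> i))"
    by (simp only: T_sum)
  \<comment> \<open>The substitution x_n = -L', under which \<open>Z\<close> is what the bracket in
    \<open>H_eq\<close> becomes.\<close>
  define \<sigma> where "\<sigma> i = (if i = n then - L' else var i)" for i
  have \<sigma>n: "\<sigma> n = - L'"
    by (simp add: \<sigma>_def)
  have \<sigma>: "\<sigma> i = var i" if "i < n" for i
    using that by (simp add: \<sigma>_def)
  have fixed: "subst (?x 0) \<sigma> p = p" if "Poly_Mapping.keys p \<subseteq> mons {..<n} k" for p k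
    using that by (intro subst_fixed[of p "{..<n}"]) (auto simp: mons_def \<sigma>)
  have pos: "0 < n"
    using n by simp
  have L'_neq: "L' \<noteq> (0 :: 'k mpoly)"
    using pos by (intro var_sum_neq_0[of _ 0]) simp_all
  have split: "(\<Sum>i\<le>n. f i) = (\<Sum>i<n. f i) + f n" for f :: "nat \<Rightarrow> 'k mpoly"
    by (simp add: lessThan_Suc_atMost[symmetric])
  have "subst (?x 0) \<sigma> (var_sum {..n}) = 0"
  proof -
    have "sum \<sigma> {..<n} = L'"
      unfolding var_sum_def by (rule sum.cong) (simp_all add: \<sigma>)
    then show ?thesis
      by (simp add: split \<sigma>n)
  qed
  then have "0 = subst (?x 0) \<sigma> H"
    by (simp add: H_def)
  also have "\<dots> = subst (?x 0) \<sigma> (mono \<mu>) * (AP + (- L' * BP + ?x 0 c * (- L') ^ e)) +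
      (\<Sum>i\<le>n. ?x 0 (\<alpha> i) * \<sigma> i ^ d)"
    unfolding H_eq using keysAP keysBP B(1) fixed[of AP e] fixed[of BP "e - 1"]
    by (simp add: \<sigma>n subset_iff)
  also have "subst (?x 0) \<sigma> (mono \<mu>) = (- L') ^ a * var 0 ^ b"
    using pos by (simp add: \<mu>_def mon_val_add \<sigma>n \<sigma>)
  also have "(\<Sum>i\<le>n. ?x 0 (\<alpha> i) * \<sigma> i ^ d) =
      (\<Sum>i<n. ?x (Poly_Mapping.single i d) (\<alpha> i)) + ?x 0 (\<alpha> n) * (- L') ^ d"
  proof -
    have "?x 0 (\<alpha> i) * \<sigma> i ^ d = ?x (Poly_Mapping.single i d) (\<alpha> i)" if "i \<in> {..<n}" for i
      using that by (simp add: \<sigma> var_power mult_single)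
    then show ?thesis
      unfolding split \<sigma>n by simp
  qed
  finally have rel: "(- L') ^ a * var 0 ^ b * Z +
      ((\<Sum>i<n. ?x (Poly_Mapping.single i d) (\<alpha> i)) + ?x 0 (\<alpha> n) * (- L') ^ d) = 0"
    by (simp add: Z_def diff_add_eq algebra_simps)
  \<comment> \<open>The alternatives of \<open>pure\<close>: either every pure power lies in
    \<open>T\<close> and no \<alpha> remains, or the power L'^a divides the sum of pure powers in
    x_0, ..., x_(n-1) and forces their coefficients to vanish.\<close>
  have \<alpha>_Z: "(\<forall>i\<le>n. \<alpha> i = 0) \<and> Z = 0"
  proof (cases "a = 0 \<and> b = 0 \<and> pures {..<n} d \<inter> C = {}")
    case True
    then have "\<alpha> i = 0" if "i \<le> n" for i
      using pures_subset_T that by (auto simp: \<alpha>_def pures_def)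
    then show ?thesis
      using rel True by simp
  next
    case False
    define W where "W = var 0 ^ b * Z + ?x 0 (\<alpha> n) * (- L') ^ (d - a)"
    have "(- L') ^ d = (- L') ^ a * (- L') ^ (d - a)"
      using deg by (simp flip: power_add)
    then have sum: "(\<Sum>i<n. ?x (Poly_Mapping.single i d) (\<alpha> i)) = - ((- L') ^ a * W)"
      using rel by (simp add: W_def algebra_simps eq_neg_iff_add_eq_0)
    also have "\<dots> = L' ^ a * (- ((- 1) ^ a * W))"
      by (subst power_minus) simp
    finally have eq: "(\<Sum>i<n. ?x (Poly_Mapping.single i d) (\<alpha> i)) = L' ^ a * (- ((- 1) ^ a * W))" .
    have \<alpha>: "\<alpha> i = 0" if "i < n" for i
      by (rule pure_sum_divisible_by_power[OF finite_lessThan d _ _ eq]) (use that n pure False in auto)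
    then have "(- L') ^ a * W = 0"
      using sum by simp
    then have W: "W = 0"
      using L'_neq by simp
    have \<alpha>n: "\<alpha> n = 0"
    proof (cases "b = 0")
      case True
      then show ?thesis
        using pure_n_in_T by (simp add: \<alpha>_def)
    next
      case False
      \<comment> \<open>At the point with x_1 = -1 and all other coordinates 0, the factor x_0^b
        vanishes and -L' is 1, so W takes the value \<open>\<alpha> n\<close>.\<close>
      define \<tau> where "\<tau> i = (if i = 1 then - 1 else (0 :: 'k))" for i :: nat
      have "sum \<tau> {..<n} = - 1"
        using n by (simp add: \<tau>_def sum.delta)
      moreover have "subst id \<tau> W = 0"
        by (simp add: W)
      ultimately show ?thesis
        using False by (simp add: W_def \<tau>_def zero_power)
    qed
    then have "var 0 ^ b * Z = 0"
      using W by (simp add: W_def)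
    moreover have "var 0 ^ b \<noteq> (0 :: 'k mpoly)"
      by (metis keys_eq_empty keys_single insert_not_empty var_power zero_neq_one)
    ultimately show ?thesis
      using \<alpha> \<alpha>n le_less by auto
  qed
  \<comment> \<open>The sign is chosen so that c (-L')^e = -t L'^e; t will be the scalar by which
    \<open>H\<close> is a multiple of \<mu> K.\<close>
  define t where "t = - ((- 1) ^ e * c)"
  have c: "c = - ((- 1) ^ e * t)"
    by (cases "even e") (simp_all add: t_def)
  \<comment> \<open>The deviation of \<open>BP\<close> from the expected -tE. Since Z = 0, L' F is
    AP - t (L'^e - L' E), which has no monomials in \<open>C\<close>, so \<open>unique\<close>
    applies.\<close>
  define F where "F = BP + ?x 0 t * E"
  have neg_pow: "?x 0 c * (- L') ^ e = - (?x 0 t * L' ^ e)"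
    by (cases "even e") (simp_all add: t_def single_uminus)
  have LF: "L' * F = AP - ?x 0 t * (L' ^ e - L' * E)"
    using \<alpha>_Z by (simp add: F_def Z_def neg_pow algebra_simps)
  have "F = 0"
  proof (rule unique)
    have "Poly_Mapping.keys (?x 0 t * E) \<subseteq> B"
      using E by (auto simp: in_keys_iff lookup_const_times)
    then show "Poly_Mapping.keys F \<subseteq> B"
      unfolding F_def using keys_add[of BP "?x 0 t * E"] keysBP by blast
    fix m assume m: "m \<in> C"
    then have "Poly_Mapping.lookup AP m = 0"
      using keysAP by (auto simp: in_keys_iff)
    moreover have "Poly_Mapping.lookup (L' ^ e - L' * E) m = 0"
      using m C cancel by blast
    ultimately show "Poly_Mapping.lookup (L' * F) m = 0"
      by (simp only: LF lookup_minus lookup_const_times mult_zero_right diff_zero)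
  qed
  then have AP: "AP = ?x 0 t * (L' ^ e - L' * E)" and BP: "BP = - (?x 0 t * E)"
    using LF by (simp_all add: F_def eq_neg_iff_add_eq_0)
  have t: "t \<noteq> 0"
  proof
    assume "t = 0"
    then have "H = 0"
      using H_eq \<alpha>_Z AP BP c by simp
    then show False
      using G var_sum_neq_0[of "{..n}" 0, where 'k = 'k] by (simp add: H_def)
  qed
  have "?h m \<noteq> 0" if "m \<in> T" for m
    using that unfolding T_def
  proof (elim UnE imageE)
    fix m' assume m': "m = \<mu> + m'" "m' \<in> mons {..<n} e - C"
    then have "?h m = t * Poly_Mapping.lookup (L' ^ e - L' * E) m'"
      using lookupAP[of m'] AP by (simp only: lookup_const_times)
    then show ?thesis
      using t cancel[of m'] m' by simp
  next
    fix m' assume m': "m = \<mu> + (?X 1 + m')" "m' \<in> B"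
    then have "?h m = - (t * Poly_Mapping.lookup E m')"
      using lookupBP[of m'] BP by (simp only: lookup_const_times lookup_uminus)
    then show ?thesis
      using t m' unfolding E[symmetric] by (simp add: in_keys_iff)
  next
    assume "m \<in> {\<mu> + ?X e}"
    then show ?thesis
      using c t by (auto simp: c_def)
  qed
  then show ?thesis
    by (auto simp: H_def in_keys_iff)
qed

text \<open>A subset still giving a Togliatti system contains the pure powers and the support of
  some nonzero product; by \<open>kernel_support\<close> it contains \<open>T\<close>, hence all of
  \<open>A\<close>.\<close>

theorem minimal_togliatti:
  assumes card: "card A \<le> (n + d - 1) choose (n - 1)"
  defines "I \<equiv> Idl\<^bsub>poly_ring n\<^esub> ((mono :: _ \<Rightarrow> 'k mpoly) ` A)"
  shows "I \<in> min_monomial_togliatti_systems n d" "num_generators n I = card A"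
proof -
  show "num_generators n I = card A"
    unfolding I_def by (rule num_generators_Idl_mono[OF A_subset])
  have nd: "0 < d" "0 < n"
    using d n by simp_all
  have "togliatti_system n d I"
    unfolding I_def togliatti_system_monomial_iff[OF A_subset nd]
    using card kernel_exists by (auto simp: A_def pures_def)
  moreover have "\<not> togliatti_system n d (Idl\<^bsub>poly_ring n\<^esub> M')"
    if M': "M' \<subset> (mono :: _ \<Rightarrow> 'k mpoly) ` A" for M'
  proof
    obtain A' where A': "A' \<subseteq> A" "M' = mono ` A'"
      using M' by (meson psubset_imp_subset subset_imageE)
    assume "togliatti_system n d (Idl\<^bsub>poly_ring n\<^esub> M')"
    then have tog: "(\<forall>i\<le>n. Poly_Mapping.single i d \<in> A') \<and>
        (\<exists>G\<in>forms n (d - 1). G \<noteq> (0 :: 'k mpoly) \<and> Poly_Mapping.keys (var_sum {..n} * G) \<subseteq> A')"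
      unfolding A'(2) togliatti_system_monomial_iff[OF order_trans[OF A'(1) A_subset] nd] by blast
    then obtain G where "G \<noteq> (0 :: 'k mpoly)" "Poly_Mapping.keys (var_sum {..n} * G) \<subseteq> A'"
      by blast
    then have "T \<subseteq> A'"
      using kernel_support[of G] A'(1) by blast
    then have "A \<subseteq> A'"
      using tog by (auto simp: A_def pures_def)
    then show False
      using A' M' by blast
  qed
  ultimately show "I \<in> min_monomial_togliatti_systems n d"
    unfolding min_monomial_togliatti_systems_def minimal_monomial_togliatti_def
    using A_subset by (auto simp: I_def monomials_eq intro!: exI[of _ "mono ` A"])
qed

end

section \<open>Multinomial coefficients and the family with E = 0\<close>

lemma mons_keysD: "m \<in> mons V d \<Longrightarrow> Poly_Mapping.keys m \<subseteq> V"
  by (simp add: mons_def)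

lemma minus_single_mons:
  assumes "m \<in> mons V d" "i \<in> Poly_Mapping.keys m"
  shows "m - Poly_Mapping.single i 1 \<in> mons V (d - 1)"
proof -
  have "Poly_Mapping.keys (m - Poly_Mapping.single i 1) \<subseteq> Poly_Mapping.keys m"
    by (auto simp: in_keys_iff lookup_minus)
  then show ?thesis
    using assms by (auto simp: mons_def mon_degree_minus_single simp del: One_nat_def)
qed

text \<open>The multinomial theorem with denominators cleared. In the induction the term of x_i
  contributes (exponent of x_i) * e!, and the exponents add up to e + 1.\<close>

lemma lookup_var_sum_power:
  assumes V: "finite V" and m: "m \<in> mons V e"
  shows "Poly_Mapping.lookup (var_sum V ^ e) m * (\<Prod>i\<in>V. fact (Poly_Mapping.lookup m i)) =
    (fact e :: 'k::field_char_0)"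
  using m
proof (induction e arbitrary: m)
  case 0
  then have "Poly_Mapping.lookup m i = 0" for i
    using lookup_le_mon_degree[of m i] by (simp add: mons_def)
  moreover from this have "m = 0"
    by (intro poly_mapping_eqI) simp
  ultimately show ?case
    by simp
next
  case (Suc e)
  let ?P = "\<lambda>m. \<Prod>i\<in>V. fact (Poly_Mapping.lookup m i) :: 'k"
  have summand: "Poly_Mapping.lookup (var_sum V ^ e) (m - Poly_Mapping.single i 1) * ?P m =
      of_nat (Poly_Mapping.lookup m i) * fact e" if i: "i \<in> V \<inter> Poly_Mapping.keys m" for i
  proof -
    let ?m = "m - Poly_Mapping.single i 1"
    have "?P m = fact (Poly_Mapping.lookup m i) * (\<Prod>j\<in>V - {i}. fact (Poly_Mapping.lookup m j))"
      using V i by (intro prod.remove) auto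
    also have "(\<Prod>j\<in>V - {i}. fact (Poly_Mapping.lookup m j)) = (\<Prod>j\<in>V - {i}. fact (Poly_Mapping.lookup ?m j))"
      by (intro prod.cong) (auto simp: lookup_minus lookup_single)
    also have "fact (Poly_Mapping.lookup m i) =
        of_nat (Poly_Mapping.lookup m i) * (fact (Poly_Mapping.lookup ?m i) :: 'k)"
      using i by (cases "Poly_Mapping.lookup m i") (auto simp: lookup_minus in_keys_iff)
    also have "of_nat (Poly_Mapping.lookup m i) * fact (Poly_Mapping.lookup ?m i) *
        (\<Prod>j\<in>V - {i}. fact (Poly_Mapping.lookup ?m j)) = of_nat (Poly_Mapping.lookup m i) * ?P ?m"
      unfolding mult.assoc using V i by (subst prod.remove[of V i]) auto
    finally have "?P m = of_nat (Poly_Mapping.lookup m i) * ?P ?m" .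
    moreover have "Poly_Mapping.lookup (var_sum V ^ e) ?m * ?P ?m = fact e"
      using Suc.IH minus_single_mons[OF Suc.prems, of i] i by simp
    ultimately show ?thesis
      by (simp add: mult.left_commute)
  qed
  have "Poly_Mapping.lookup (var_sum V ^ Suc e) m * ?P m =
      (\<Sum>i\<in>V \<inter> Poly_Mapping.keys m. of_nat (Poly_Mapping.lookup m i) * fact e)"
    using summand by (simp add: lookup_var_sum_times[OF V] sum_distrib_right del: One_nat_def)
  also have "\<dots> = of_nat (\<Sum>i\<in>V \<inter> Poly_Mapping.keys m. Poly_Mapping.lookup m i) * fact e"
    by (simp add: sum_distrib_right)
  also have "(\<Sum>i\<in>V \<inter> Poly_Mapping.keys m. Poly_Mapping.lookup m i) = (\<Sum>i\<in>V. Poly_Mapping.lookup m i)"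
    using V by (intro sum.mono_neutral_left) (auto simp: in_keys_iff)
  also have "\<dots> = Suc e"
    using Suc.prems mon_degree_eq_sum[OF V, of m] by (simp add: mons_def)
  finally show ?case
    by simp
qed

lemma lookup_var_sum_power_neq_0:
  "finite V \<Longrightarrow> m \<in> mons V e \<Longrightarrow> Poly_Mapping.lookup (var_sum V ^ e) m \<noteq> (0 :: 'k::field_char_0)"
  using lookup_var_sum_power[of V m e, where 'k = 'k] by auto

text \<open>In characteristic zero no multinomial coefficient vanishes, so without E nothing is
  cancelled.\<close>

lemma monomial_family_zero:
  assumes "2 \<le> n" "2 \<le> d" "1 \<le> e" "a + b + e = d" "b \<le> 1" "1 \<le> a \<and> 3 \<le> n \<or> 2 \<le> a"
  shows "monomial_family n d a b e {} {} (0 :: 'k::field_char_0 mpoly)"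
proof
  show "Poly_Mapping.lookup (var_sum {..<n} ^ e - var_sum {..<n} * 0) m = (0 :: 'k) \<longleftrightarrow> m \<in> {}"
    if "m \<in> mons {..<n} e" for m
    using lookup_var_sum_power_neq_0[OF finite_lessThan that, where 'k = 'k] by simp
  show "F = 0" if "Poly_Mapping.keys F \<subseteq> {}" for F :: "'k mpoly"
    using that by (simp add: keys_eq_empty)
qed (use assms in auto)

section \<open>Cancelling monomials in three variables\<close>

definition yz :: "(nat \<Rightarrow>\<^sub>0 nat) \<Rightarrow> nat" where
  "yz m = Poly_Mapping.lookup m 1 + Poly_Mapping.lookup m 2"

text \<open>\<open>canceller e c\<close> is $\sum_j c_j x_0^{e-j} (x_1 + x_2)^{j-1}$.\<close>

definition canceller :: "nat \<Rightarrow> (nat \<Rightarrow> int) \<Rightarrow> 'k::field_char_0 mpoly" where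
  "canceller e c = (\<Sum>m\<in>mons {0, 1, 2} (e - 1). Poly_Mapping.single m
     (of_int (c (Suc (yz m))) * fact (yz m) /
       (fact (Poly_Mapping.lookup m 1) * fact (Poly_Mapping.lookup m 2))))"

definition cancelled :: "nat \<Rightarrow> nat set \<Rightarrow> (nat \<Rightarrow>\<^sub>0 nat) set" where
  "cancelled e J = {m \<in> mons {0, 1, 2} e. yz m \<in> J}"

text \<open>The shift by \<open>Suc\<close> is due to the indexing of \<open>canceller\<close>: its
  j-th summand has degree j - 1 in x_1, x_2.\<close>

definition cancelling :: "nat \<Rightarrow> nat set \<Rightarrow> (nat \<Rightarrow>\<^sub>0 nat) set" where
  "cancelling e J = {m \<in> mons {0, 1, 2} (e - 1). Suc (yz m) \<in> J}"

lemma finite_mons3: "finite (mons {0, 1, 2} k)"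
  by (simp add: finite_mons)

lemma lookup_canceller:
  "Poly_Mapping.lookup (canceller e c) m =
    (if m \<in> mons {0, 1, 2} (e - 1) then of_int (c (Suc (yz m))) * fact (yz m) /
       (fact (Poly_Mapping.lookup m 1) * fact (Poly_Mapping.lookup m 2)) else 0)"
  unfolding canceller_def using finite_mons3
  by (simp add: lookup_sum lookup_single when_def sum.delta)

lemma mons3_sum: "m \<in> mons {0, 1, 2} k \<Longrightarrow> Poly_Mapping.lookup m 0 + yz m = k"
  using mon_degree_eq_sum[of "{0, 1, 2}" m] by (simp add: mons_def yz_def)

lemma keys_canceller:
  assumes "\<And>j. c j \<noteq> 0 \<longleftrightarrow> j \<in> J"
  shows "Poly_Mapping.keys (canceller e c :: 'k::field_char_0 mpoly) = cancelling e J"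
  by (simp add: set_eq_iff in_keys_iff lookup_canceller cancelling_def assms)

lemma lookup_minus_other:
  "j \<noteq> i \<Longrightarrow> Poly_Mapping.lookup (m - Poly_Mapping.single i (1::nat)) j = Poly_Mapping.lookup m j"
  by (simp add: lookup_minus lookup_single)

lemma lookup_minus_self:
  "Poly_Mapping.lookup (m - Poly_Mapping.single i (1::nat)) i = Poly_Mapping.lookup m i - 1"
  by (simp add: lookup_minus)

text \<open>The product x_0^(e-j) (x_1 + x_2)^j arises twice: from x_0 times summand j + 1 and from
  x_1 + x_2 times summand j. The boundary values of \<open>c\<close> cover the layers where one of
  the two is missing.\<close>

lemma lookup_var_sum_times_canceller:
  assumes n: "3 \<le> n" and m: "m \<in> mons {0, 1, 2} e" and c: "c 0 = 0" "c (Suc e) = 0"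
  shows "Poly_Mapping.lookup (var_sum {..<n} * canceller e c) m *
      (fact (Poly_Mapping.lookup m 1) * fact (Poly_Mapping.lookup m 2)) =
    fact (yz m) * (of_int (c (yz m) + c (Suc (yz m))) :: 'k::field_char_0)"
proof -
  let ?f = "\<lambda>m. fact (Poly_Mapping.lookup m 1) * fact (Poly_Mapping.lookup m 2) :: 'k"
  let ?E = "Poly_Mapping.lookup (canceller e c :: 'k mpoly)"
  let ?t = "\<lambda>i. if i \<in> Poly_Mapping.keys m then ?E (m - Poly_Mapping.single i 1) else 0"
  have "Poly_Mapping.lookup (var_sum {..<n} * canceller e c :: 'k mpoly) m = (\<Sum>i<n. ?t i)"
    by (simp add: lookup_var_sum_times sum.inter_restrict del: One_nat_def)
  also have "\<dots> = (\<Sum>i\<in>{0, 1, 2}. ?t i)"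
    using n mons_keysD[OF m] by (intro sum.mono_neutral_right) auto
  also have "\<dots> = ?t 0 + ?t 1 + ?t 2"
    by (simp del: One_nat_def)
  finally have sum: "Poly_Mapping.lookup (var_sum {..<n} * canceller e c :: 'k mpoly) m = ?t 0 + ?t 1 + ?t 2" .
  have E: "?E (m - Poly_Mapping.single i 1) = of_int (c (Suc (yz (m - Poly_Mapping.single i 1)))) *
      fact (yz (m - Poly_Mapping.single i 1)) / ?f (m - Poly_Mapping.single i 1)"
    if "i \<in> Poly_Mapping.keys m" for i
    using minus_single_mons[OF m that] by (simp only: lookup_canceller if_True)
  have t0: "?t 0 * ?f m = fact (yz m) * of_int (c (Suc (yz m)))"
  proof (cases "0 \<in> Poly_Mapping.keys m")
    case True
    define u where "u = m - Poly_Mapping.single 0 (1 :: nat)"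
    have u: "Poly_Mapping.lookup u 1 = Poly_Mapping.lookup m 1" "Poly_Mapping.lookup u 2 = Poly_Mapping.lookup m 2"
      unfolding u_def by (rule lookup_minus_other, simp)+
    then have "yz u = yz m"
      by (simp add: yz_def)
    then show ?thesis
      using E[OF True, folded u_def] u True unfolding u_def[symmetric] by simp
  next
    case False
    \<comment> \<open>Without x_0 the monomial is in the last layer, where
      \<open>c (Suc e) = 0\<close> takes the place of the missing term.\<close>
    then have "yz m = e"
      using mons3_sum[OF m] by (simp add: in_keys_iff)
    then show ?thesis
      using False c by simp
  qed
  have ti: "?t i * ?f m = of_nat (Poly_Mapping.lookup m i) * (fact (yz m - 1) * of_int (c (yz m)))"
    if i: "i = 1 \<or> i = 2" for i
  proof (cases "i \<in> Poly_Mapping.keys m")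
    case True
    let ?m = "m - Poly_Mapping.single i 1"
    have pos: "0 < Poly_Mapping.lookup m i"
      using True by (simp add: in_keys_iff)
    have yz: "yz ?m = yz m - 1" "Suc (yz ?m) = yz m"
      using i pos by (auto simp: yz_def lookup_minus_other lookup_minus_self simp del: One_nat_def)
    have "?f m = of_nat (Poly_Mapping.lookup m i) * ?f ?m"
      using i pos fact_reduce[OF pos, where 'a = 'k]
      by (auto simp: lookup_minus_other lookup_minus_self mult_ac simp del: One_nat_def)
    moreover have "?f ?m \<noteq> 0"
      by simp
    ultimately show ?thesis
      using True E[OF True] yz by (simp add: field_simps del: One_nat_def)
  next
    case False
    then show ?thesis
      by (simp add: in_keys_iff)
  qed
  have "(?t 0 + ?t 1 + ?t 2) * ?f m = fact (yz m) * of_int (c (Suc (yz m))) +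
      of_nat (yz m) * (fact (yz m - 1) * of_int (c (yz m)))"
    unfolding distrib_right t0 using ti[of 1] ti[of 2] by (simp add: yz_def algebra_simps)
  also have "\<dots> = fact (yz m) * of_int (c (yz m) + c (Suc (yz m)))"
    using c by (cases "yz m") (simp_all add: algebra_simps)
  finally show ?thesis
    by (simp only: sum)
qed

text \<open>Within a layer all coefficients of both products carry the same factor j! / (p! q!),
  with p and q the exponents of x_1 and x_2; so cancelling a whole layer is a single equation on
  \<open>c\<close>.\<close>

lemma lookup_power_minus_canceller:
  assumes n: "3 \<le> n" and m: "m \<in> mons {0, 1, 2} e" and c: "c 0 = 0" "c (Suc e) = 0"
  shows "Poly_Mapping.lookup (var_sum {..<n} ^ e - var_sum {..<n} * canceller e c) m =
      (0 :: 'k::field_char_0) \<longleftrightarrow> int (e choose yz m) = c (yz m) + c (Suc (yz m))"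
proof -
  let ?f = "fact (Poly_Mapping.lookup m 1) * fact (Poly_Mapping.lookup m 2) :: 'k"
  have m': "m \<in> mons {..<n} e"
    using m n by (auto simp: mons_def)
  have yz: "yz m \<le> e" "Poly_Mapping.lookup m 0 = e - yz m"
    using mons3_sum[OF m] by auto
  have "Poly_Mapping.lookup m i = 0" if "i \<notin> {0, 1, 2}" for i
    using that mons_keysD[OF m] by (metis in_keys_iff subsetD)
  then have "(\<Prod>i<n. fact (Poly_Mapping.lookup m i)) = (\<Prod>i\<in>{0, 1, 2}. fact (Poly_Mapping.lookup m i) :: 'k)"
    using n by (intro prod.mono_neutral_right) auto
  also have "\<dots> = fact (e - yz m) * ?f"
    by (simp add: yz del: One_nat_def)
  finally have "Poly_Mapping.lookup (var_sum {..<n} ^ e) m * ?f * fact (e - yz m) = fact e"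
    using lookup_var_sum_power[OF finite_lessThan m', where 'k = 'k] by (simp add: mult_ac)
  also have "fact e = fact (yz m) * of_nat (e choose yz m) * (fact (e - yz m) :: 'k)"
    by (simp add: binomial_fact[OF yz(1)])
  finally have "Poly_Mapping.lookup (var_sum {..<n} ^ e) m * ?f = fact (yz m) * (of_nat (e choose yz m) :: 'k)"
    by simp
  then have "Poly_Mapping.lookup (var_sum {..<n} ^ e - var_sum {..<n} * canceller e c) m * ?f =
      fact (yz m) * (of_int (int (e choose yz m) - (c (yz m) + c (Suc (yz m)))) :: 'k)"
    using lookup_var_sum_times_canceller[OF n m c, where 'k = 'k]
    by (simp add: lookup_minus left_diff_distrib right_diff_distrib del: One_nat_def of_int_add)
  moreover have "?f \<noteq> 0"
    by simp
  ultimately have "Poly_Mapping.lookup (var_sum {..<n} ^ e - var_sum {..<n} * canceller e c) m = (0 :: 'k) \<longleftrightarrow>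
      (of_int (int (e choose yz m) - (c (yz m) + c (Suc (yz m)))) :: 'k) = 0"
    by (metis fact_nonzero mult_eq_0_iff)
  then show ?thesis
    unfolding of_int_eq_0_iff by simp
qed

text \<open>E is free of x_v, so a contribution to \<open>m\<close> can only come from x_v E, with
  x_v of exponent one. There the coefficient of the power is e times a binomial coefficient, in
  place of c_j, times the common factor.\<close>

lemma lookup_power_minus_canceller_other:
  assumes n: "3 \<le> n" and m: "m \<in> mons {..<n} e" and v: "v \<in> Poly_Mapping.keys m" "3 \<le> v"
    and c: "\<And>j. j \<in> {1..e} \<Longrightarrow> c j \<noteq> int (e * ((e - 1) choose (j - 1)))"
  shows "Poly_Mapping.lookup (var_sum {..<n} ^ e - var_sum {..<n} * canceller e c) m \<noteq>
    (0 :: 'k::field_char_0)"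
proof -
  let ?u = "m - Poly_Mapping.single v 1"
  let ?f = "fact (Poly_Mapping.lookup m 1) * fact (Poly_Mapping.lookup m 2) :: 'k"
  let ?E = "Poly_Mapping.lookup (canceller e c :: 'k mpoly)"
  have vn: "v < n"
    using v m by (auto simp: mons_def)
  have "Poly_Mapping.lookup (var_sum {..<n} * canceller e c :: 'k mpoly) m =
      (\<Sum>i\<in>{..<n} \<inter> Poly_Mapping.keys m. ?E (m - Poly_Mapping.single i 1))"
    by (simp add: lookup_var_sum_times del: One_nat_def)
  also have "\<dots> = (\<Sum>i\<in>{v}. ?E (m - Poly_Mapping.single i 1))"
  proof (rule sum.mono_neutral_right)
    show "\<forall>i\<in>{..<n} \<inter> Poly_Mapping.keys m - {v}. ?E (m - Poly_Mapping.single i 1) = 0"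
    proof
      fix i assume "i \<in> {..<n} \<inter> Poly_Mapping.keys m - {v}"
      then have "v \<in> Poly_Mapping.keys (m - Poly_Mapping.single i 1)"
        using v(1) by (auto simp: in_keys_iff lookup_minus lookup_single)
      then have "m - Poly_Mapping.single i 1 \<notin> mons {0, 1, 2} (e - 1)"
        using v(2) by (auto simp: mons_def)
      then show "?E (m - Poly_Mapping.single i 1) = 0"
        by (simp only: lookup_canceller if_False)
    qed
  qed (use v vn in auto)
  finally have L: "Poly_Mapping.lookup (var_sum {..<n} * canceller e c :: 'k mpoly) m = ?E ?u"
    by simp
  show ?thesis
  proof (cases "?u \<in> mons {0, 1, 2} (e - 1)")
    case False
    then show ?thesis
      using L lookup_var_sum_power_neq_0[OF finite_lessThan m, where 'k = 'k]
      by (simp add: lookup_minus lookup_canceller del: One_nat_def)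
  next
    case True
    define j where "j = Suc (yz ?u)"
    have "mon_degree m \<noteq> 0"
      using v(1) by (auto simp: mon_degree_def in_keys_iff)
    then have e: "1 \<le> e"
      using m by (simp add: mons_def)
    have u0: "Poly_Mapping.lookup ?u 0 + yz ?u = e - 1"
      by (rule mons3_sum[OF True])
    then have j: "1 \<le> j" "j \<le> e" "Poly_Mapping.lookup m 0 = (e - 1) - (j - 1)"
      using e v(2) by (auto simp: j_def lookup_minus_other simp del: One_nat_def)
    have u: "Poly_Mapping.lookup ?u i = Poly_Mapping.lookup m i" if "i < 3" for i
      using v(2) that by (intro lookup_minus_other) auto
    have "v \<notin> Poly_Mapping.keys ?u"
      using True v(2) by (auto simp: mons_def)
    then have "Poly_Mapping.lookup m v = 1"
      using v(1) by (simp add: in_keys_iff lookup_minus)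
    moreover have "Poly_Mapping.lookup m i = 0" if "i \<notin> {0, 1, 2}" "i \<noteq> v" for i
    proof -
      have "i \<notin> Poly_Mapping.keys ?u"
        using True that by (auto simp: mons_def)
      then show ?thesis
        using that(2) lookup_minus_other[of i v m] by (simp add: in_keys_iff del: One_nat_def)
    qed
    ultimately have one: "fact (Poly_Mapping.lookup m i) = (1 :: 'k)" if "i \<notin> {0, 1, 2}" for i
      using that by (cases "i = v") auto
    have "(\<Prod>i<n. fact (Poly_Mapping.lookup m i)) = (\<Prod>i\<in>{0, 1, 2}. fact (Poly_Mapping.lookup m i) :: 'k)"
      using n one by (intro prod.mono_neutral_right) auto
    also have "\<dots> = fact ((e - 1) - (j - 1)) * ?f"
      by (simp add: j(3) del: One_nat_def)
    finally have "Poly_Mapping.lookup (var_sum {..<n} ^ e) m * ?f * fact ((e - 1) - (j - 1)) = fact e"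
      using lookup_var_sum_power[OF finite_lessThan m, where 'k = 'k] by (simp add: mult_ac)
    also have "fact e = of_nat e * (fact (e - 1) :: 'k)"
      using e by (intro fact_reduce) simp
    also have "fact (e - 1) = fact (j - 1) * of_nat ((e - 1) choose (j - 1)) * (fact ((e - 1) - (j - 1)) :: 'k)"
      using binomial_fact[of "j - 1" "e - 1", where 'a = 'k] j(1,2) by simp
    finally have P: "Poly_Mapping.lookup (var_sum {..<n} ^ e) m * ?f =
        fact (j - 1) * (of_nat (e * ((e - 1) choose (j - 1))) :: 'k)"
      by (simp add: mult_ac)
    have "?E ?u * ?f = of_int (c j) * fact (j - 1)"
      using True u[of 1] u[of 2] by (simp add: lookup_canceller j_def del: One_nat_def)
    then have "Poly_Mapping.lookup (var_sum {..<n} ^ e - var_sum {..<n} * canceller e c) m * ?f =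
        fact (j - 1) * (of_int (int (e * ((e - 1) choose (j - 1))) - c j) :: 'k)"
      using P L by (simp add: lookup_minus algebra_simps del: One_nat_def of_nat_mult)
    moreover have "int (e * ((e - 1) choose (j - 1))) - c j \<noteq> 0"
      using c[of j] j by simp
    ultimately show ?thesis
      by (metis fact_nonzero mult_eq_0_iff mult_zero_left of_int_eq_0_iff)
  qed
qed

text \<open>A monomial of \<open>F\<close> with maximal degree in $x_1, x_2$ and then maximal degree in $x_1$ cannot
  be cancelled in $(x_0 + \dots + x_{n-1}) F$ after multiplication by $x_1$.\<close>

lemma canceller_unique:
  fixes F :: "'k::field_char_0 mpoly"
  assumes n: "3 \<le> n" and e: "1 \<le> e" and F: "Poly_Mapping.keys F \<subseteq> cancelling e J"
    and zero: "\<And>m. m \<in> cancelled e J \<Longrightarrow> Poly_Mapping.lookup (var_sum {..<n} * F) m = 0"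
  shows "F = 0"
proof (rule ccontr)
  assume "F \<noteq> 0"
  \<comment> \<open>Encodes the lexicographic order on the pair (degree in x_1, x_2; exponent of
    x_1): the exponent of x_1 is below \<open>Suc e\<close>.\<close>
  define w where "w m = yz m * Suc e + Poly_Mapping.lookup m 1" for m
  let ?S = "w ` Poly_Mapping.keys F"
  have "?S \<noteq> {}"
    using \<open>F \<noteq> 0\<close> by (simp add: keys_eq_empty)
  then have "Max ?S \<in> ?S"
    by (intro Max_in) auto
  then obtain m where m: "m \<in> Poly_Mapping.keys F" "w m = Max ?S"
    by (metis imageE)
  have max: "w u \<le> w m" if "u \<in> Poly_Mapping.keys F" for u
    using that m(2) by simp
  have mB: "m \<in> mons {0, 1, 2} (e - 1)" "Suc (yz m) \<in> J"
    using m(1) F by (auto simp: cancelling_def)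
  let ?M = "Poly_Mapping.single 1 1 + m"
  have keysM: "Poly_Mapping.keys ?M \<subseteq> {0, 1, 2}" "1 \<in> Poly_Mapping.keys ?M"
    using mons_keysD[OF mB(1)] by (auto simp: keys_add_nat)
  have "?M \<in> cancelled e J"
    using mB e by (simp add: cancelled_def mons_def keys_add_nat yz_def lookup_add lookup_single)
  then have "Poly_Mapping.lookup (var_sum {..<n} * F) ?M = 0"
    by (rule zero)
  \<comment> \<open>Replacing a factor x_0 by x_1 raises \<open>yz\<close>; replacing x_2 by x_1
    keeps \<open>yz\<close> and raises the exponent of x_1. Either contradicts maximality.\<close>
  have "Poly_Mapping.lookup F (?M - Poly_Mapping.single i 1) = 0" if "i = 0 \<or> i = 2" "i \<in> Poly_Mapping.keys ?M" for i
  proof -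
    have pos: "0 < Poly_Mapping.lookup ?M i"
      using that(2) by (simp add: in_keys_iff)
    have le: "Poly_Mapping.lookup m 1 \<le> e - 1"
      using lookup_le_mon_degree[of m 1] mB(1) by (simp add: mons_def)
    have "w m < w (?M - Poly_Mapping.single i 1)"
      using that(1) pos le
      by (auto simp: w_def yz_def lookup_minus lookup_add lookup_single)
    then have "?M - Poly_Mapping.single i 1 \<notin> Poly_Mapping.keys F"
      using max[of "?M - Poly_Mapping.single i 1"] by linarith
    then show ?thesis
      by (simp add: in_keys_iff)
  qed
  then have other: "Poly_Mapping.lookup F (?M - Poly_Mapping.single i 1) = 0"
    if "i \<in> ({..<n} \<inter> Poly_Mapping.keys ?M) - {1}" for i
    using that keysM(1) by blast
  have "Poly_Mapping.lookup (var_sum {..<n} * F) ?M =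
      (\<Sum>i\<in>{..<n} \<inter> Poly_Mapping.keys ?M. Poly_Mapping.lookup F (?M - Poly_Mapping.single i 1))"
    by (rule lookup_var_sum_times) simp
  also have "\<dots> = (\<Sum>i\<in>{1}. Poly_Mapping.lookup F (?M - Poly_Mapping.single i 1))"
    using n keysM(2) other by (intro sum.mono_neutral_right) auto
  also have "\<dots> = Poly_Mapping.lookup F m"
    by (simp del: One_nat_def)
  finally have "Poly_Mapping.lookup F m = 0"
    using \<open>Poly_Mapping.lookup (var_sum {..<n} * F) ?M = 0\<close> by simp
  then show False
    using m(1) by (simp add: in_keys_iff)
qed

section \<open>Families of minimal systems\<close>

lemma card_pures: "0 < d \<Longrightarrow> finite V \<Longrightarrow> card (pures V d) = card V"
  unfolding pures_def
  by (rule card_image) (auto intro!: inj_onI dest!: arg_cong[where f = Poly_Mapping.keys])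

context monomial_family
begin

lemma card_mons_lessThan: "card (mons {..<n} e) = (n - 1 + e) choose e"
  using card_mons[of "{..<n}" e] n by (simp add: lessThan_empty_iff)

text \<open>All elements of \<open>T\<close> contain x_n, so x_n^d is the only pure power that can
  lie in it. It does so exactly for b = 0, and thus b raises the count by one.\<close>

lemma card_A_shifted:
  assumes a: "1 \<le> a"
  shows "card A + card C = n + b + ((n - 1 + e) choose e) + card B + 1"
proof -
  have finT: "finite T"
    using finite_A by (simp add: A_def)
  have keysT: "Poly_Mapping.keys \<mu> \<subseteq> Poly_Mapping.keys m" if "m \<in> T" for m
    using that unfolding T_def by (auto simp: keys_add_nat)
  have nT: "n \<in> Poly_Mapping.keys m" if "m \<in> T" for m
    using keysT[OF that] a by (auto simp: \<mu>_def keys_add_nat)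
  have pn: "m = Poly_Mapping.single n d" if "m \<in> T" "m \<in> pures {..n} d" for m
    using nT[OF that(1)] that(2) by (auto simp: pures_def split: if_splits)
  have "card (pures {..n} d \<inter> T) + b = 1"
  proof (cases "b = 0")
    case True
    have "Poly_Mapping.single n d \<in> pures {..n} d"
      unfolding pures_def by (rule imageI) simp
    then have "pures {..n} d \<inter> T = {Poly_Mapping.single n d}"
      using pn pure_n_in_T[OF True] by blast
    then show ?thesis
      using True by simp
  next
    case False
    then have zero: "0 \<in> Poly_Mapping.keys m" if "m \<in> T" for m
      using keysT[OF that] by (auto simp: \<mu>_def keys_add_nat)
    have "pures {..n} d \<inter> T = {}"
    proof (rule equals0I)
      fix m assume m: "m \<in> pures {..n} d \<inter> T"
      then have "m = Poly_Mapping.single n d"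
        using pn by blast
      moreover have "0 \<in> Poly_Mapping.keys m"
        using zero m by blast
      ultimately show False
        using n by (simp split: if_splits)
    qed
    then show ?thesis
      using False b by simp
  qed
  moreover have "card A + card (pures {..n} d \<inter> T) = Suc n + card T"
    using card_Un_Int[of "pures {..n} d" T] finT card_pures[of d "{..n}"] d
    by (simp add: A_def pures_def)
  ultimately show ?thesis
    using card_T card_mons_lessThan by linarith
qed

lemma card_A_unshifted:
  assumes "a = 0" "b = 0" "pures {..<n} d \<inter> C = {}"
  shows "card A + card C = ((n - 1 + e) choose e) + card B + 1"
proof -
  have "A = T"
    unfolding A_def using pures_subset_T[OF assms] by (rule Un_absorb1)
  then show ?thesis
    using card_T card_mons_lessThan by simp
qed

end

definition attained :: "'k::field_char_0 itself \<Rightarrow> nat \<Rightarrow> nat \<Rightarrow> nat \<Rightarrow> bool" where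
  "attained k n d r \<longleftrightarrow>
    (\<exists>I \<in> (min_monomial_togliatti_systems n d :: 'k mpoly set set). num_generators n I = r)"

lemma (in monomial_family) attained_card_A:
  "card A \<le> (n + d - 1) choose (n - 1) \<Longrightarrow> attained TYPE('k) n d (card A)"
  using minimal_togliatti unfolding attained_def by blast

lemma attained_trivial:
  assumes "2 \<le> n" "2 \<le> d" "1 \<le> e" "a + b + e = d" "b \<le> 1" "1 \<le> a \<and> 3 \<le> n \<or> 2 \<le> a"
    and "n + b + ((n - 1 + e) choose e) + 1 \<le> (n + d - 1) choose (n - 1)"
  shows "attained TYPE('k::field_char_0) n d (n + b + ((n - 1 + e) choose e) + 1)"
proof -
  interpret monomial_family n d a b e "{}" "{}" "0 :: 'k mpoly"
    by (rule monomial_family_zero) fact+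
  have "card A = n + b + ((n - 1 + e) choose e) + 1"
    using card_A_shifted assms(6) by auto
  then show ?thesis
    using attained_card_A assms(7) by simp
qed

text \<open>Multiplication by x_1 embeds the monomials of E into the cancelled ones and misses
  x_0^(e-j) x_2^j, one for each layer.\<close>

lemma card_cancelled:
  assumes e: "1 \<le> e" and s: "1 \<le> s" and t: "t \<le> e"
  shows "card (cancelled e {s..t}) = card (cancelling e {s..t}) + (Suc t - s)"
proof -
  let ?f = "\<lambda>m. Poly_Mapping.single 1 1 + m :: nat \<Rightarrow>\<^sub>0 nat"
  let ?g = "\<lambda>j. Poly_Mapping.single 0 (e - j) + Poly_Mapping.single 2 j :: nat \<Rightarrow>\<^sub>0 nat"
  have "cancelled e {s..t} = ?f ` cancelling e {s..t} \<union> ?g ` {s..t}"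
  proof (intro equalityI subsetI)
    fix m assume m: "m \<in> cancelled e {s..t}"
    then have m3: "m \<in> mons {0, 1, 2} e" and yz: "yz m \<in> {s..t}"
      by (simp_all add: cancelled_def)
    show "m \<in> ?f ` cancelling e {s..t} \<union> ?g ` {s..t}"
    proof (cases "1 \<in> Poly_Mapping.keys m")
      case True
      let ?u = "m - Poly_Mapping.single 1 1"
      have "0 < Poly_Mapping.lookup m 1"
        using True by (simp add: in_keys_iff)
      then have "Suc (yz ?u) = yz m"
        by (simp add: yz_def lookup_minus lookup_single)
      then have "?u \<in> cancelling e {s..t}"
        using minus_single_mons[OF m3 True] yz by (simp add: cancelling_def)
      then show ?thesis
        using single_minus_single[OF True, symmetric] by (intro UnI1) (rule image_eqI)
    next
      case False
      have "Poly_Mapping.lookup m 0 = e - yz m"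
        using mons3_sum[OF m3] by linarith
      moreover have "yz m = Poly_Mapping.lookup m 2"
        using False by (simp add: yz_def in_keys_iff)
      moreover have "Poly_Mapping.lookup m i = 0" if "i \<notin> {0, 2}" for i
        using that False mons_keysD[OF m3] by (auto simp: subset_iff simp flip: not_in_keys_iff_lookup_eq_zero)
      ultimately have "m = ?g (yz m)"
        by (intro poly_mapping_eqI) (auto simp: lookup_add lookup_single when_def)
      then have "m \<in> ?g ` {s..t}"
        using yz by (rule image_eqI)
      then show ?thesis
        by (rule UnI2)
    qed
  next
    fix m assume "m \<in> ?f ` cancelling e {s..t} \<union> ?g ` {s..t}"
    then show "m \<in> cancelled e {s..t}"
    proof (elim UnE imageE)
      fix u assume m: "m = ?f u" and "u \<in> cancelling e {s..t}"
      then show ?thesis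
        unfolding m using e
        by (simp add: cancelled_def cancelling_def mons_def keys_add_nat yz_def lookup_add lookup_single)
    next
      fix j assume m: "m = ?g j" and j: "j \<in> {s..t}"
      have "Poly_Mapping.keys (?g j) \<subseteq> {0, 1, 2}"
        unfolding keys_add_nat by (auto split: if_splits)
      then show ?thesis
        unfolding m using t j by (simp add: cancelled_def mons_def yz_def lookup_add lookup_single)
    qed
  qed
  moreover have "?f ` cancelling e {s..t} \<inter> ?g ` {s..t} = {}"
  proof -
    have "?f u \<noteq> ?g j" for u j
    proof
      assume "?f u = ?g j"
      then have "Poly_Mapping.lookup (?f u) 1 = Poly_Mapping.lookup (?g j) 1"
        by (rule arg_cong)
      then show False
        by (simp add: lookup_add lookup_single)
    qed
    then show ?thesis
      by blast
  qed
  moreover have "inj_on ?g {s..t}"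
  proof (rule inj_onI)
    fix i j assume "?g i = ?g j"
    then have "Poly_Mapping.lookup (?g i) 2 = Poly_Mapping.lookup (?g j) 2"
      by (rule arg_cong)
    then show "i = j"
      by (simp add: lookup_add lookup_single)
  qed
  moreover have "inj_on ?f (cancelling e {s..t})"
    by (auto intro: inj_onI)
  moreover have "finite (cancelling e {s..t})"
    using finite_mons3 by (simp add: cancelling_def)
  ultimately show ?thesis
    by (simp add: card_Un_disjoint card_image)
qed

text \<open>Turns the hypotheses of the locale into numerical conditions on \<open>c\<close>. The
  bound \<open>2 \<le> s\<close> gives \<open>c 0 = 0\<close> and keeps the exponent 0 out of
  \<open>cancelling\<close>; for a = 0, it and \<open>t < e\<close> keep the pure powers
  uncancelled.\<close>

lemma monomial_family_canceller:
  fixes c :: "nat \<Rightarrow> int"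
  assumes n: "3 \<le> n" and d: "2 \<le> d" and e: "1 \<le> e" "a + e = d" and st: "2 \<le> s" "t \<le> e"
    and supp: "\<And>j. c j \<noteq> 0 \<longleftrightarrow> j \<in> {s..t}"
    and rel: "\<And>j. j \<le> e \<Longrightarrow> int (e choose j) = c j + c (Suc j) \<longleftrightarrow> j \<in> {s..t}"
    and other: "\<And>j. 3 < n \<Longrightarrow> j \<in> {1..e} \<Longrightarrow> c j \<noteq> int (e * ((e - 1) choose (j - 1)))"
    and pure: "1 \<le> a \<or> t < e"
  shows "monomial_family n d a 0 e (cancelling e {s..t}) (cancelled e {s..t})
    (canceller e c :: 'k::field_char_0 mpoly)"
proof
  have c: "c 0 = 0" "c (Suc e) = 0"
    using supp[of 0] supp[of "Suc e"] st by auto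
  have sub: "mons {0, 1, 2} k \<subseteq> mons {..<n} k" for k
    using n by (auto simp: mons_def)
  show "a = 0 \<and> 0 = (0 :: nat) \<and> pures {..<n} d \<inter> cancelled e {s..t} = {} \<or> 1 \<le> a \<and> 3 \<le> n \<or> 2 \<le> a"
  proof (cases "1 \<le> a")
    case True
    then show ?thesis
      using n by simp
  next
    case False
    then have "t < d" "a = 0"
      using pure e by auto
    \<comment> \<open>Pure powers lie in the extreme layers 0 and d, both outside
      \<open>{s..t}\<close>.\<close>
    moreover have "yz (Poly_Mapping.single i d) = 0 \<or> yz (Poly_Mapping.single i d) = d" for i
      by (simp add: yz_def lookup_single when_def)
    then have "Poly_Mapping.single i d \<notin> cancelled e {s..t}" for i
      using \<open>t < d\<close> st by (metis (no_types, lifting) cancelled_def atLeastAtMost_iff mem_Collect_eq not_less zero_neq_numeral le_zero_eq)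
    ultimately show ?thesis
      by (auto simp: pures_def)
  qed
  show "cancelled e {s..t} \<subseteq> mons {..<n} e" "cancelling e {s..t} \<subseteq> mons {..<n} (e - 1)"
    using sub by (auto simp: cancelled_def cancelling_def)
  show "0 \<notin> cancelling e {s..t}"
    using st by (simp add: cancelling_def yz_def)
  show "Poly_Mapping.keys (canceller e c :: 'k mpoly) = cancelling e {s..t}"
    by (rule keys_canceller[OF supp])
  show "Poly_Mapping.lookup (var_sum {..<n} ^ e - var_sum {..<n} * canceller e c) m = (0 :: 'k) \<longleftrightarrow>
      m \<in> cancelled e {s..t}" if m: "m \<in> mons {..<n} e" for m
  proof (cases "m \<in> mons {0, 1, 2} e")
    case True
    then have "yz m \<le> e"
      using mons3_sum by fastforce
    then show ?thesis
      using lookup_power_minus_canceller[OF n True c, where 'k = 'k] rel[of "yz m"] True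
      by (simp add: cancelled_def)
  next
    case False
    then obtain v where v: "v \<in> Poly_Mapping.keys m" "v \<notin> {0, 1, 2}"
      using m by (auto simp: mons_def)
    then have "3 \<le> v" "v < n"
      using m by (auto simp: mons_def)
    then show ?thesis
      using lookup_power_minus_canceller_other[OF n m v(1), of c, where 'k = 'k] other False
      by (auto simp: cancelled_def)
  qed
  show "F = 0" if "Poly_Mapping.keys F \<subseteq> cancelling e {s..t}"
      "\<And>m. m \<in> cancelled e {s..t} \<Longrightarrow> Poly_Mapping.lookup (var_sum {..<n} * F) m = 0" for F :: "'k mpoly"
    using canceller_unique[OF n e(1)] that by blast
qed (use n d e in auto)

lemma two_le_choose: "1 \<le> k \<Longrightarrow> k < m \<Longrightarrow> 2 \<le> m choose k"
proof -
  assume "1 \<le> k" "k < m"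
  then have "m choose k = ((m - 1) choose (k - 1)) + ((m - 1) choose k)" "0 < (m - 1) choose (k - 1)"
      "0 < (m - 1) choose k"
    using choose_reduce_nat[of m k] by auto
  then show ?thesis
    by linarith
qed

text \<open>The coefficients solve $c_j + c_{j+1} = \binom{e}{j}$ downwards from $c_{e+1} = 0$;
  \<open>attained_unshifted\<close> starts from $c_e = 0$ with $e = d$ instead, which spares the pure powers.\<close>

lemma attained_shifted:
  assumes e: "2 \<le> e" "e < d" and s: "2 \<le> s" "s \<le> e"
    and card: "r + (Suc e - s) = ((e + 2) choose 2) + 4" and r: "r \<le> (d + 2) choose 2"
  shows "attained TYPE('k::field_char_0) 3 d r"
proof -
  \<comment> \<open>Pascal's rule solves the recursion; truncation below \<open>s\<close> decides
    how many layers are cancelled.\<close>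
  define c where "c j = (if j \<in> {s..e} then int ((e - 1) choose (j - 1)) else 0)" for j
  have rel: "int (e choose j) = c j + c (Suc j) \<longleftrightarrow> j \<in> {s..e}" if j: "j \<le> e" for j
  proof -
    consider "s \<le> j" | "Suc j = s" | "Suc j < s"
      by linarith
    then show ?thesis
    proof cases
      case 1
      then show ?thesis
        using j s e choose_reduce_nat[of e j] by (cases "j = e") (auto simp: c_def)
    next
      case 2
      \<comment> \<open>In the layer just below \<open>s\<close> the truncated term is missing;
        being positive, it keeps that layer uncancelled.\<close>
      then have "0 < (e - 1) choose (j - 1)"
        using s by simp
      then show ?thesis
        using 2 j s e choose_reduce_nat[of e j] by (auto simp: c_def)
    next
      case 3
      then show ?thesis
        using j by (auto simp: c_def)
    qed
  qed
  interpret F: monomial_family 3 d "d - e" 0 e "cancelling e {s..e}" "cancelled e {s..e}" "canceller e c :: 'k mpoly"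
    using e s rel by (intro monomial_family_canceller) (auto simp: c_def)
  have "(3 - 1 + e) choose e = (e + 2) choose 2"
    using binomial_symmetric[of e "e + 2"] by (simp add: add.commute)
  moreover have "1 \<le> d - e"
    using e by simp
  note F.card_A_shifted[OF this]
  moreover have "card (cancelled e {s..e}) = card (cancelling e {s..e}) + (Suc e - s)"
    using e s by (intro card_cancelled) auto
  ultimately have "card F.A = r"
    using card by linarith
  then show ?thesis
    using F.attained_card_A r by (simp add: numeral_2_eq_2 numeral_3_eq_3)
qed

lemma attained_unshifted:
  assumes n: "3 \<le> n" and d: "4 \<le> d" and s: "3 \<le> s" "s \<le> d - 1"
    and r: "r + (d - s) = ((n - 1 + d) choose d) + 1"
  shows "attained TYPE('k::field_char_0) n d r"
proof -
  let ?C = "\<lambda>j. int ((d - 1) choose (j - 1))"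
  \<comment> \<open>An alternating solution of the homogeneous recursion, added to the binomial
    solution to make it vanish at d; so c_(d-1) = (d - 1) + 1 = d.\<close>
  define \<epsilon> where "\<epsilon> j = (- 1 :: int) ^ (d - 1 - j)" for j
  define c where "c j = (if j \<in> {s..d - 1} then ?C j + \<epsilon> j else 0)" for j
  have \<epsilon>: "\<epsilon> j = 1 \<or> \<epsilon> j = - 1" for j
    by (cases "even (d - 1 - j)") (simp_all add: \<epsilon>_def)
  have big: "2 \<le> ?C j" if "2 \<le> j" "j \<le> d - 1" for j
    using two_le_choose[of "j - 1" "d - 1"] that by simp
  have supp: "c j \<noteq> 0 \<longleftrightarrow> j \<in> {s..d - 1}" for j
    using big[of j] \<epsilon>[of j] s by (auto simp: c_def)
  have rel: "int (d choose j) = c j + c (Suc j) \<longleftrightarrow> j \<in> {s..d - 1}" if j: "j \<le> d" for j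
  proof -
    consider "s \<le> j" "j < d - 1" | "j = d - 1" | "j = d" | "Suc j = s" | "Suc j < s"
      using j by linarith
    then show ?thesis
    proof cases
      case 1
      then have "d - 1 - j = Suc (d - 1 - Suc j)"
        by simp
      then have "\<epsilon> j + \<epsilon> (Suc j) = 0"
        by (simp add: \<epsilon>_def)
      then show ?thesis
        using 1 s choose_reduce_nat[of d j] by (auto simp: c_def)
    next
      case 2
      then show ?thesis
        using s d choose_reduce_nat[of d j] by (auto simp: c_def \<epsilon>_def)
    next
      case 3
      then show ?thesis
        using d by (auto simp: c_def)
    next
      case 4
      \<comment> \<open>Below \<open>s\<close> the missing binomial coefficient must differ from the
        perturbation, which is 1 or -1; being at least 2 suffices, and \<open>3 \<le> s\<close>
        ensures it.\<close>
      then have "2 \<le> ?C j"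
        using s by (intro big) auto
      then show ?thesis
        using 4 s d choose_reduce_nat[of d j] \<epsilon>[of "Suc j"] by (auto simp: c_def)
    next
      case 5
      then show ?thesis
        using j by (auto simp: c_def)
    qed
  qed
  have other: "c j \<noteq> int (d * ((d - 1) choose (j - 1)))" if j: "j \<in> {1..d}" for j
  proof -
    have "0 < (d - 1) choose (j - 1)"
      using j by (intro zero_less_binomial diff_le_mono) simp
    then have C: "1 \<le> ?C j"
      by linarith
    have "4 * ?C j \<le> int d * ?C j"
      using d C by (intro mult_right_mono) auto
    moreover have "c j \<le> ?C j + 1"
      using C \<epsilon>[of j] by (auto simp: c_def)
    ultimately show ?thesis
      using C unfolding of_nat_mult by linarith
  qed
  interpret F: monomial_family n d 0 0 d "cancelling d {s..d - 1}" "cancelled d {s..d - 1}" "canceller d c :: 'k mpoly"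
    using n d s supp rel other by (intro monomial_family_canceller) auto
  have "pures {..<n} d \<inter> cancelled d {s..d - 1} = {}"
    using F.pure by auto
  note F.card_A_unshifted[OF refl refl this]
  moreover have "card (cancelled d {s..d - 1}) = card (cancelling d {s..d - 1}) + (Suc (d - 1) - s)"
    using d s by (intro card_cancelled) auto
  moreover have "Suc (d - 1) - s = d - s"
    using d by simp
  ultimately have "card F.A = r"
    using r by linarith
  moreover have "(n - 1 + d) choose d = (n + d - 1) choose (n - 1)"
    using n binomial_symmetric[of d "n - 1 + d"] by simp
  moreover have "1 \<le> d - s"
    using s d by simp
  then have "r \<le> (n - 1 + d) choose d"
    using r by linarith
  ultimately show ?thesis
    using F.attained_card_A by simp
qed

lemma generators_le_max:
  assumes "2 \<le> n" "4 \<le> d"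
  shows "2 * n + 1 \<le> (n + d - 1) choose (n - 1)"
proof -
  have "2 * n + 1 \<le> (n + 3) choose 4"
    using assms(1)
  proof (induction n rule: dec_induct)
    case (step n)
    have "2 \<le> (n + 3) choose 3"
      using step by (intro two_le_choose) auto
    moreover have "(Suc n + 3) choose 4 = ((n + 3) choose 3) + ((n + 3) choose 4)"
      using choose_reduce_nat[of "Suc n + 3" 4] by (simp add: add.commute)
    ultimately show ?case
      using step.IH by simp
  qed (simp add: binomial_symmetric[of 4 5])
  also have "\<dots> = (n + 3) choose (n - 1)"
    using assms(1) binomial_symmetric[of 4 "n + 3"] by simp
  also have "\<dots> \<le> (n + d - 1) choose (n - 1)"
    using assms(2) by (intro binomial_right_mono) simp
  finally show ?thesis .
qed

text \<open>The artinian condition supplies n + 1 pure powers, and \<open>card_nonpure_ge\<close> in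
  n + 1 variables supplies n further monomials.\<close>

lemma num_generators_bounds:
  assumes I: "I \<in> (min_monomial_togliatti_systems n d :: 'k::field_char_0 mpoly set set)"
    and n: "2 \<le> n" and d: "4 \<le> d"
  shows "2 * n + 1 \<le> num_generators n I \<and> num_generators n I \<le> (n + d - 1) choose (n - 1)"
proof -
  obtain M where M: "M \<subseteq> monomials n d" "I = Idl\<^bsub>poly_ring n\<^esub> M" "togliatti_system n d I"
    using I by (auto simp: min_monomial_togliatti_systems_def minimal_monomial_togliatti_def)
  then obtain A where A: "A \<subseteq> mons {..n} d" "M = mono ` A"
    by (auto simp: monomials_eq elim: subset_imageE)
  have gens: "num_generators n I = card A"
    unfolding M(2) A(2) by (rule num_generators_Idl_mono[OF A(1)])
  have "0 < d" "0 < n"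
    using n d by simp_all
  then have tog: "(\<forall>i\<le>n. Poly_Mapping.single i d \<in> A) \<and> card A \<le> (n + d - 1) choose (n - 1) \<and>
      (\<exists>G\<in>forms n (d - 1). G \<noteq> (0 :: 'k mpoly) \<and> Poly_Mapping.keys (var_sum {..n} * G) \<subseteq> A)"
    using M(3) togliatti_system_monomial_iff[OF A(1), where 'k = 'k] unfolding M(2) A(2) by blast
  then obtain G where G: "G \<in> forms n (d - 1)" "G \<noteq> (0 :: 'k mpoly)" "Poly_Mapping.keys (var_sum {..n} * G) \<subseteq> A"
    by blast
  let ?N = "Poly_Mapping.keys (var_sum {..n} * G) - pures {..n} d"
  have "card {..n} - 1 \<le> card ?N"
    using G n d by (intro card_nonpure_ge) (simp_all add: forms_eq)
  moreover have "pures {..n} d \<union> ?N \<subseteq> A"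
    using tog G(3) by (auto simp: pures_def)
  then have "card (pures {..n} d \<union> ?N) \<le> card A"
    using finite_subset[OF A(1)] finite_mons[of "{..n}"] by (intro card_mono) auto
  moreover have "card (pures {..n} d \<union> ?N) = card (pures {..n} d) + card ?N"
    by (intro card_Un_disjoint) (auto simp: pures_def)
  moreover have "card (pures {..n} d) = Suc n"
    using d by (simp add: card_pures)
  ultimately show ?thesis
    using tog gens by simp
qed

text \<open>The case e = 1, b = 0, E = 0: x_n^(d-1) times every variable, together with the pure
  powers.\<close>

lemma attained_min:
  assumes "2 \<le> n" "4 \<le> d"
  shows "attained TYPE('k::field_char_0) n d (2 * n + 1)"
proof -
  have eq: "n + 0 + ((n - 1 + 1) choose 1) + 1 = 2 * n + 1"
    using assms by simp
  have "attained TYPE('k) n d (n + 0 + ((n - 1 + 1) choose 1) + 1)"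
    by (rule attained_trivial[where a = "d - 1"], unfold eq)
      (use assms generators_le_max in auto)
  then show ?thesis
    by (simp only: eq)
qed

text \<open>With e = d and E = 0 one would have all monomials of degree d in x_0, ..., x_(n-1) and
  x_n^d, one more than the bound; cancelling the single layer d - 1 reaches it. For n = 2 there is
  no x_2 to cancel with, and x_2^3 times the family with e = d - 3 has the required size d +
  1.\<close>

lemma attained_max:
  assumes n: "2 \<le> n" and d: "4 \<le> d"
  shows "attained TYPE('k::field_char_0) n d ((n + d - 1) choose (n - 1))"
proof (cases "n = 2")
  case True
  obtain d' where d': "d = d' + 3"
    using d le_Suc_ex[of 3 d] by (auto simp: add.commute)
  have eq: "2 + 0 + ((2 - 1 + d') choose d') + 1 = (2 + d - 1) choose (2 - 1)"
    using binomial_symmetric[of d' "d' + 1"] by (simp add: d')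
  have "attained TYPE('k) 2 d (2 + 0 + ((2 - 1 + d') choose d') + 1)"
    by (rule attained_trivial[where a = 3], unfold eq) (use d d' in auto)
  then show ?thesis
    unfolding eq True .
next
  case False
  then have "(n - 1 + d) choose d = (n + d - 1) choose (n - 1)"
    using n binomial_symmetric[of d "n - 1 + d"] by simp
  then show ?thesis
    using attained_unshifted[of n d "d - 1", where 'k = 'k] n d False by simp
qed

text \<open>The intervals from \<open>f e\<close> to \<open>f (Suc e) - 1\<close> cover all sizes
  from 6 on. For e < d, cancelling 0 to e - 1 layers gives sizes \<open>f (Suc e) - 1\<close> down
  to \<open>f e + 1\<close>, and b = 1 with e - 1 in place of e gives \<open>f e\<close>. The
  unshifted family covers \<open>f d\<close> up to the maximum.\<close>

lemma attained_3:
  assumes d: "4 \<le> d" and r: "7 \<le> r" "r \<le> (d + 2) choose 2"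
  shows "attained TYPE('k::field_char_0) 3 d r"
proof -
  define f where "f e = ((e + 1) choose 2) + 5" for e :: nat
  have f_Suc: "f (Suc e) = f e + (e + 1)" for e
    using choose_reduce_nat[of "e + 2" 2] by (simp add: f_def)
  have f_mono: "f i \<le> f j" if "i \<le> j" for i j
    unfolding f_def using that by (simp add: binomial_right_mono)
  have f1: "f 1 = 6"
    by (simp add: f_def choose_two)
  have "\<exists>e\<ge>1. f e \<le> m \<and> m < f (Suc e)" if "6 \<le> m" for m
    using that
  proof (induction m rule: dec_induct)
    case base
    then show ?case
      using f1 f_Suc[of 1] by (intro exI[of _ 1]) simp
  next
    case (step m)
    then obtain e where e: "1 \<le> e" "f e \<le> m" "m < f (Suc e)"
      by blast
    show ?case
    proof (cases "Suc m < f (Suc e)")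
      case True
      then show ?thesis
        using e by (intro exI[of _ e]) simp
    next
      case False
      then show ?thesis
        using e f_Suc[of "Suc e"] by (intro exI[of _ "Suc e"]) simp
    qed
  qed
  from this[of r] obtain e where e: "1 \<le> e" "f e \<le> r" "r < f (Suc e)"
    using r(1) by auto
  have choose: "(e + 2) choose 2 = ((e + 1) choose 2) + (e + 1)" for e :: nat
    using choose_reduce_nat[of "e + 2" 2] by simp
  have top: "(3 + d - 1) choose (3 - 1) = (d + 2) choose 2"
    by (simp add: add.commute)
  have fe: "f e = ((e + 1) choose 2) + 5" "f (Suc e) = ((e + 2) choose 2) + 5"
    by (simp_all add: f_def)
  consider "d \<le> e" | "e < d" "r = f e" | "e < d" "f e < r" "e = 1" | "e < d" "f e < r" "2 \<le> e"
    using e by linarith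
  then show ?thesis
  proof cases
    case 1
    \<comment> \<open>Solved from the size formula of \<open>attained_unshifted\<close>;
      \<open>f d \<le> r\<close> is exactly the condition \<open>3 \<le> s\<close>.\<close>
    define s where "s = r + d - ((d + 2) choose 2) - 1"
    have "f d \<le> r"
      using f_mono[OF 1] e by simp
    then have "((d + 2) choose 2) + 4 \<le> r + d"
      using choose[of d] by (simp add: f_def)
    then have s: "s + ((d + 2) choose 2) + 1 = r + d" "3 \<le> s"
      by (simp_all add: s_def)
    then have s_le: "s \<le> d - 1"
      using r(2) by simp
    have "(3 - 1 + d) choose d = (d + 2) choose 2"
      using binomial_symmetric[of d "d + 2"] by (simp add: add.commute)
    then have "r + (d - s) = ((3 - 1 + d) choose d) + 1"
      using s s_le by linarith
    then show ?thesis
      by (rule attained_unshifted[OF order_refl d s(2) s_le])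
  next
    case 2
    then have "2 \<le> e"
      using e(1) r(1) f1 by (cases "e = 1") auto
    \<comment> \<open>The size \<open>f e\<close>, out of reach of the layers, comes from exponent e
      - 1 with the extra factor x_0.\<close>
    define e' where "e' = e - 1"
    have e': "1 \<le> e'" "e = Suc e'" "(d - e) + 1 + e' = d"
      using \<open>2 \<le> e\<close> 2 by (simp_all add: e'_def)
    have "(3 - 1 + e') choose e' = (e + 1) choose 2"
      using binomial_symmetric[of e' "e' + 2"] by (simp add: e' add.commute)
    then have eq: "3 + 1 + ((3 - 1 + e') choose e') + 1 = r"
      using 2 fe by simp
    have "attained TYPE('k) 3 d (3 + 1 + ((3 - 1 + e') choose e') + 1)"
      by (rule attained_trivial[where a = "d - e"], unfold eq top) (use e' 2 d r(2) in auto)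
    then show ?thesis
      unfolding eq .
  next
    case 3
    then have "r = 7"
      using f1 f_Suc[of 1] e(3) r(1) by simp
    then show ?thesis
      using attained_min[of 3 d, where 'k = 'k] d by simp
  next
    case 4
    define s where "s = r + Suc e - (((e + 2) choose 2) + 4)"
    have "s + (((e + 2) choose 2) + 4) = r + Suc e"
      using 4 fe choose[of e] by (simp add: s_def)
    moreover from this have "2 \<le> s" "s \<le> Suc e"
      using 4 e(3) fe choose[of e] by simp_all
    moreover have "s \<le> e \<or> s = Suc e"
      using \<open>s \<le> Suc e\<close> by linarith
    ultimately show ?thesis
    proof (elim disjE)
      assume "s \<le> e"
      then show ?thesis
        using \<open>2 \<le> s\<close> \<open>s + (((e + 2) choose 2) + 4) = r + Suc e\<close> 4 r(2)
        by (intro attained_shifted[of e d s]) auto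
    next
      \<comment> \<open>No layer is to be cancelled, so E = 0.\<close>
      assume "s = Suc e"
      then have eq: "3 + 0 + ((3 - 1 + e) choose e) + 1 = r"
        using \<open>s + (((e + 2) choose 2) + 4) = r + Suc e\<close> binomial_symmetric[of e "e + 2"]
        by (simp add: add.commute)
      have "attained TYPE('k) 3 d (3 + 0 + ((3 - 1 + e) choose e) + 1)"
        by (rule attained_trivial[where a = "d - e"], unfold eq top) (use e(1) 4 d r(2) in auto)
      then show ?thesis
        unfolding eq .
    qed
  qed
qed

lemma
  fixes k :: "'k::field_char_0 itself"
  assumes n: "2 \<le> n" and d: "4 \<le> d"
  shows togliatti_mu_eq: "togliatti_mu k n d = 2 * n + 1"
    and togliatti_rho_eq: "togliatti_rho k n d = (n + d - 1) choose (n - 1)"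
proof -
  let ?S = "num_generators n ` (min_monomial_togliatti_systems n d :: 'k mpoly set set)"
  have bounds: "2 * n + 1 \<le> r \<and> r \<le> (n + d - 1) choose (n - 1)" if "r \<in> ?S" for r
    using that num_generators_bounds[OF _ n d] by blast
  then have fin: "finite ?S"
    by (intro finite_subset[of ?S "{..(n + d - 1) choose (n - 1)}"]) auto
  show "togliatti_mu k n d = 2 * n + 1"
    unfolding togliatti_mu_def
  proof (rule Min_eqI[OF fin])
    show "2 * n + 1 \<in> ?S"
      using attained_min[OF n d, where 'k = 'k] unfolding attained_def by force
  qed (use bounds in blast)
  show "togliatti_rho k n d = (n + d - 1) choose (n - 1)"
    unfolding togliatti_rho_def
  proof (rule Max_eqI[OF fin])
    show "(n + d - 1) choose (n - 1) \<in> ?S"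
      using attained_max[OF n d, where 'k = 'k] unfolding attained_def by force
  qed (use bounds in blast)
qed

theorem proposition4p7:
  fixes n :: nat and k :: "'k::{alg_closed_field, field_char_0} itself"
  assumes "n \<ge> 2"
  shows "(\<forall>d\<ge>4. togliatti_mu k n d = 2 * n + 1) \<and>
    (\<forall>d\<ge>4. togliatti_rho k n d = (n + d - 1) choose (n - 1)) \<and>
    (n = 3 \<longrightarrow> (\<forall>d\<ge>4.
       togliatti_mu k 3 d = 7 \<and> togliatti_rho k 3 d = (d + 2) choose 2 \<and>
       (\<forall>r. 7 \<le> r \<and> r \<le> (d + 2) choose 2 \<longrightarrow>
          (\<exists>I \<in> (min_monomial_togliatti_systems 3 d :: 'k mpoly set set).
             num_generators 3 I = r))))"
proof (intro conjI impI allI)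
  show "togliatti_mu k n d = 2 * n + 1" if "4 \<le> d" for d
    by (rule togliatti_mu_eq[OF assms that])
  show "togliatti_rho k n d = (n + d - 1) choose (n - 1)" if "4 \<le> d" for d
    by (rule togliatti_rho_eq[OF assms that])
  show "togliatti_mu k 3 d = 7" if "4 \<le> d" for d
    using togliatti_mu_eq[of 3 d k] that by simp
  show "togliatti_rho k 3 d = (d + 2) choose 2" if "4 \<le> d" for d
    using togliatti_rho_eq[of 3 d k] that by (simp add: add.commute)
  show "\<exists>I \<in> (min_monomial_togliatti_systems 3 d :: 'k mpoly set set). num_generators 3 I = r"
    if "4 \<le> d" "7 \<le> r \<and> r \<le> (d + 2) choose 2" for d r
    using attained_3[of d r, where 'k = 'k] that unfolding attained_def by blast
qed

end
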